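(* Let $V$ be a nonzero finite-dimensional real normed space with $\ell_\infty$-decomposition $V=(U\oplus\ell_\infty^d)_\infty$, and let $0<p<1$. Then: (i) If $V=\ell_\infty^d$ (i.e., $U=\{0\}$), then almost all countable dense sets $S\subset V$ are Rado, but there exist countable dense sets which are strongly non-Rado. Additionally, there exist countable dense sets $S$ for which the probability that two independent random graphs $G,G'\in\mathcal{G}_p(V,S)$ are isomorphic lies strictly between $0$ and $1$. (ii) If $d=0$ (i.e., $V=U$), then all countable dense sets $S\subset V$ are strongly non-Rado. (iii) If $d>0$ and $U\neq\{0\}$, then almost all countable dense sets $S\subset V$ are strongly non-Rado, but there exist countable dense sets $S$ which are Rado. Additionally, there exist countable dense sets $S$ for which the probability that two independent random graphs $G,G'\in\mathcal{G}_p(V,S)$ are isomorphic lies strictly between $0$ and $1$.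
   Context: All normed spaces are finite-dimensional and real. $\ell_\infty^d$ is $\mathbb{R}^d$ with norm $\|(x_1,\dots,x_d)\|=\max_i|x_i|$. $\ell_\infty$-decomposition: every finite-dimensional normed space $V$ has a unique maximal subspace $W$ isometric to $\ell_\infty^d$ for some $d\ge 0$ such that there is a subspace $U$ with $V=U\oplus W$ and $\|u+w\|=\max(\|u\|,\|w\|)$ for all $u\in U$, $w\in W$. One writes $V=(U\oplus\ell_\infty^d)_\infty$ and calls this the $\ell_\infty$-decomposition of $V$. Random graph model: let $S$ be a countable dense subset of $V$ and let $\widehat{G}(V,S)$ be the graph on vertex set $S$ in which distinct $x,y\in S$ are joined if and only if $\|x-y\|<1$. For $0<p<1$, $\mathcal{G}_p(V,S)$ is the probability space of random subgraphs $G$ of $\widehat{G}(V,S)$ with vertex set $S$ in which each edge of $\widehat{G}(V,S)$ is kept independently with probability $p$. The set $S$ is Rado (for $p$) if two independent random graphs $G,G'\in\mathcal{G}_p(V,S)$ are almost surely isomorphic, and strongly non-Rado (for $p$) if two such graphs are almost surely not isomorphic. "Almost all": this refers to any fixed notion of "almost all countable dense subsets of $V$" for which almost all $S$ satisfy the following genericity condition: (if $U\neq\{0\}$) no two distinct points of $S$ have the same $U$-component, and (if $d\geq 1$) no two distinct points of $S$ have $\ell_\infty^d$-components differing by an integer (including $0$) in some coordinate. (As usual, if a property holds for almost all $S$ then so does any property it implies.) For example, one may take $S$ to be the set of points of an i.i.d. sequence sampled from a distribution on $V\cong\mathbb{R}^n$ with strictly positive density, with "almost all" meaning almost surely; or the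 union of countably many density-one Poisson processes. *)

theory Defs
  imports "HOL-Probability.Probability"
begin

section \<open>The $\ell_\infty$-decomposition\<close>

text \<open>
  Since \<open>d\<close> varies, the space $\ell_\infty^d$ is modelled by the real sequences
  supported on the indices below \<open>d\<close>. Inserting \<open>0\<close> under the maximum only matters for \<open>d = 0\<close>.
\<close>

definition linf_space :: "nat \<Rightarrow> (nat \<Rightarrow> real) set" where
  "linf_space d = {x. \<forall>i\<ge>d. x i = 0}"

definition linf_norm :: "nat \<Rightarrow> (nat \<Rightarrow> real) \<Rightarrow> real" where
  "linf_norm d x = Max (insert 0 ((\<lambda>i. \<bar>x i\<bar>) ` {..<d}))"

definition linf_isometry ::
    "'v::real_normed_vector set \<Rightarrow> nat \<Rightarrow> ('v \<Rightarrow> nat \<Rightarrow> real) \<Rightarrow> bool" where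
  "linf_isometry W d T \<longleftrightarrow>
     bij_betw T W (linf_space d) \<and>
     (\<forall>x\<in>W. \<forall>y\<in>W. \<forall>i. T (x + y) i = T x i + T y i) \<and>
     (\<forall>c. \<forall>x\<in>W. \<forall>i. T (c *\<^sub>R x) i = c * T x i) \<and>
     (\<forall>x\<in>W. linf_norm d (T x) = norm x)"

definition max_direct_sum :: "'v::real_normed_vector set \<Rightarrow> 'v set \<Rightarrow> bool" where
  "max_direct_sum U W \<longleftrightarrow>
     subspace U \<and> subspace W \<and> U \<inter> W = {0} \<and>
     (\<forall>v. \<exists>u\<in>U. \<exists>w\<in>W. v = u + w) \<and>
     (\<forall>u\<in>U. \<forall>w\<in>W. norm (u + w) = max (norm u) (norm w))"

definition linf_summand :: "'v::real_normed_vector set \<Rightarrow> bool" where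
  "linf_summand W \<longleftrightarrow> (\<exists>U d T. max_direct_sum U W \<and> linf_isometry W d T)"

text \<open>
  The isometry \<open>T\<close> is carried along only to speak about coordinates in \<open>W\<close>; it is unique up
  to permuting the coordinates and changing their signs.
\<close>

definition linf_decomposition ::
    "'v::real_normed_vector set \<Rightarrow> 'v set \<Rightarrow> nat \<Rightarrow> ('v \<Rightarrow> nat \<Rightarrow> real) \<Rightarrow> bool" where
  "linf_decomposition U W d T \<longleftrightarrow>
     max_direct_sum U W \<and> linf_isometry W d T \<and>
     (\<forall>W'. linf_summand W' \<and> W \<subseteq> W' \<longrightarrow> W' = W)"

text \<open>For a direct sum of \<open>A\<close> and \<open>B\<close>, the component of \<open>v\<close> in \<open>A\<close>.\<close>

definition component :: "'v::real_normed_vector set \<Rightarrow> 'v set \<Rightarrow> 'v \<Rightarrow> 'v" where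
  "component A B v = (THE a. a \<in> A \<and> v - a \<in> B)"


section \<open>Countable dense sets and genericity\<close>

definition countable_dense :: "'v::real_normed_vector set \<Rightarrow> bool" where
  "countable_dense S \<longleftrightarrow> countable S \<and> closure S = UNIV"

definition generic_set ::
    "'v::real_normed_vector set \<Rightarrow> 'v set \<Rightarrow> nat \<Rightarrow> ('v \<Rightarrow> nat \<Rightarrow> real) \<Rightarrow> 'v set \<Rightarrow> bool" where
  "generic_set U W d T S \<longleftrightarrow>
     (U \<noteq> {0} \<longrightarrow>
        (\<forall>x\<in>S. \<forall>y\<in>S. x \<noteq> y \<longrightarrow> component U W x \<noteq> component U W y)) \<and>
     (\<forall>x\<in>S. \<forall>y\<in>S. x \<noteq> y \<longrightarrow>
        (\<forall>i<d. T (component W U x) i - T (component W U y) i \<notin> \<int>))"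

text \<open>
  An arbitrary notion \<open>almost_all\<close> of a property holding for almost all countable dense sets:
  it is closed under implication between properties of countable dense sets, and almost all
  countable dense sets are generic.
\<close>

definition almost_all_notion ::
    "'v::real_normed_vector set \<Rightarrow> 'v set \<Rightarrow> nat \<Rightarrow> ('v \<Rightarrow> nat \<Rightarrow> real) \<Rightarrow>
     (('v set \<Rightarrow> bool) \<Rightarrow> bool) \<Rightarrow> bool" where
  "almost_all_notion U W d T almost_all \<longleftrightarrow>
     (\<forall>P Q. almost_all P \<and> (\<forall>S. countable_dense S \<and> P S \<longrightarrow> Q S) \<longrightarrow> almost_all Q) \<and>
     almost_all (generic_set U W d T)"


section \<open>Random geometric graphs\<close>

text \<open>A graph with vertex set \<open>S\<close> is given by its set of edges, each a two-element subset of \<open>S\<close>.\<close>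

definition unit_edges :: "'v::real_normed_vector set \<Rightarrow> 'v set set" where
  "unit_edges S = {{x, y} | x y. x \<in> S \<and> y \<in> S \<and> x \<noteq> y \<and> norm (x - y) < 1}"

text \<open>
  An outcome of the random graph is the family of independent indicators of the edges that
  are kept; \<open>kept_edges\<close> turns it into a graph.
\<close>

definition random_graph ::
    "real \<Rightarrow> 'v::real_normed_vector set \<Rightarrow> ('v set \<Rightarrow> bool) measure" where
  "random_graph p S = (\<Pi>\<^sub>M e\<in>unit_edges S. measure_pmf (bernoulli_pmf p))"

definition kept_edges :: "'v::real_normed_vector set \<Rightarrow> ('v set \<Rightarrow> bool) \<Rightarrow> 'v set set" where
  "kept_edges S \<omega> = {e \<in> unit_edges S. \<omega> e}"

definition graph_isomorphic :: "'v set \<Rightarrow> 'v set set \<Rightarrow> 'v set set \<Rightarrow> bool" where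
  "graph_isomorphic S G G' \<longleftrightarrow>
     (\<exists>f. bij_betw f S S \<and> (\<forall>x\<in>S. \<forall>y\<in>S. {x, y} \<in> G \<longleftrightarrow> {f x, f y} \<in> G'))"

definition random_graph_pair ::
    "real \<Rightarrow> 'v::real_normed_vector set \<Rightarrow> (('v set \<Rightarrow> bool) \<times> ('v set \<Rightarrow> bool)) measure" where
  "random_graph_pair p S = random_graph p S \<Otimes>\<^sub>M random_graph p S"

definition rado :: "real \<Rightarrow> 'v::real_normed_vector set \<Rightarrow> bool" where
  "rado p S \<longleftrightarrow>
     (AE \<omega> in random_graph_pair p S.
        graph_isomorphic S (kept_edges S (fst \<omega>)) (kept_edges S (snd \<omega>)))"

definition strongly_non_rado :: "real \<Rightarrow> 'v::real_normed_vector set \<Rightarrow> bool" where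
  "strongly_non_rado p S \<longleftrightarrow>
     (AE \<omega> in random_graph_pair p S.
        \<not> graph_isomorphic S (kept_edges S (fst \<omega>)) (kept_edges S (snd \<omega>)))"

text \<open>
  The isomorphism event is analytic and hence measurable for the completed measure, but it need
  not belong to the product sigma-algebra. Therefore its probability is taken with respect to the
  completion. Note that a positive value of \<open>measure\<close> includes measurability of the event.
\<close>

definition iso_prob :: "real \<Rightarrow> 'v::real_normed_vector set \<Rightarrow> real" where
  "iso_prob p S =
     measure (completion (random_graph_pair p S))
       {\<omega> \<in> space (random_graph_pair p S).
          graph_isomorphic S (kept_edges S (fst \<omega>)) (kept_edges S (snd \<omega>))}"

end

theory Submission
  imports Defs
begin

text \<open>
  Almost surely the graph metric of a random graph on \<open>S\<close> records the norm up to rounding: for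
  \<open>k \<ge> 2\<close>, two points of \<open>S\<close> are joined by a path of at most \<open>k\<close> edges if and only if their
  difference has norm less than \<open>k\<close> (\<open>AE_geodesic_graph\<close>). An isomorphism between two random
  graphs is therefore a step isometry, that is, a bijection of \<open>S\<close> preserving the relations
  \<open>norm (x - y) < k\<close> for all integers \<open>k \<ge> 2\<close>, and the question becomes which step isometries
  \<open>S\<close> has. If they move some infinite family of edges in only countably many ways, the graphs
  are almost surely not isomorphic, since each of these ways would have to match infinitely many
  independent pairs of edge indicators (\<open>strongly_non_radoI\<close>).

  Step isometries are rigid modulo the maximum-norm summand \<open>W\<close>. A step isometry \<open>f\<close> distorts
  distances by at most \<open>2\<close>, and this alone gives a linear isometry \<open>B\<close> such that \<open>h = B \<circ> f\<close>
  moves all points of \<open>S\<close> by a bounded amount (\<open>coarse_isometry_straightening\<close>). Finer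
  information comes from the smooth functionals, the gradients of the norm at points where it
  has a quadratic upper bound. If \<open>\<phi>\<close> is the gradient at \<open>v\<close>, then \<open>norm (z - x)\<close> is almost \<open>\<phi>
  (z - x)\<close> for \<open>z\<close> far out in direction \<open>v\<close>, so that comparing \<open>norm (z - x)\<close> and \<open>norm (z - y)\<close>
  with integers shows that \<open>\<phi> x - \<phi> y > m\<close> implies \<open>\<phi> (h x) - \<phi> (h y) \<ge> m\<close> for every integer \<open>m\<close>
  (\<open>step_displacement_monotone\<close>). If moreover \<open>\<phi>\<close> is a linear combination of smooth functionals
  other than \<open>\<phi>\<close> and \<open>- \<phi>\<close>, then its displacement \<open>\<phi> (h x) - \<phi> x\<close> is constant
  (\<open>dependent_displacement_constant\<close>). The smooth functionals that are not such combinations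
  are, up to sign, coordinates of \<open>W\<close>: any other one would split off a further line in the
  maximum norm, against the maximality of \<open>W\<close> (\<open>maximal_summand_imp_dependent\<close>). Consequently \<open>B
  (f x - f y) - (x - y)\<close> always lies in \<open>W\<close> (\<open>step_isometry_rigid\<close>). If the \<open>U\<close>-components are
  injective on \<open>S\<close>, as is trivial for \<open>d = 0\<close> and generic for \<open>U \<noteq> {0}\<close>, then \<open>f\<close> is determined
  by its values on finitely many points, there are countably many step isometries, and \<open>S\<close> is
  strongly non-Rado.

  In the directions of \<open>W\<close> only the integer parts of coordinate differences matter. If these
  differences are never integers and every \<open>U\<close>-component occurring in \<open>S\<close> occurs infinitely
  often in every open box of \<open>W\<close>-coordinates, then a back-and-forth construction that keeps
  \<open>U\<close>-components and integer parts produces an isomorphism almost surely; it can also be made to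
  fix finitely many exceptional points on which the two graphs agree
  (\<open>isomorphic_if_agree_on_exceptional\<close>). For \<open>U = {0}\<close> this covers generic sets, and for \<open>d >
  0\<close> there is always some \<open>S\<close> with these properties.

  The remaining sets arise from such a set by adding multiples of the vector \<open>e\<close> in \<open>W\<close> with all
  coordinates \<open>1\<close>. Adding the multiples by \<open>0\<close>, \<open>1/2\<close>, \<open>2\<close> and \<open>7/2\<close> creates the only pairs at
  distance exactly \<open>2\<close> or \<open>3\<close>. Step isometries preserve these distances and hence fix \<open>0\<close> and
  \<open>e/2\<close>, so the graphs are isomorphic if and only if they agree on the edge between these two
  points, which has a probability strictly between \<open>0\<close> and \<open>1\<close>. For \<open>U = {0}\<close>, adding all
  multiples \<open>n e/2\<close> makes step isometries act on the points \<open>n e\<close> as on an arithmetic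
  progression, so that the edges from \<open>n e\<close> to \<open>n e + e/2\<close> move in only countably many ways.
\<close>

section \<open>Finite-dimensional normed spaces\<close>

text \<open>
  No inner product is given, so compactness of balls and completeness are derived here from a
  finite basis.
\<close>

locale finite_dim_basis =
  fixes Bs :: "'v::real_normed_vector set"
  assumes finite_Bs: "finite Bs" and independent_Bs: "independent Bs" and span_Bs: "span Bs = UNIV"
begin

definition coord :: "'v \<Rightarrow> 'v \<Rightarrow> real" where
  "coord b v = representation Bs v b"

lemma coord_sum: "(\<Sum>b\<in>Bs. coord b v *\<^sub>R b) = v"
  unfolding coord_def
  by (rule real_vector.sum_representation_eq) (auto simp: independent_Bs span_Bs finite_Bs)

lemma linear_coord: "linear (coord b)"
  unfolding coord_def
  by (rule linearI)
    (simp_all add: real_vector.representation_add real_vector.representation_scale independent_Bs span_Bs)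

lemma coord_combination:
  assumes "b \<in> Bs"
  shows "coord b (\<Sum>a\<in>Bs. c a *\<^sub>R a) = c b"
proof -
  have "coord b (\<Sum>a\<in>Bs. c a *\<^sub>R a) = (\<Sum>a\<in>Bs. c a * coord b a)"
    using linear_coord[of b] by (simp add: linear_sum linear_scale)
  also have "\<dots> = (\<Sum>a\<in>Bs. if a = b then c a else 0)"
    by (rule sum.cong) (auto simp: coord_def real_vector.representation_basis independent_Bs)
  finally show ?thesis using assms finite_Bs by simp
qed

text \<open>
  The coefficients outside the basis are set to \<open>0\<close>, so that the cube is a product of compact
  sets in the product topology on all functions.
\<close>

definition cube :: "real \<Rightarrow> ('v \<Rightarrow> real) set" where
  "cube M = (\<Pi>\<^sub>E b\<in>UNIV. if b \<in> Bs then {-M..M} else {0})"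

lemma compact_cube: "compact (cube M)"
proof -
  have "compactin (product_topology (\<lambda>_. euclidean) UNIV) (cube M)"
    unfolding cube_def compactin_PiE by auto
  then show ?thesis by (simp add: euclidean_product_topology)
qed

definition combination :: "('v \<Rightarrow> real) \<Rightarrow> 'v" where
  "combination c = (\<Sum>b\<in>Bs. c b *\<^sub>R b)"

lemma continuous_combination: "continuous_on A combination"
  unfolding combination_def
  by (intro continuous_intros continuous_on_subset[OF continuous_on_product_coordinates]) auto

text \<open>
  All norms on a finite-dimensional space are equivalent: the norm of a combination attains a
  positive minimum on the compact boundary of the unit cube of coefficients.
\<close>

lemma coord_bounded: "\<exists>K>0. \<forall>v. \<forall>b\<in>Bs. \<bar>coord b v\<bar> \<le> K * norm v"
proof (cases "Bs = {}")
  case True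
  then show ?thesis by (auto intro: exI[of _ 1])
next
  case False
  let ?face = "\<lambda>b. {c. \<bar>c b\<bar> = (1::real)}"
  define Q where "Q = (\<Union>b\<in>Bs. cube 1 \<inter> ?face b)"
  have "closed (?face b)" for b :: 'v
    by (intro closed_Collect_eq continuous_intros) auto
  then have compQ: "compact Q"
    unfolding Q_def by (intro compact_UN compact_Int_closed compact_cube finite_Bs)
  have "(\<lambda>b. if b \<in> Bs then 1 else 0) \<in> Q"
    using False unfolding Q_def cube_def by (auto simp: PiE_iff)
  then have neQ: "Q \<noteq> {}" by auto
  have "continuous_on Q (\<lambda>c. norm (combination c))"
    by (intro continuous_intros continuous_combination)
  from continuous_attains_inf[OF compQ neQ this]
  obtain c0 where c0: "c0 \<in> Q" and min: "\<And>c. c \<in> Q \<Longrightarrow> norm (combination c0) \<le> norm (combination c)"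
    by auto
  define m where "m = norm (combination c0)"
  have "m > 0"
  proof (rule ccontr)
    assume "\<not> m > 0"
    then have z: "combination c0 = 0" by (simp add: m_def)
    from c0 obtain b where b: "b \<in> Bs" "\<bar>c0 b\<bar> = 1" unfolding Q_def by blast
    have "coord b (combination c0) = c0 b"
      unfolding combination_def using b(1) by (rule coord_combination)
    then show False using z b linear_0[OF linear_coord] by simp
  qed
  have bound: "Max ((\<lambda>b. \<bar>coord b v\<bar>) ` Bs) * m \<le> norm v" for v
  proof -
    define s where "s = Max ((\<lambda>b. \<bar>coord b v\<bar>) ` Bs)"
    have le: "\<bar>coord b v\<bar> \<le> s" if "b \<in> Bs" for b
      unfolding s_def using that finite_Bs by auto
    have "s \<in> (\<lambda>b. \<bar>coord b v\<bar>) ` Bs"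
      unfolding s_def using finite_Bs False by (intro Max_in) auto
    then obtain b0 where b0: "b0 \<in> Bs" "s = \<bar>coord b0 v\<bar>" by auto
    show ?thesis
    proof (cases "s = 0")
      case True
      then show ?thesis unfolding s_def by simp
    next
      case nz: False
      then have spos: "s > 0" using b0 by auto
      define c where "c = (\<lambda>b. if b \<in> Bs then coord b v / s else 0)"
      have "\<bar>c b\<bar> \<le> 1" if "b \<in> Bs" for b
        using le[OF that] that spos unfolding c_def by simp
      then have "c \<in> cube 1"
        unfolding cube_def by (simp add: PiE_iff abs_le_iff) (simp add: c_def minus_le_iff)
      moreover have "\<bar>c b0\<bar> = 1" unfolding c_def using b0 spos by simp
      ultimately have "c \<in> Q" unfolding Q_def using b0(1) by blast
      from min[OF this] have "m \<le> norm (combination c)" by (simp add: m_def)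
      also have "combination c = (1/s) *\<^sub>R v"
        unfolding combination_def c_def
        by (subst (2) coord_sum[symmetric]) (simp add: scaleR_sum_right)
      also have "norm \<dots> = norm v / s" using spos by simp
      finally show ?thesis unfolding s_def[symmetric] using spos by (simp add: field_simps)
    qed
  qed
  show ?thesis
  proof (intro exI[of _ "1/m"] conjI allI ballI)
    show "1/m > 0" using \<open>m > 0\<close> by simp
    fix v b assume b: "b \<in> Bs"
    then have "\<bar>coord b v\<bar> \<le> Max ((\<lambda>b. \<bar>coord b v\<bar>) ` Bs)"
      using finite_Bs by auto
    then have "\<bar>coord b v\<bar> * m \<le> norm v"
      using bound[of v] \<open>m > 0\<close> by (meson less_imp_le mult_right_mono order_trans)
    then show "\<bar>coord b v\<bar> \<le> 1/m * norm v" using \<open>m > 0\<close> by (simp add: field_simps)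
  qed
qed

lemma continuous_coord: "b \<in> Bs \<Longrightarrow> continuous_on A (coord b)"
proof -
  assume b: "b \<in> Bs"
  obtain K where K: "\<And>v b. b \<in> Bs \<Longrightarrow> \<bar>coord b v\<bar> \<le> K * norm v" using coord_bounded by blast
  have "bounded_linear (coord b)"
    by (intro bounded_linear.intro linear_coord bounded_linear_axioms.intro exI[of _ K])
      (use K[OF b] in \<open>simp add: mult.commute\<close>)
  then show ?thesis by (rule linear_continuous_on)
qed

lemma compact_ball: "compact (cball a r :: 'v set)"
proof -
  obtain K where K: "K > 0" "\<And>v b. b \<in> Bs \<Longrightarrow> \<bar>coord b v\<bar> \<le> K * norm v" using coord_bounded by blast
  define M where "M = K * (norm a + \<bar>r\<bar>)"
  have "cball a r \<subseteq> combination ` cube M"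
  proof
    fix v assume v: "v \<in> cball a r"
    then have "norm v \<le> norm a + \<bar>r\<bar>"
      using norm_triangle_sub[of v a] by (auto simp: dist_norm norm_minus_commute)
    then have "\<bar>coord b v\<bar> \<le> M" if "b \<in> Bs" for b
      using K(2)[OF that, of v] K(1) unfolding M_def by (meson less_imp_le mult_left_mono order_trans)
    then have "(\<lambda>b. if b \<in> Bs then coord b v else 0) \<in> cube M"
      unfolding cube_def by (simp add: PiE_iff abs_le_iff minus_le_iff)
    moreover have "combination (\<lambda>b. if b \<in> Bs then coord b v else 0) = v"
      unfolding combination_def by (subst (2) coord_sum[symmetric]) simp
    ultimately show "v \<in> combination ` cube M" by (rule_tac image_eqI[OF sym])
  qed
  then have "cball a r = combination ` cube M \<inter> cball a r" by blast
  moreover have "compact (combination ` cube M \<inter> cball a r)"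
    by (intro compact_Int_closed compact_continuous_image continuous_combination compact_cube closed_cball)
  ultimately show ?thesis by simp
qed

lemma Cauchy_imp_convergent:
  fixes X :: "nat \<Rightarrow> 'v"
  assumes "Cauchy X"
  shows "\<exists>l. X \<longlonglongrightarrow> l"
proof -
  from cauchy_imp_bounded[OF assms] obtain a r where "range X \<subseteq> cball a r"
    using bounded_subset_cball by blast
  then have "\<forall>n. X n \<in> cball a r" by blast
  with compact_imp_complete[OF compact_ball[of a r]] assms show ?thesis
    unfolding complete_def by blast
qed

lemma countable_dense_exists: "\<exists>D::'v set. countable_dense D"
proof -
  define D where "D = combination ` (\<Pi>\<^sub>E b\<in>Bs. \<rat>)"
  have "countable (\<Pi>\<^sub>E b\<in>Bs. (\<rat>::real set))"
    using finite_Bs countable_rat by (rule countable_PiE)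
  then have "countable D"
    unfolding D_def by (rule countable_image)
  moreover have "closure D = UNIV"
  proof -
    have "\<exists>y\<in>D. dist y x < e" if "e > 0" for x e
    proof -
      define L where "L = 1 + (\<Sum>b\<in>Bs. norm b)"
      have L: "L > 0" unfolding L_def by (smt (verit) norm_ge_zero sum_nonneg)
      have "\<exists>q\<in>\<rat>. \<bar>q - coord b x\<bar> < e / L" for b
      proof -
        have "e / L > 0" using that L by simp
        then have "coord b x - e/L < coord b x + e/L" by linarith
        from Rats_dense_in_real[OF this]
        obtain q where "q \<in> \<rat>" "coord b x - e/L < q" "q < coord b x + e/L" by blast
        then show ?thesis by (intro bexI[of _ q]) auto
      qed
      then obtain q where q: "\<And>b. q b \<in> \<rat>" "\<And>b. \<bar>q b - coord b x\<bar> < e / L" by metis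
      define y where "y = combination (restrict q Bs)"
      have "y \<in> D" unfolding D_def y_def by (intro imageI) (auto simp: q)
      have "y - x = (\<Sum>b\<in>Bs. (q b - coord b x) *\<^sub>R b)"
        unfolding y_def combination_def
        by (subst (2) coord_sum[symmetric]) (simp add: sum_subtractf[symmetric] scaleR_diff_left)
      then have "norm (y - x) \<le> (\<Sum>b\<in>Bs. norm ((q b - coord b x) *\<^sub>R b))"
        by (simp only: norm_sum)
      also have "\<dots> \<le> (\<Sum>b\<in>Bs. e / L * norm b)"
        unfolding norm_scaleR by (intro sum_mono mult_right_mono less_imp_le q(2) norm_ge_zero)
      also have "\<dots> = e / L * (L - 1)" unfolding L_def by (simp add: sum_distrib_left)
      also have "\<dots> < e" using L that by (simp add: field_simps)
      finally show ?thesis using \<open>y \<in> D\<close> by (auto simp: dist_norm)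
    qed
    then show ?thesis by (auto simp: closure_approachable)
  qed
  ultimately show ?thesis unfolding countable_dense_def by blast
qed

end

section \<open>Smooth functionals\<close>

text \<open>
  The two bounds together say that \<open>\<phi>\<close> is a subgradient of the norm at \<open>v\<close> for which the
  first-order expansion has a quadratic error. Such points are easy to find by minimising, and
  scaling makes the error disappear at infinity.
\<close>

definition smooth_at :: "('v::real_normed_vector \<Rightarrow> real) \<Rightarrow> 'v \<Rightarrow> real \<Rightarrow> bool" where
  "smooth_at \<phi> v C \<longleftrightarrow> linear \<phi> \<and> (\<forall>x. \<phi> x \<le> norm x) \<and>
     (\<forall>h. norm (v + h) \<le> \<phi> (v + h) + C * (norm h)\<^sup>2)"

definition smooth_functionals :: "('v::real_normed_vector \<Rightarrow> real) set" where
  "smooth_functionals = {\<phi>. \<exists>v C. smooth_at \<phi> v C}"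

lemma smooth_functionalsE:
  assumes "\<phi> \<in> smooth_functionals"
  obtains v C where "linear \<phi>" "\<And>x. \<phi> x \<le> norm x"
    "\<And>h. norm (v + h) \<le> \<phi> (v + h) + C * (norm h)\<^sup>2" "\<phi> v = norm v" "C \<ge> 0"
proof -
  obtain v C where sm: "smooth_at \<phi> v C" using assms by (auto simp: smooth_functionals_def)
  have le: "norm (v + h) \<le> \<phi> (v + h) + max C 0 * (norm h)\<^sup>2" for h
  proof -
    have "C * (norm h)\<^sup>2 \<le> max C 0 * (norm h)\<^sup>2" by (intro mult_right_mono) auto
    then show ?thesis using sm unfolding smooth_at_def by (smt (verit))
  qed
  show ?thesis
    by (rule that[of v "max C 0"])
      (use sm le[of 0] le in \<open>auto simp: smooth_at_def intro: antisym\<close>)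
qed

lemma smooth_functional_linear: "\<phi> \<in> smooth_functionals \<Longrightarrow> linear \<phi>"
  by (erule smooth_functionalsE)

lemma smooth_functional_le: "\<phi> \<in> smooth_functionals \<Longrightarrow> \<phi> x \<le> norm x"
  by (erule smooth_functionalsE)

lemma smooth_functional_abs_le: "\<phi> \<in> smooth_functionals \<Longrightarrow> \<bar>\<phi> x\<bar> \<le> norm x"
  using smooth_functional_le[of \<phi> x] smooth_functional_le[of \<phi> "-x"]
  by (simp add: smooth_functional_linear linear_neg)

lemma smooth_functional_minus: "\<phi> \<in> smooth_functionals \<Longrightarrow> (\<lambda>x. - \<phi> x) \<in> smooth_functionals"
proof -
  assume \<phi>: "\<phi> \<in> smooth_functionals"
  then have lin: "linear \<phi>" by (rule smooth_functional_linear)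
  obtain v C where "smooth_at \<phi> v C" using \<phi> by (auto simp: smooth_functionals_def)
  then have "smooth_at (\<lambda>x. - \<phi> x) (- v) C"
    unfolding smooth_at_def
  proof (intro conjI allI; elim conjE)
    show "linear (\<lambda>x. - \<phi> x)" using lin by (rule linear_compose_neg)
    fix x
    assume a: "\<forall>x. \<phi> x \<le> norm x" "\<forall>h. norm (v + h) \<le> \<phi> (v + h) + C * (norm h)\<^sup>2"
    show "- \<phi> x \<le> norm x" using a(1)[rule_format, of "-x"] by (simp add: linear_neg[OF lin])
    show "norm (- v + x) \<le> - \<phi> (- v + x) + C * (norm x)\<^sup>2"
      using a(2)[rule_format, of "-x"] linear_neg[OF lin, of "v - x"] norm_minus_cancel[of "v - x"] by simp
  qed
  then show ?thesis by (auto simp: smooth_functionals_def)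
qed

text \<open>
  Scaling the expansion at \<open>v\<close> to the point \<open>t *\<^sub>R v\<close> divides the quadratic error by \<open>t\<close>. Hence,
  far out in direction \<open>v\<close>, norms are values of \<open>\<phi>\<close> up to a small error.
\<close>

lemma smooth_at_far:
  assumes "linear \<phi>" and le: "\<And>h. norm (v + h) \<le> \<phi> (v + h) + C * (norm h)\<^sup>2" and t: "t > 0"
  shows "norm x \<le> \<phi> x + C * (norm (x - t *\<^sub>R v))\<^sup>2 / t"
proof -
  let ?h = "(1/t) *\<^sub>R (x - t *\<^sub>R v)"
  have e: "v + ?h = (1/t) *\<^sub>R x" using t by (simp add: scaleR_diff_right)
  have "norm x / t \<le> \<phi> x / t + C * (norm (x - t *\<^sub>R v) / t)\<^sup>2"
    using le[of ?h] t unfolding e by (simp add: linear_scale[OF assms(1)])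
  then have "t * (norm x / t) \<le> t * (\<phi> x / t + C * (norm (x - t *\<^sub>R v) / t)\<^sup>2)"
    using t by (intro mult_left_mono) auto
  also have "\<dots> = \<phi> x + C * (norm (x - t *\<^sub>R v))\<^sup>2 / t"
    using t by (simp add: distrib_left power_divide power2_eq_square)
  finally show ?thesis using t by simp
qed

text \<open>
  By convexity an upper bound of this form forces the matching lower bound: \<open>v\<close> lies between \<open>v
  + h\<close> and \<open>v - t *\<^sub>R h\<close>, and the upper bound applies to the latter.
\<close>

lemma quadratic_upper_bound_imp_smooth_at:
  assumes lin: "linear \<phi>" and up: "\<And>h. norm (v + h) \<le> norm v + \<phi> h + C * (norm h)\<^sup>2"
  shows "smooth_at \<phi> v C"
proof -
  have low: "norm v + \<phi> h \<le> norm (v + h)" for h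
  proof (rule field_le_epsilon)
    fix e :: real assume e: "e > 0"
    define t where "t = e / (1 + \<bar>C\<bar> * (norm h)\<^sup>2)"
    have d: "1 + \<bar>C\<bar> * (norm h)\<^sup>2 > 0" by (smt (verit) mult_nonneg_nonneg zero_le_power2 abs_ge_zero)
    have t: "t > 0" unfolding t_def using e d by simp
    have "t * (\<bar>C\<bar> * (norm h)\<^sup>2) \<le> t * (1 + \<bar>C\<bar> * (norm h)\<^sup>2)" using t by (intro mult_left_mono) auto
    also have "\<dots> = e" unfolding t_def using d by simp
    finally have te: "t * (\<bar>C\<bar> * (norm h)\<^sup>2) \<le> e" .
    have "(1 + t) *\<^sub>R v = t *\<^sub>R (v + h) + (v - t *\<^sub>R h)" by (simp add: algebra_simps)
    then have "(1 + t) * norm v \<le> t * norm (v + h) + norm (v - t *\<^sub>R h)"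
      using norm_triangle_ineq[of "t *\<^sub>R (v + h)" "v - t *\<^sub>R h"] t
      by (metis abs_of_pos add_pos_pos norm_scaleR zero_less_one)
    moreover have "norm (v - t *\<^sub>R h) \<le> norm v - t * \<phi> h + C * (t * norm h)\<^sup>2"
      using up[of "- t *\<^sub>R h"] t by (simp add: linear_neg[OF lin] linear_scale[OF lin])
    ultimately have "t * norm v \<le> t * norm (v + h) - t * \<phi> h + t * (t * (C * (norm h)\<^sup>2))"
      by (simp add: algebra_simps power2_eq_square)
    also have "t * (t * (C * (norm h)\<^sup>2)) \<le> t * e"
    proof (intro mult_left_mono)
      have "t * (C * (norm h)\<^sup>2) \<le> t * (\<bar>C\<bar> * (norm h)\<^sup>2)"
        using t by (intro mult_left_mono mult_right_mono) auto
      then show "t * (C * (norm h)\<^sup>2) \<le> e" using te by linarith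
    qed (use t in auto)
    finally have "t * norm v \<le> t * (norm (v + h) - \<phi> h + e)" by (simp add: algebra_simps)
    then show "norm v + \<phi> h \<le> norm (v + h) + e" using t by simp
  qed
  have pv: "\<phi> v = norm v"
  proof -
    have "norm v + \<phi> v \<le> norm (v + v)" by (rule low)
    also have "norm (v + v) = 2 * norm v" by (simp flip: scaleR_2)
    finally show ?thesis using low[of "-v"] by (simp add: linear_neg[OF lin])
  qed
  have "\<phi> x \<le> norm x" for x
    using low[of "x - v"] pv by (simp add: linear_diff[OF lin])
  then show ?thesis
    unfolding smooth_at_def using lin up pv by (simp add: linear_add[OF lin])
qed

context finite_dim_basis
begin

text \<open>
  Touch the norm from above: subtract it from a large multiple of a Euclidean square centred at
  \<open>w\<close>. At a minimiser \<open>v\<close> of the difference the norm has a quadratic upper bound, and \<open>v\<close> is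
  close to \<open>w\<close> when the multiple is large.
\<close>

lemma smooth_functionals_norming:
  fixes w :: 'v
  assumes e: "e > 0"
  shows "\<exists>\<phi>\<in>smooth_functionals. \<phi> w \<ge> norm w - e"
proof -
  obtain K where K: "K > 0" "\<And>v b. b \<in> Bs \<Longrightarrow> \<bar>coord b v\<bar> \<le> K * norm v" using coord_bounded by blast
  define q where "q = (\<lambda>v. \<Sum>b\<in>Bs. (coord b v)\<^sup>2)"
  define L where "L = 1 + (\<Sum>b\<in>Bs. (norm b)\<^sup>2)"
  have L: "L > 0" unfolding L_def by (smt (verit) zero_le_power2 sum_nonneg)
  have q_upper: "q h \<le> (real (card Bs) * K\<^sup>2) * (norm h)\<^sup>2" for h
  proof -
    have "q h \<le> (\<Sum>b\<in>Bs. (K * norm h)\<^sup>2)"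
      unfolding q_def
    proof (intro sum_mono)
      fix b assume "b \<in> Bs"
      from K(2)[OF this, of h] have "\<bar>coord b h\<bar>\<^sup>2 \<le> (K * norm h)\<^sup>2" by (intro power_mono) auto
      then show "(coord b h)\<^sup>2 \<le> (K * norm h)\<^sup>2" by simp
    qed
    then show ?thesis by (simp add: power_mult_distrib algebra_simps)
  qed
  have q_lower: "(norm h)\<^sup>2 \<le> L * q h" for h
  proof -
    have "norm h \<le> (\<Sum>b\<in>Bs. \<bar>coord b h\<bar> * norm b)"
      by (subst (1) coord_sum[symmetric], rule order_trans[OF norm_sum]) simp
    then have "(norm h)\<^sup>2 \<le> (\<Sum>b\<in>Bs. \<bar>coord b h\<bar> * norm b)\<^sup>2" by (intro power_mono) auto
    also have "\<dots> \<le> (\<Sum>b\<in>Bs. \<bar>coord b h\<bar>\<^sup>2) * (\<Sum>b\<in>Bs. (norm b)\<^sup>2)"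
      by (rule Cauchy_Schwarz_ineq_sum)
    also have "\<dots> \<le> q h * L" unfolding q_def L_def by (simp add: distrib_left sum_nonneg)
    finally show ?thesis by (simp add: mult.commute)
  qed
  \<comment> \<open>With this \<open>C\<close> the penalty exceeds \<open>norm (x - w)\<close> outside the ball of radius \<open>e / 2\<close>, so the
    minimum over the ball is a global one.\<close>
  define C where "C = 2 * L / e"
  have C: "C > 0" unfolding C_def using L e by simp
  define R where "R = e / 2"
  define F where "F = (\<lambda>v. C * q (v - w) - norm v)"
  have "continuous_on (cball w R) F"
    unfolding F_def q_def
    by (intro continuous_intros continuous_on_compose2[OF continuous_coord[of _ UNIV]]) auto
  with compact_ball[of w R] obtain v where v: "v \<in> cball w R" and vmin: "\<And>x. x \<in> cball w R \<Longrightarrow> F v \<le> F x"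
    using continuous_attains_inf[of "cball w R" F] e unfolding R_def by force
  have q0: "q 0 = 0" unfolding q_def by (simp add: linear_0[OF linear_coord])
  have Fmin: "F v \<le> F x" for x
  proof (cases "x \<in> cball w R")
    case True then show ?thesis by (rule vmin)
  next
    case False
    then have far: "norm (x - w) > R" by (simp add: dist_norm norm_minus_commute)
    have "C * q (x - w) \<ge> C * ((norm (x - w))\<^sup>2 / L)"
      using q_lower[of "x - w"] C L by (intro mult_left_mono) (auto simp: field_simps)
    also have "C * ((norm (x - w))\<^sup>2 / L) = (norm (x - w) / R) * norm (x - w)"
      unfolding C_def R_def using L e by (simp add: field_simps power2_eq_square)
    also have "\<dots> \<ge> 1 * norm (x - w)"
      using far e unfolding R_def by (intro mult_right_mono) (auto simp: field_simps)
    finally have "F x \<ge> F w"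
      unfolding F_def using norm_triangle_ineq2[of x w] by (simp add: q0)
    moreover have "F v \<le> F w" using e by (intro vmin) (simp add: R_def)
    ultimately show ?thesis by linarith
  qed
  define \<phi> where "\<phi> = (\<lambda>h. 2 * C * (\<Sum>b\<in>Bs. coord b (v - w) * coord b h))"
  have lin: "linear \<phi>"
    unfolding \<phi>_def
    by (rule linearI)
      (simp_all add: linear_add[OF linear_coord] linear_scale[OF linear_coord] sum.distrib
        sum_distrib_left algebra_simps)
  have qadd: "q (a + h) = q a + 2 * (\<Sum>b\<in>Bs. coord b a * coord b h) + q h" for a h
    unfolding q_def
    by (simp add: linear_add[OF linear_coord] power2_sum sum.distrib sum_distrib_left algebra_simps)
  have "norm (v + h) \<le> norm v + \<phi> h + (C * (real (card Bs) * K\<^sup>2)) * (norm h)\<^sup>2" for h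
  proof -
    have eq: "v + h - w = (v - w) + h" by simp
    from Fmin[of "v + h"] have "norm (v + h) \<le> norm v + C * (q (v - w + h) - q (v - w))"
      unfolding F_def eq by (simp add: algebra_simps)
    also have "\<dots> = norm v + \<phi> h + C * q h"
      unfolding qadd \<phi>_def by (simp add: algebra_simps)
    also have "C * q h \<le> C * ((real (card Bs) * K\<^sup>2) * (norm h)\<^sup>2)"
      using q_upper C by (intro mult_left_mono) auto
    finally show ?thesis by (simp add: mult.assoc)
  qed
  from quadratic_upper_bound_imp_smooth_at[OF lin this]
  have sm: "smooth_at \<phi> v (C * (real (card Bs) * K\<^sup>2))" .
  then have in_smooth: "\<phi> \<in> smooth_functionals" by (auto simp: smooth_functionals_def)
  have "norm v \<le> \<phi> v" using sm unfolding smooth_at_def by (metis add.right_neutral mult_zero_right norm_zero power_zero_numeral)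
  moreover have "\<phi> v - \<phi> w \<le> norm (v - w)"
    using smooth_functional_le[OF in_smooth, of "v - w"] by (simp add: linear_diff[OF lin])
  moreover have "norm (v - w) \<le> e / 2" using v by (simp add: R_def dist_norm norm_minus_commute)
  moreover have "norm w \<le> norm v + norm (v - w)" using norm_triangle_sub[of w v] by (simp add: norm_minus_commute)
  ultimately have "\<phi> w \<ge> norm w - e" by linarith
  with in_smooth show ?thesis by blast
qed

end

lemma finite_dim_basis_exists:
  assumes "\<exists>B :: 'v::real_normed_vector set. finite B \<and> span B = UNIV"
  shows "\<exists>Bs :: 'v set. finite_dim_basis Bs"
proof -
  obtain B :: "'v set" where B: "finite B" "span B = UNIV" using assms by blast
  obtain C where "C \<subseteq> B" "independent C" "B \<subseteq> span C"
    by (rule maximal_independent_subset)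
  moreover have "span C = UNIV"
    using span_minimal[OF \<open>B \<subseteq> span C\<close> subspace_span] B(2) by auto
  moreover have "finite C"
    using \<open>C \<subseteq> B\<close> B(1) by (rule finite_subset)
  ultimately show ?thesis unfolding finite_dim_basis_def by blast
qed

section \<open>Coarse isometries\<close>

lemma dense_approx:
  assumes "closure S = UNIV" "e > 0"
  obtains s where "s \<in> S" "norm (s - x) < e"
  using assms closure_approachable[of x S] by (auto simp: dist_norm)

text \<open>
  The functions \<open>a n\<close> lie in a product of compact intervals, so they have a cluster point. Every
  closed condition satisfied by all of them, or eventually by all of them, passes to the cluster
  point.
\<close>

lemma horofunction_exists:
  fixes w :: "nat \<Rightarrow> 'v::real_normed_vector" and b :: 'v
  defines "a \<equiv> \<lambda>n y. norm (y - w n) - norm (b - w n)"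
  shows "\<exists>\<eta>. convex_on UNIV \<eta> \<and> (\<forall>x y. \<eta> x - \<eta> y \<le> norm (x - y)) \<and> \<eta> b = 0 \<and>
    (\<forall>y l u. (\<forall>\<^sub>F n in sequentially. l \<le> a n y \<and> a n y \<le> u) \<longrightarrow> l \<le> \<eta> y \<and> \<eta> y \<le> u)"
proof -
  define Q where "Q = (\<Pi>\<^sub>E y\<in>UNIV. {- norm (y - b)..norm (y - b)})"
  have "compactin (product_topology (\<lambda>_. euclidean) UNIV) Q"
    unfolding Q_def compactin_PiE by auto
  then have compQ: "compact Q" by (simp add: euclidean_product_topology)
  have bound: "a n x - a n y \<le> norm (x - y)" for n x y
    unfolding a_def using norm_triangle_ineq2[of "x - w n" "y - w n"] by simp
  have ab: "a n b = 0" for n by (simp add: a_def)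
  have inQ: "a n \<in> Q" for n
    unfolding Q_def using bound[of n _ b] bound[of n b]
    by (auto simp: PiE_iff ab norm_minus_commute minus_le_iff)
  have "eventually (\<lambda>g. g \<in> Q) (filtermap a sequentially)"
    by (simp add: eventually_filtermap inQ)
  moreover have "filtermap a sequentially \<noteq> bot" by (simp add: filtermap_bot_iff)
  ultimately obtain \<eta> where cluster: "inf (nhds \<eta>) (filtermap a sequentially) \<noteq> bot"
    using compQ unfolding compact_filter by blast
  have closed_transfer: "\<eta> \<in> C" if C: "closed C" "\<forall>\<^sub>F n in sequentially. a n \<in> C" for C
  proof (rule ccontr)
    assume "\<eta> \<notin> C"
    then have "eventually (\<lambda>g. g \<in> -C) (nhds \<eta>)"
      using C(1) by (intro eventually_nhds_in_open) auto
    moreover have "eventually (\<lambda>g. g \<in> C) (filtermap a sequentially)"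
      using C(2) by (simp add: eventually_filtermap)
    ultimately have "eventually (\<lambda>_. False) (inf (nhds \<eta>) (filtermap a sequentially))"
      unfolding eventually_inf by (intro exI[of _ "\<lambda>g. g \<in> -C"] exI[of _ "\<lambda>g. g \<in> C"]) auto
    then show False using cluster by (simp add: eventually_False)
  qed
  have "convex_on UNIV \<eta>"
  proof (intro convex_onI)
    fix t :: real and x y :: 'v
    assume t: "0 < t" "t < 1"
    define C where "C = {g. g ((1 - t) *\<^sub>R x + t *\<^sub>R y) \<le> (1 - t) * g x + t * (g y :: real)}"
    have "closed C" unfolding C_def by (intro closed_Collect_le continuous_intros) auto
    moreover have "a n \<in> C" for n
    proof -
      have "(1 - t) *\<^sub>R x + t *\<^sub>R y - w n = (1 - t) *\<^sub>R (x - w n) + t *\<^sub>R (y - w n)"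
        by (simp add: algebra_simps)
      then have "norm ((1 - t) *\<^sub>R x + t *\<^sub>R y - w n) \<le> (1 - t) * norm (x - w n) + t * norm (y - w n)"
        using norm_triangle_ineq[of "(1 - t) *\<^sub>R (x - w n)" "t *\<^sub>R (y - w n)"] t by simp
      then show ?thesis unfolding C_def a_def by (simp add: algebra_simps)
    qed
    ultimately have "\<eta> \<in> C" by (intro closed_transfer) auto
    then show "\<eta> ((1 - t) *\<^sub>R x + t *\<^sub>R y) \<le> (1 - t) * \<eta> x + t * \<eta> y" by (simp add: C_def)
  qed auto
  moreover have "\<eta> x - \<eta> y \<le> norm (x - y)" for x y
  proof -
    have "closed {g. g x - g y \<le> norm (x - y)}" by (intro closed_Collect_le continuous_intros) auto
    from closed_transfer[OF this] bound show ?thesis by simp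
  qed
  moreover have "\<eta> b = 0"
  proof -
    have "closed {g. g b = (0::real)}" by (intro closed_Collect_eq continuous_intros) auto
    from closed_transfer[OF this] ab show ?thesis by simp
  qed
  moreover have "l \<le> \<eta> y \<and> \<eta> y \<le> u" if "\<forall>\<^sub>F n in sequentially. l \<le> a n y \<and> a n y \<le> u" for y l u
  proof -
    have "closed {g. l \<le> g y \<and> g y \<le> u}" by (intro closed_Collect_conj closed_Collect_le continuous_intros) auto
    from closed_transfer[OF this] that show ?thesis by simp
  qed
  ultimately show ?thesis by blast
qed

text \<open>
  A convex function that increases somewhere grows at least linearly along the corresponding
  ray.
\<close>

lemma bounded_convex_imp_constant:
  fixes s :: "'v::real_normed_vector \<Rightarrow> real"
  assumes conv: "convex_on UNIV s" and bd: "\<And>x. \<bar>s x\<bar> \<le> C"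
  shows "s x = s y"
proof -
  have "s x \<le> s y" for x y
  proof (rule ccontr)
    assume "\<not> s x \<le> s y"
    then have d: "s x - s y > 0" by simp
    have C: "C \<ge> 0" using bd[of 0] by linarith
    define t where "t = 1 + 2 * C / (s x - s y)"
    have t: "t \<ge> 1" unfolding t_def using d C by simp
    define z where "z = y + t *\<^sub>R (x - y)"
    have "x = (1 - 1/t) *\<^sub>R y + (1/t) *\<^sub>R z" unfolding z_def using t by (simp add: algebra_simps)
    then have "s x \<le> (1 - 1/t) * s y + (1/t) * s z"
      using convex_onD[OF conv, of "1/t" y z] t by simp
    then have "s x - s y \<le> (s z - s y) / t" using t by (simp add: field_simps)
    also have "\<dots> \<le> 2 * C / t" using bd[of z] bd[of y] t by (intro divide_right_mono) auto
    also have "\<dots> < s x - s y"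
    proof -
      have "(s x - s y) * t = s x - s y + 2 * C" unfolding t_def using d by (simp add: distrib_left)
      then show ?thesis using t d by (simp add: divide_less_eq)
    qed
    finally show False by simp
  qed
  then show ?thesis by (simp add: antisym)
qed

lemma segment_affine_imp_linear:
  fixes g :: "'v::real_vector \<Rightarrow> real"
  assumes aff: "\<And>x y t. 0 \<le> t \<Longrightarrow> t \<le> 1 \<Longrightarrow> g ((1 - t) *\<^sub>R x + t *\<^sub>R y) = (1 - t) * g x + t * g y"
    and z: "g 0 = 0"
  shows "linear g"
proof -
  have small: "g (t *\<^sub>R y) = t * g y" if "0 \<le> t" "t \<le> 1" for t y
    using aff[OF that, of 0 y] z by simp
  have pos: "g (t *\<^sub>R y) = t * g y" if "0 \<le> t" for t y
  proof (cases "t \<le> 1")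
    case False
    then have "g ((1/t) *\<^sub>R (t *\<^sub>R y)) = (1/t) * g (t *\<^sub>R y)" by (intro small) auto
    then show ?thesis using False by (simp add: field_simps)
  qed (use small that in auto)
  have add: "g (x + y) = g x + g y" for x y
  proof -
    have "x + y = 2 *\<^sub>R ((1 - 1/2) *\<^sub>R x + (1/2) *\<^sub>R y)" by (simp add: scaleR_add_right)
    then have "g (x + y) = 2 * g ((1 - 1/2) *\<^sub>R x + (1/2) *\<^sub>R y)" using pos[of 2] by simp
    then show ?thesis using aff[of "1/2" x y] by simp
  qed
  have neg: "g (- y) = - g y" for y using add[of y "-y"] z by simp
  have "g (t *\<^sub>R y) = t * g y" for t y
    using pos[of t y] pos[of "-t" y] neg[of "t *\<^sub>R y"] by (cases "0 \<le> t") auto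
  with add show ?thesis by (intro linearI) auto
qed

text \<open>
  Let \<open>z n\<close> in \<open>S\<close> be close to \<open>n *\<^sub>R v\<close>, where \<open>\<phi>\<close> is the gradient at \<open>v\<close>. The horofunction of
  the points \<open>f (z n)\<close> is convex and takes at \<open>f x\<close> the value \<open>- \<phi> (x - x0)\<close> up to an error of
  \<open>4\<close>, since each of the two distances involved is distorted by at most \<open>2\<close>. The functional \<open>-
  \<phi>\<close> gives a second convex function. Their sum is bounded on the dense set \<open>S\<close>, hence
  everywhere, hence constant; so both are affine.
\<close>

lemma coarse_isometry_functional:
  fixes f :: "'v::real_normed_vector \<Rightarrow> 'v"
  assumes dense: "closure S = UNIV" and onto: "f ` S = S"
    and coarse: "\<And>x y. x \<in> S \<Longrightarrow> y \<in> S \<Longrightarrow> \<bar>norm (f x - f y) - norm (x - y)\<bar> \<le> 2"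
    and \<phi>: "\<phi> \<in> smooth_functionals" and x0: "x0 \<in> S"
  shows "\<exists>\<phi>'. linear \<phi>' \<and> (\<forall>y. \<phi>' y \<le> norm y) \<and>
    (\<forall>x\<in>S. \<bar>\<phi>' (f x - f x0) - \<phi> (x - x0)\<bar> \<le> 4)"
proof -
  have horo: "\<exists>\<eta>. convex_on UNIV \<eta> \<and> (\<forall>x y. \<eta> x - \<eta> y \<le> norm (x - y)) \<and> \<eta> (f x0) = 0 \<and>
      (\<forall>x\<in>S. \<bar>\<eta> (f x) + \<phi> (x - x0)\<bar> \<le> 4)" if \<phi>: "\<phi> \<in> smooth_functionals" for \<phi>
  proof -
    from \<phi> obtain v C where lin: "linear \<phi>" and le: "\<And>x. \<phi> x \<le> norm x"
      and up: "\<And>h. norm (v + h) \<le> \<phi> (v + h) + C * (norm h)\<^sup>2" and pv: "\<phi> v = norm v" and C: "C \<ge> 0"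
      by (rule smooth_functionalsE) blast
    have "\<exists>z\<in>S. norm (z - real n *\<^sub>R v) < 1" for n
      using dense_approx[OF dense, of 1 "real n *\<^sub>R v"] by auto
    then obtain z where zS: "\<And>n. z n \<in> S" and z: "\<And>n. norm (z n - real n *\<^sub>R v) < 1" by metis
    obtain \<eta> where \<eta>: "convex_on UNIV \<eta>" "\<forall>x y. \<eta> x - \<eta> y \<le> norm (x - y)" "\<eta> (f x0) = 0"
      and lim: "\<And>y l u. (\<forall>\<^sub>F n in sequentially. l \<le> norm (y - f (z n)) - norm (f x0 - f (z n)) \<and>
         norm (y - f (z n)) - norm (f x0 - f (z n)) \<le> u) \<Longrightarrow> l \<le> \<eta> y \<and> \<eta> y \<le> u"
      using horofunction_exists[of "f x0" "\<lambda>n. f (z n)"] by blast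
    have "\<bar>\<eta> (f x) + \<phi> (x - x0)\<bar> \<le> 4" if x: "x \<in> S" for x
    proof (rule field_le_epsilon)
      fix e :: real assume e: "e > 0"
      define M where "M = C * (1 + norm x + norm x0)\<^sup>2"
      have M: "M \<ge> 0" using C by (simp add: M_def)
      have est: "norm (y - z n) \<le> \<phi> (z n - y) + M / n" if "n > 0" "norm y \<le> norm x + norm x0" for n y
      proof -
        have "norm (z n - y) \<le> \<phi> (z n - y) + C * (norm (z n - y - real n *\<^sub>R v))\<^sup>2 / n"
          using smooth_at_far[OF lin up, of "real n"] that by simp
        moreover have "C * (norm (z n - y - real n *\<^sub>R v))\<^sup>2 / n \<le> M / n"
        proof -
          have "norm (z n - y - real n *\<^sub>R v) \<le> norm (z n - real n *\<^sub>R v) + norm y"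
            using norm_triangle_ineq4[of "z n - real n *\<^sub>R v" y] by (simp add: algebra_simps)
          also have "\<dots> \<le> 1 + norm x + norm x0" using z[of n] that by simp
          finally show ?thesis unfolding M_def using C
            by (intro divide_right_mono mult_left_mono power_mono) auto
        qed
        ultimately show ?thesis by (simp add: norm_minus_commute)
      qed
      have "\<forall>\<^sub>F n in sequentially. - \<phi> (x - x0) - (4 + e) \<le> norm (f x - f (z n)) - norm (f x0 - f (z n)) \<and>
         norm (f x - f (z n)) - norm (f x0 - f (z n)) \<le> - \<phi> (x - x0) + (4 + e)"
        using eventually_gt_at_top[of "nat \<lceil>M / e\<rceil>"]
      proof eventually_elim
        case (elim n)
        then have n: "real n > M / e" "n > 0" by (auto simp: nat_less_iff ceiling_less_iff) linarith
        then have Mn: "M / n \<le> e" using e by (simp add: field_simps)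
        have 1: "norm (x - z n) \<le> \<phi> (z n - x) + e" "norm (x0 - z n) \<le> \<phi> (z n - x0) + e"
          using est[OF n(2), of x] est[OF n(2), of x0] Mn by auto
        have 2: "norm (x - z n) \<ge> \<phi> (z n - x)" "norm (x0 - z n) \<ge> \<phi> (z n - x0)"
          using le[of "z n - x"] le[of "z n - x0"] by (auto simp: norm_minus_commute)
        show ?case
          using 1 2 coarse[OF x zS[of n]] coarse[OF x0 zS[of n]]
          by (simp add: linear_diff[OF lin] abs_le_iff)
      qed
      from lim[OF this] show "\<bar>\<eta> (f x) + \<phi> (x - x0)\<bar> \<le> 4 + e" by auto
    qed
    with \<eta> show ?thesis by blast
  qed
  have lin: "linear \<phi>" using \<phi> by (rule smooth_functional_linear)
  have "(\<lambda>x. - \<phi> x) \<in> smooth_functionals" using \<phi> by (rule smooth_functional_minus)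
  from horo[OF this] obtain \<eta>' where \<eta>': "convex_on UNIV \<eta>'" "\<And>x y. \<eta>' x - \<eta>' y \<le> norm (x - y)" "\<eta>' (f x0) = 0"
    "\<And>x. x \<in> S \<Longrightarrow> \<bar>\<eta>' (f x) - \<phi> (x - x0)\<bar> \<le> 4" by auto
  from horo[OF \<phi>] obtain \<eta> where \<eta>: "convex_on UNIV \<eta>" "\<And>x y. \<eta> x - \<eta> y \<le> norm (x - y)" "\<eta> (f x0) = 0"
    "\<And>x. x \<in> S \<Longrightarrow> \<bar>\<eta> (f x) + \<phi> (x - x0)\<bar> \<le> 4" by auto
  have "\<eta> x + \<eta>' x = \<eta> (f x0) + \<eta>' (f x0)" for x
  proof (rule bounded_convex_imp_constant[of "\<lambda>x. \<eta> x + \<eta>' x"])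
    show "convex_on UNIV (\<lambda>x. \<eta> x + \<eta>' x)" using \<eta>(1) \<eta>'(1) by (rule convex_on_add)
    fix y
    obtain s where s: "s \<in> S" "norm (s - y) < 1" using dense_approx[OF dense, of 1 y] by auto
    then obtain x where x: "x \<in> S" "s = f x" using onto by auto
    have "norm (y - s) < 1" using s(2) by (simp add: norm_minus_commute)
    then show "\<bar>\<eta> y + \<eta>' y\<bar> \<le> 10"
      using \<eta>(4)[OF x(1)] \<eta>'(4)[OF x(1)] \<eta>(2)[of y s] \<eta>(2)[of s y] \<eta>'(2)[of y s] \<eta>'(2)[of s y] s(2)
      unfolding x(2) by linarith
  qed
  then have opp: "\<eta>' x = - \<eta> x" for x using \<eta>(3) \<eta>'(3) by (simp add: eq_neg_iff_add_eq_0 add.commute)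
  define g where "g = (\<lambda>y. - \<eta> (f x0 + y))"
  have ling: "linear g"
  proof (rule segment_affine_imp_linear)
    fix x y :: 'v and t :: real assume t: "0 \<le> t" "t \<le> 1"
    have eq: "f x0 + ((1 - t) *\<^sub>R x + t *\<^sub>R y) = (1 - t) *\<^sub>R (f x0 + x) + t *\<^sub>R (f x0 + y)"
      by (simp add: algebra_simps)
    show "g ((1 - t) *\<^sub>R x + t *\<^sub>R y) = (1 - t) * g x + t * g y"
      using convex_onD[OF \<eta>(1) t, of "f x0 + x" "f x0 + y"] convex_onD[OF \<eta>'(1) t, of "f x0 + x" "f x0 + y"]
      unfolding g_def eq opp by simp
  qed (simp add: g_def \<eta>(3))
  moreover have "g y \<le> norm y" for y
    using \<eta>(2)[of "f x0" "f x0 + y"] \<eta>(3) by (simp add: g_def)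
  moreover have "\<bar>g (f x - f x0) - \<phi> (x - x0)\<bar> \<le> 4" if "x \<in> S" for x
    using \<eta>(4)[OF that] by (simp add: g_def abs_minus_commute)
  ultimately show ?thesis by blast
qed

context finite_dim_basis
begin

lemma norm_le_by_smooth_functionals:
  fixes x :: 'v
  assumes "\<And>\<phi>. \<phi> \<in> smooth_functionals \<Longrightarrow> \<phi> x \<le> r"
  shows "norm x \<le> r"
proof (rule field_le_epsilon)
  fix e :: real assume "e > 0"
  from smooth_functionals_norming[OF this, of x] assms show "norm x \<le> r + e" by fastforce
qed

lemma smooth_functionals_separate:
  fixes x y :: 'v
  assumes "\<And>\<phi>. \<phi> \<in> smooth_functionals \<Longrightarrow> \<phi> x = \<phi> y"
  shows "x = y"
proof -
  have "norm (x - y) \<le> 0"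
    by (rule norm_le_by_smooth_functionals) (simp add: linear_diff smooth_functional_linear assms)
  then show ?thesis by simp
qed

text \<open>
  For every smooth \<open>\<phi>\<close> let \<open>F \<phi>\<close> be the linear functional with \<open>F \<phi> (f x)\<close> within a bounded
  distance of \<open>\<phi> x\<close>. Rescaling preimages of points near \<open>n *\<^sub>R y\<close> gives a Cauchy sequence, whose
  limit \<open>B y\<close> satisfies \<open>\<phi> (B y) = F \<phi> y\<close> for all smooth \<open>\<phi>\<close>; as these functionals separate
  points, \<open>B\<close> is linear.
\<close>

lemma coarse_isometry_straightening:
  fixes f :: "'v \<Rightarrow> 'v"
  assumes dense: "closure S = UNIV" and onto: "f ` S = S"
    and coarse: "\<And>x y. x \<in> S \<Longrightarrow> y \<in> S \<Longrightarrow> \<bar>norm (f x - f y) - norm (x - y)\<bar> \<le> 2"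
  shows "\<exists>B K. linear B \<and> (\<forall>y. norm (B y) = norm y) \<and> (\<forall>x\<in>S. norm (B (f x) - x) \<le> K)"
proof -
  obtain x0 where x0: "x0 \<in> S" using dense_approx[OF dense, of 1] by auto
  define K where "K = 4 + norm (f x0) + norm x0"
  have "\<forall>\<phi>\<in>smooth_functionals. \<exists>\<phi>'. linear \<phi>' \<and> (\<forall>y. \<phi>' y \<le> norm y) \<and>
    (\<forall>x\<in>S. \<bar>\<phi>' (f x - f x0) - \<phi> (x - x0)\<bar> \<le> 4)"
    using coarse_isometry_functional[OF dense onto coarse _ x0] by blast
  from bchoice[OF this] obtain F where F: "\<And>\<phi>. \<phi> \<in> smooth_functionals \<Longrightarrow> linear (F \<phi>)"
    "\<And>\<phi> y. \<phi> \<in> smooth_functionals \<Longrightarrow> F \<phi> y \<le> norm y"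
    "\<And>\<phi> x. \<phi> \<in> smooth_functionals \<Longrightarrow> x \<in> S \<Longrightarrow> \<bar>F \<phi> (f x - f x0) - \<phi> (x - x0)\<bar> \<le> 4"
    by auto
  have Fabs: "\<bar>F \<phi> y\<bar> \<le> norm y" if "\<phi> \<in> smooth_functionals" for \<phi> y
    using F(2)[OF that, of y] F(2)[OF that, of "-y"] by (simp add: linear_neg[OF F(1)[OF that]])
  have near: "\<bar>F \<phi> (f x) - \<phi> x\<bar> \<le> K" if "\<phi> \<in> smooth_functionals" "x \<in> S" for \<phi> x
    using F(3)[OF that] Fabs[OF that(1), of "f x0"] smooth_functional_abs_le[OF that(1), of x0]
    by (simp add: linear_diff[OF F(1)[OF that(1)]] linear_diff[OF smooth_functional_linear[OF that(1)]] K_def)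
  have ex: "\<exists>b. (\<forall>\<phi>\<in>smooth_functionals. \<phi> b = F \<phi> y) \<and> norm b = norm y" for y
  proof -
    have "\<exists>x\<in>S. norm (f x - real n *\<^sub>R y) < 1" for n
      using dense_approx[OF dense, of 1 "real n *\<^sub>R y"] onto by (metis imageE zero_less_one)
    then obtain s where sS: "\<And>n. s n \<in> S" and s: "\<And>n. norm (f (s n) - real n *\<^sub>R y) < 1" by metis
    define X where "X = (\<lambda>n. (1 / real (Suc n)) *\<^sub>R s (Suc n))"
    have \<phi>X: "\<bar>\<phi> (X n) - F \<phi> y\<bar> \<le> (K + 1) / real (Suc n)" if \<phi>: "\<phi> \<in> smooth_functionals" for \<phi> n
    proof -
      let ?m = "real (Suc n)"
      have "\<bar>F \<phi> (f (s (Suc n))) - ?m * F \<phi> y\<bar> \<le> 1"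
        using Fabs[OF \<phi>, of "f (s (Suc n)) - ?m *\<^sub>R y"] s[of "Suc n"]
        unfolding linear_diff[OF F(1)[OF \<phi>]] linear_scale[OF F(1)[OF \<phi>]] by simp
      with near[OF \<phi> sS[of "Suc n"]] have "\<bar>\<phi> (s (Suc n)) - ?m * F \<phi> y\<bar> \<le> K + 1" by linarith
      then have "\<bar>\<phi> (s (Suc n)) - ?m * F \<phi> y\<bar> / ?m \<le> (K + 1) / ?m" by (intro divide_right_mono) auto
      also have "\<bar>\<phi> (s (Suc n)) - ?m * F \<phi> y\<bar> / ?m = \<bar>(\<phi> (s (Suc n)) - ?m * F \<phi> y) / ?m\<bar>"
        by simp
      also have "(\<phi> (s (Suc n)) - ?m * F \<phi> y) / ?m = \<phi> (X n) - F \<phi> y"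
        unfolding X_def linear_scale[OF smooth_functional_linear[OF \<phi>]] by (simp add: diff_divide_distrib del: of_nat_Suc)
      finally show ?thesis .
    qed
    have tendsto0: "(\<lambda>n. c / real (Suc n)) \<longlonglongrightarrow> 0" for c
      using tendsto_mult_right_zero[OF LIMSEQ_inverse_real_of_nat, of c] by (simp add: divide_inverse)
    have diff: "norm (X n - X m) \<le> (K + 1) / real (Suc n) + (K + 1) / real (Suc m)" for n m
    proof (rule norm_le_by_smooth_functionals)
      fix \<phi> :: "'v \<Rightarrow> real" assume \<phi>: "\<phi> \<in> smooth_functionals"
      from \<phi>X[OF this, of n] \<phi>X[OF this, of m]
      show "\<phi> (X n - X m) \<le> (K + 1) / real (Suc n) + (K + 1) / real (Suc m)"
        unfolding linear_diff[OF smooth_functional_linear[OF \<phi>]] by linarith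
    qed
    have "Cauchy X"
    proof (rule metric_CauchyI)
      fix e :: real assume e: "e > 0"
      then have "\<forall>\<^sub>F n in sequentially. (K + 1) / real (Suc n) < e / 2"
        using order_tendstoD(2)[OF tendsto0[of "K+1"], of "e/2"] by simp
      then obtain M where M: "\<And>n. n \<ge> M \<Longrightarrow> (K + 1) / real (Suc n) < e / 2"
        unfolding eventually_sequentially by blast
      show "\<exists>M. \<forall>m\<ge>M. \<forall>n\<ge>M. dist (X m) (X n) < e"
      proof (intro exI[of _ M] allI impI)
        fix m n assume "m \<ge> M" "n \<ge> M"
        from M[OF this(1)] M[OF this(2)] diff[of m n] show "dist (X m) (X n) < e"
          unfolding dist_norm by linarith
      qed
    qed
    from Cauchy_imp_convergent[OF this] obtain b where b: "X \<longlonglongrightarrow> b" ..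
    have "\<phi> b = F \<phi> y" if \<phi>: "\<phi> \<in> smooth_functionals" for \<phi>
    proof -
      have "(\<lambda>n. \<phi> (X n) - \<phi> b) \<longlonglongrightarrow> 0"
      proof (rule Lim_null_comparison)
        show "\<forall>\<^sub>F n in sequentially. norm (\<phi> (X n) - \<phi> b) \<le> norm (X n - b)"
          using smooth_functional_abs_le[OF \<phi>] by (simp flip: linear_diff[OF smooth_functional_linear[OF \<phi>]])
        show "(\<lambda>n. norm (X n - b)) \<longlonglongrightarrow> 0" using b by (simp add: LIM_zero tendsto_norm_zero)
      qed
      moreover have "(\<lambda>n. \<phi> (X n) - F \<phi> y) \<longlonglongrightarrow> 0"
        by (rule Lim_null_comparison[OF _ tendsto0[of "K+1"]]) (use \<phi>X[OF \<phi>] in simp)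
      ultimately have "(\<lambda>n. (\<phi> (X n) - F \<phi> y) - (\<phi> (X n) - \<phi> b)) \<longlonglongrightarrow> 0 - 0" by (intro tendsto_diff)
      then have "(\<lambda>n::nat. \<phi> b - F \<phi> y) \<longlonglongrightarrow> 0" by simp
      then show ?thesis by (simp add: LIMSEQ_const_iff)
    qed
    moreover have "norm b = norm y"
    proof -
      define c where "c = 3 + norm (f x0) + norm x0"
      have "(\<lambda>n. norm (X n) - norm y) \<longlonglongrightarrow> 0"
      proof (rule Lim_null_comparison[OF _ tendsto0[of c]])
        have "norm (norm (X n) - norm y) \<le> c / real (Suc n)" for n
        proof -
          let ?m = "real (Suc n)"
          have "\<bar>norm (f (s (Suc n))) - ?m * norm y\<bar> \<le> 1"
            using norm_triangle_ineq3[of "f (s (Suc n))" "?m *\<^sub>R y"] s[of "Suc n"] by simp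
          moreover have "\<bar>norm (f (s (Suc n)) - f x0) - norm (f (s (Suc n)))\<bar> \<le> norm (f x0)"
            using norm_triangle_ineq3[of "f (s (Suc n)) - f x0" "f (s (Suc n))"] by simp
          moreover have "\<bar>norm (s (Suc n) - x0) - norm (s (Suc n))\<bar> \<le> norm x0"
            using norm_triangle_ineq3[of "s (Suc n) - x0" "s (Suc n)"] by simp
          ultimately have "\<bar>norm (s (Suc n)) - ?m * norm y\<bar> \<le> c"
            using coarse[OF sS[of "Suc n"] x0] unfolding c_def by linarith
          then have "\<bar>norm (s (Suc n)) - ?m * norm y\<bar> / ?m \<le> c / ?m" by (intro divide_right_mono) auto
          also have "\<bar>norm (s (Suc n)) - ?m * norm y\<bar> / ?m = \<bar>(norm (s (Suc n)) - ?m * norm y) / ?m\<bar>"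
            by simp
          also have "(norm (s (Suc n)) - ?m * norm y) / ?m = norm (X n) - norm y"
            unfolding X_def by (simp add: diff_divide_distrib del: of_nat_Suc)
          finally show ?thesis by simp
        qed
        then show "\<forall>\<^sub>F n in sequentially. norm (norm (X n) - norm y) \<le> c / real (Suc n)" by simp
      qed
      then have "(\<lambda>n. norm (X n)) \<longlonglongrightarrow> norm y" by (simp add: LIM_zero_iff)
      moreover have "(\<lambda>n. norm (X n)) \<longlonglongrightarrow> norm b" using b by (rule tendsto_norm)
      ultimately show ?thesis using LIMSEQ_unique by blast
    qed
    ultimately show ?thesis by blast
  qed
  define B where "B = (\<lambda>y. SOME b. (\<forall>\<phi>\<in>smooth_functionals. \<phi> b = F \<phi> y) \<and> norm b = norm y)"
  have B: "\<And>\<phi> y. \<phi> \<in> smooth_functionals \<Longrightarrow> \<phi> (B y) = F \<phi> y" "\<And>y. norm (B y) = norm y"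
    using someI_ex[OF ex] unfolding B_def by blast+
  have "linear B"
  proof (rule linearI)
    fix x y c
    show "B (x + y) = B x + B y"
      by (rule smooth_functionals_separate)
        (simp add: B(1) linear_add[OF smooth_functional_linear] linear_add[OF F(1)])
    show "B (c *\<^sub>R x) = c *\<^sub>R B x"
      by (rule smooth_functionals_separate)
        (simp add: B(1) linear_scale[OF smooth_functional_linear] linear_scale[OF F(1)])
  qed
  moreover have "norm (B (f x) - x) \<le> K" if "x \<in> S" for x
  proof (rule norm_le_by_smooth_functionals)
    fix \<phi> :: "'v \<Rightarrow> real" assume \<phi>: "\<phi> \<in> smooth_functionals"
    from near[OF this that] show "\<phi> (B (f x) - x) \<le> K"
      by (simp add: B(1)[OF \<phi>] linear_diff[OF smooth_functional_linear[OF \<phi>]] abs_le_iff)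
  qed
  ultimately show ?thesis using B(2) by blast
qed

end

section \<open>Displacements under step isometries\<close>

text \<open>
  At the origin the norm has a corner in every direction, which no quadratic bound allows.
\<close>

lemma smooth_at_nonzero:
  fixes u v :: "'v::real_normed_vector"
  assumes "linear \<phi>" and up: "\<And>h. norm (v + h) \<le> \<phi> (v + h) + C * (norm h)\<^sup>2"
    and C: "C \<ge> 0" and u: "u \<noteq> 0"
  shows "v \<noteq> 0"
proof
  assume v: "v = 0"
  define h where "h = (1 / ((C + 1) * norm u)) *\<^sub>R u"
  have "norm h = (1 / ((C + 1) * norm u)) * norm u" unfolding h_def using C by simp
  also have "\<dots> = 1 / (C + 1)" using u by simp
  finally have n: "norm h = 1 / (C + 1)" .
  have "norm h + norm (-h) \<le> 2 * (C * (norm h)\<^sup>2)"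
    using up[of h] up[of "-h"] v by (simp add: linear_neg[OF assms(1)])
  then have "1 / (C + 1) \<le> C * (1 / (C + 1))\<^sup>2" by (simp add: n)
  also have "\<dots> = (C / (C + 1)) * (1 / (C + 1))" by (simp add: power2_eq_square)
  also have "\<dots> < 1 * (1 / (C + 1))" using C by (intro mult_strict_right_mono) auto
  finally show False by simp
qed

text \<open>
  Choose an integer \<open>k\<close> and a point \<open>z\<close> of \<open>S\<close> far out in the direction \<open>v\<close> at which \<open>\<phi>\<close> is the
  gradient, such that \<open>norm (z - x) < k\<close> but \<open>norm (z - y) \<ge> k + m\<close>; this is possible because
  these norms are nearly \<open>\<phi> (z - x)\<close> and at least \<open>\<phi> (z - y)\<close>. The two inequalities survive the
  application of \<open>h\<close>. Since \<open>h z\<close> is near \<open>z\<close>, it is still far out in direction \<open>v\<close>, and the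
  norms can be turned back into values of \<open>\<phi>\<close>. Only \<open>\<ge>\<close> is obtained, because the second norm is
  compared with \<open>\<phi>\<close> up to a vanishing error.
\<close>

lemma step_displacement_monotone:
  fixes h :: "'v::real_normed_vector \<Rightarrow> 'v" and m :: int
  assumes dense: "closure S = UNIV" and nz: "\<exists>u::'v. u \<noteq> 0"
    and step: "\<And>x y k. x \<in> S \<Longrightarrow> y \<in> S \<Longrightarrow> k \<ge> 2 \<Longrightarrow> norm (x - y) < real k \<longleftrightarrow> norm (h x - h y) < real k"
    and near: "\<And>x. x \<in> S \<Longrightarrow> norm (h x - x) \<le> K"
    and \<phi>: "\<phi> \<in> smooth_functionals" and x: "x \<in> S" and y: "y \<in> S"
    and gt: "\<phi> x - \<phi> y > of_int m"
  shows "\<phi> (h x) - \<phi> (h y) \<ge> of_int m"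
proof (rule field_le_epsilon)
  fix e :: real assume e: "e > 0"
  from \<phi> obtain v C where lin: "linear \<phi>" and le: "\<And>x. \<phi> x \<le> norm x"
    and up: "\<And>h. norm (v + h) \<le> \<phi> (v + h) + C * (norm h)\<^sup>2" and pv: "\<phi> v = norm v" and C: "C \<ge> 0"
    by (rule smooth_functionalsE) blast
  have v: "norm v > 0" using smooth_at_nonzero[OF lin up C] nz by auto
  define \<gamma> where "\<gamma> = \<phi> x - \<phi> y - of_int m"
  have \<gamma>: "\<gamma> > 0" using gt by (simp add: \<gamma>_def)
  define \<rho> where "\<rho> = min 1 (\<gamma> / 4)"
  have \<rho>: "\<rho> > 0" "\<rho> \<le> 1" "\<rho> \<le> \<gamma> / 4" using \<gamma> by (auto simp: \<rho>_def)
  define K1 where "K1 = 1 + norm x"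
  define K2 where "K2 = K + 1 + norm (h y)"
  have K: "K \<ge> 0" using near[OF x] norm_ge_zero order_trans by blast
  define T0 where "T0 = 1 + C * K1\<^sup>2 * 8 / \<gamma> + C * K2\<^sup>2 / e"
  have T0: "T0 > 0" unfolding T0_def using C \<gamma> e by (intro add_pos_nonneg) auto
  obtain k where k: "real k \<ge> T0 * norm v + \<bar>\<phi> x\<bar> + \<gamma> + \<bar>of_int m\<bar> + 2"
    using real_arch_simple by blast
  have T0v: "T0 * norm v > 0" using T0 v by simp
  \<comment> \<open>With this \<open>t\<close>, \<open>\<phi> (t *\<^sub>R v - x)\<close> is \<open>k - \<gamma> / 2\<close> and \<open>\<phi> (t *\<^sub>R v - y)\<close> is \<open>k + m + \<gamma> / 2\<close>.\<close>
  define t where "t = (real k + \<phi> x - \<gamma> / 2) / norm v"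
  have "T0 * norm v \<le> real k + \<phi> x - \<gamma> / 2" using k \<gamma> by linarith
  then have t: "t \<ge> T0" unfolding t_def using v by (simp add: le_divide_eq)
  then have t0: "t > 0" using T0 by linarith
  have tv: "t * norm v = real k + \<phi> x - \<gamma> / 2" unfolding t_def using v by simp
  have small1: "C * K1\<^sup>2 / t < \<gamma> / 4"
  proof -
    have "C * K1\<^sup>2 * 8 / \<gamma> < t" using t C e unfolding T0_def by (smt (verit) divide_nonneg_pos mult_nonneg_nonneg zero_le_power2)
    then have a: "C * K1\<^sup>2 * 8 < t * \<gamma>" using \<gamma> by (simp add: divide_less_eq)
    moreover have "C * K1\<^sup>2 \<ge> 0" using C by simp
    ultimately have "C * K1\<^sup>2 < \<gamma> / 4 * t" by (simp add: mult.commute)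
    then show ?thesis using t0 by (simp add: divide_less_eq)
  qed
  have small2: "C * K2\<^sup>2 / t \<le> e"
  proof -
    have "C * K2\<^sup>2 / e \<le> t" using t C \<gamma> unfolding T0_def by (smt (verit) divide_nonneg_pos mult_nonneg_nonneg zero_le_power2)
    then show ?thesis using e t0 by (simp add: field_simps)
  qed
  obtain z where z: "z \<in> S" "norm (z - t *\<^sub>R v) < \<rho>" using dense_approx[OF dense \<rho>(1)] by blast
  have "\<bar>\<phi> (z - t *\<^sub>R v)\<bar> < \<rho>"
    using smooth_functional_abs_le[OF \<phi>, of "z - t *\<^sub>R v"] z(2) by linarith
  then have \<phi>z: "\<bar>\<phi> z - (real k + \<phi> x - \<gamma> / 2)\<bar> < \<gamma> / 4"
    using \<rho>(3) unfolding linear_diff[OF lin] linear_scale[OF lin] pv real_scaleR_def tv by linarith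
  have "norm (z - x) < real k"
  proof -
    have "norm (z - x - t *\<^sub>R v) \<le> norm (z - t *\<^sub>R v) + norm x"
      using norm_triangle_ineq4[of "z - t *\<^sub>R v" x] by (simp add: algebra_simps)
    then have "norm (z - x - t *\<^sub>R v) \<le> K1" using z(2) \<rho>(2) unfolding K1_def by linarith
    then have "C * (norm (z - x - t *\<^sub>R v))\<^sup>2 / t \<le> C * K1\<^sup>2 / t"
      using C t0 by (intro divide_right_mono mult_left_mono power_mono) auto
    moreover have "norm (z - x) \<le> \<phi> (z - x) + C * (norm (z - x - t *\<^sub>R v))\<^sup>2 / t"
      using smooth_at_far[OF lin up t0] .
    ultimately show ?thesis using small1 \<phi>z unfolding linear_diff[OF lin] by linarith
  qed
  then have hx: "norm (h z - h x) < real k"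
    using step[OF z(1) x, of k] k T0v \<gamma> by force
  define k' where "k' = nat (int k + m)"
  have k': "real k' = real k + of_int m" "k' \<ge> 2" using k T0v \<gamma> unfolding k'_def by linarith+
  have "\<not> norm (z - y) < real k'"
    using le[of "z - y"] \<phi>z \<gamma> \<gamma>_def unfolding k'(1) linear_diff[OF lin] by linarith
  then have hy: "norm (h z - h y) \<ge> real k + of_int m"
    using step[OF z(1) y k'(2)] k'(1) by simp
  have "norm (h z - h y - t *\<^sub>R v) \<le> norm (h z - z) + norm (z - t *\<^sub>R v) + norm (h y)"
    using norm_triangle_ineq4[of "h z - t *\<^sub>R v" "h y"] norm_triangle_ineq[of "h z - z" "z - t *\<^sub>R v"]
    by (simp add: algebra_simps)
  then have "norm (h z - h y - t *\<^sub>R v) \<le> K2" using z(2) \<rho>(2) near[OF z(1)] unfolding K2_def by linarith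
  then have "C * (norm (h z - h y - t *\<^sub>R v))\<^sup>2 / t \<le> C * K2\<^sup>2 / t"
    using C t0 by (intro divide_right_mono mult_left_mono power_mono) auto
  moreover have "norm (h z - h y) \<le> \<phi> (h z - h y) + C * (norm (h z - h y - t *\<^sub>R v))\<^sup>2 / t"
    using smooth_at_far[OF lin up t0] .
  ultimately have "real k + of_int m \<le> \<phi> (h z) - \<phi> (h y) + e"
    using small2 hy unfolding linear_diff[OF lin] by linarith
  moreover have "\<phi> (h z) - \<phi> (h x) < real k"
    using le[of "h z - h x"] hx unfolding linear_diff[OF lin] by linarith
  ultimately show "of_int m \<le> \<phi> (h x) - \<phi> (h y) + e" by linarith
qed

lemma bounded_climb:
  fixes g :: "'a \<Rightarrow> real"
  assumes "s0 \<in> S" and climb: "\<And>s. s \<in> S \<Longrightarrow> \<exists>s'\<in>S. g s' \<ge> g s + \<kappa>" and bd: "\<And>s. s \<in> S \<Longrightarrow> \<bar>g s\<bar> \<le> K"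
  shows "\<kappa> \<le> 0"
proof (rule ccontr)
  assume "\<not> \<kappa> \<le> 0"
  then have \<kappa>: "\<kappa> > 0" by simp
  have "\<exists>s\<in>S. g s \<ge> g s0 + real n * \<kappa>" for n
  proof (induction n)
    case 0 then show ?case using assms(1) by auto
  next
    case (Suc n)
    then obtain s where "s \<in> S" "g s \<ge> g s0 + real n * \<kappa>" by blast
    moreover obtain s' where "s' \<in> S" "g s' \<ge> g s + \<kappa>" using climb[OF \<open>s \<in> S\<close>] by blast
    ultimately show ?case by (intro bexI[of _ s']) (auto simp: algebra_simps)
  qed
  note ex = this
  obtain n where n: "real n * \<kappa> > 2 * K" using reals_Archimedean3[OF \<kappa>] by blast
  obtain s where "s \<in> S" "g s \<ge> g s0 + real n * \<kappa>" using ex[of n] by blast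
  with n have "s \<in> S" "g s > g s0 + 2 * K" by auto
  then show False using bd[of s] bd[OF assms(1)] by linarith
qed

text \<open>
  For each of the functionals the displacement \<open>D \<psi> x = \<psi> (h x) - \<psi> x\<close> can decrease only slowly:
  by monotonicity it drops by less than \<open>\<epsilon>\<close> when \<open>\<psi>\<close> increases by less than \<open>\<epsilon>\<close>. Suppose that \<open>D
  \<phi>\<close> were larger at \<open>q\<close> than at \<open>p\<close>, where \<open>p\<close> and \<open>q\<close> differ essentially only in the value of
  \<open>\<psi>1\<close>. From any point \<open>s\<close> one could then move to a point with nearly the same \<open>\<phi>\<close> but with the
  \<open>\<psi>1\<close>-value of \<open>p\<close>, the change being compensated by \<open>\<psi>2\<close>, and from there change \<open>\<psi>1\<close> to its
  value at \<open>q\<close>. The first move hardly lowers \<open>D \<phi>\<close>, as \<open>\<phi>\<close> hardly changes, and the second one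
  raises it by the assumed amount, because \<open>D \<phi>\<close> is the combination of the \<open>D \<psi>\<close>. Repeating this
  makes \<open>D \<phi>\<close> unbounded. It follows that \<open>D \<phi>\<close> is constant, since \<open>\<phi>\<close> can be given any value by
  moving along \<open>\<psi>1\<close> alone.

  The points compared always differ slightly and in a known direction in the functional
  concerned, so only one-sided estimates are needed, and jumps of \<open>h\<close> do no harm.
\<close>

lemma circuit_displacement_constant:
  fixes h :: "'v::real_normed_vector \<Rightarrow> 'v" and \<phi> :: "'v \<Rightarrow> real" and F :: "('v \<Rightarrow> real) set"
  assumes dense: "closure S = UNIV"
    and near: "\<And>x. x \<in> S \<Longrightarrow> norm (h x - x) \<le> K"
    and lin: "\<And>\<psi>. \<psi> \<in> insert \<phi> F \<Longrightarrow> linear \<psi>"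
    and le: "\<And>\<psi> x. \<psi> \<in> insert \<phi> F \<Longrightarrow> \<bar>\<psi> x\<bar> \<le> norm x"
    and mono: "\<And>\<psi> x y. \<psi> \<in> insert \<phi> F \<Longrightarrow> x \<in> S \<Longrightarrow> y \<in> S \<Longrightarrow> \<psi> x > \<psi> y \<Longrightarrow> \<psi> (h x) \<ge> \<psi> (h y)"
    and finF: "finite F" and comb: "\<And>x. \<phi> x = (\<Sum>\<psi>\<in>F. a \<psi> * \<psi> x)"
    and apos: "\<And>\<psi>. \<psi> \<in> F \<Longrightarrow> a \<psi> > 0"
    and dual1: "\<And>\<psi>. \<psi> \<in> F \<Longrightarrow> \<psi> (d \<psi>) = 1"
    and dual0: "\<And>\<psi> \<theta>. \<psi> \<in> F \<Longrightarrow> \<theta> \<in> F \<Longrightarrow> \<theta> \<noteq> \<psi> \<Longrightarrow> \<theta> (d \<psi>) = 0"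
    and two: "\<psi>1 \<in> F" "\<psi>2 \<in> F" "\<psi>1 \<noteq> \<psi>2"
    and x: "x \<in> S" and y: "y \<in> S"
  shows "\<phi> (h x) - \<phi> x = \<phi> (h y) - \<phi> y"
proof -
  define D where "D = (\<lambda>\<psi> x. \<psi> (h x) - \<psi> x :: real)"
  define A where "A = sum a F"
  have A: "A > 0" unfolding A_def using finF apos two(1) by (intro sum_pos) auto
  have Dcomb: "D \<phi> x = (\<Sum>\<psi>\<in>F. a \<psi> * D \<psi> x)" for x
    unfolding D_def comb by (simp add: right_diff_distrib sum_subtractf)
  have Dbd: "\<bar>D \<phi> x\<bar> \<le> K" if "x \<in> S" for x
    using le[of \<phi> "h x - x"] near[OF that] unfolding D_def by (simp add: linear_diff[OF lin])
  \<comment> \<open>Monotonicity in the form in which it is used: a small increase of \<open>\<psi>\<close> hardly lowers \<open>D \<psi>\<close>.\<close>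
  have up: "D \<psi> y - \<epsilon> \<le> D \<psi> x" if "\<psi> \<in> insert \<phi> F" "x \<in> S" "y \<in> S" "0 < \<psi> x - \<psi> y" "\<psi> x - \<psi> y < \<epsilon>" for \<psi> x y \<epsilon>
    using mono[OF that(1-3)] that(4,5) unfolding D_def by linarith
  define E where "E = (\<Sum>\<psi>\<in>F. d \<psi>)"
  have E: "\<psi> E = 1" if "\<psi> \<in> F" for \<psi>
  proof -
    have "\<psi> E = (\<Sum>\<theta>\<in>F. \<psi> (d \<theta>))" unfolding E_def using lin that by (simp add: linear_sum)
    also have "\<dots> = (\<Sum>\<theta>\<in>F. if \<theta> = \<psi> then 1 else 0)"
      using that dual1 dual0 by (intro sum.cong) auto
    finally show ?thesis using finF that by simp
  qed
  have \<phi>E: "\<phi> E = A" unfolding comb A_def by (simp add: E cong: sum.cong)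
  have \<phi>d: "\<phi> (d \<psi>) = a \<psi>" if "\<psi> \<in> F" for \<psi>
  proof -
    have "\<phi> (d \<psi>) = (\<Sum>\<theta>\<in>F. if \<theta> = \<psi> then a \<psi> else 0)"
      unfolding comb using that dual1 dual0 by (intro sum.cong) auto
    then show ?thesis using finF that by simp
  qed
  have close: "\<exists>s\<in>S. \<forall>\<psi>\<in>insert \<phi> F. \<bar>\<psi> s - \<psi> p\<bar> < \<rho>" if \<rho>: "\<rho> > 0" for p \<rho>
  proof -
    obtain s where s: "s \<in> S" "norm (s - p) < \<rho>" using dense_approx[OF dense \<rho>] by blast
    have "\<bar>\<psi> s - \<psi> p\<bar> < \<rho>" if "\<psi> \<in> insert \<phi> F" for \<psi>
      using le[OF that, of "s - p"] s(2) by (simp add: linear_diff[OF lin[OF that]])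
    with s(1) show ?thesis by blast
  qed
  have \<phi>F: "\<psi> \<in> F \<Longrightarrow> \<psi> \<in> insert \<phi> F" for \<psi> by simp
  note linF = lin[OF \<phi>F] and lin\<phi> = lin[OF insertI1]
  note lins = linear_add linear_diff linear_scale
  have step: "D \<phi> q - D \<phi> p \<le> (2 * A + 1) * \<epsilon>"
    if \<epsilon>: "\<epsilon> > 0" and p: "p \<in> S" and q: "q \<in> S"
      and pq: "\<And>\<psi>. \<psi> \<in> F \<Longrightarrow> \<psi> \<noteq> \<psi>1 \<Longrightarrow> - \<epsilon> < \<psi> q - \<psi> p \<and> \<psi> q - \<psi> p < 0" for \<epsilon> p q
  proof -
    define \<delta> where "\<delta> = D \<phi> q - D \<phi> p"
    have "\<exists>s'\<in>S. D \<phi> s' \<ge> D \<phi> s + (\<delta> - (2 * A + 1) * \<epsilon>)" if s: "s \<in> S" for s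
    proof -
      define w where "w = (\<phi> s + \<epsilon> / 2 - \<phi> p + (\<epsilon> / 2) * a \<psi>1) / a \<psi>2"
      \<comment> \<open>\<open>r0\<close> has slightly larger \<open>\<phi>\<close> than \<open>s\<close> and slightly smaller \<open>\<psi>1\<close> than \<open>p\<close>.\<close>
      define r0 where "r0 = p + w *\<^sub>R d \<psi>2 - (\<epsilon> / 2) *\<^sub>R d \<psi>1"
      have r0\<phi>: "\<phi> r0 = \<phi> s + \<epsilon> / 2"
        unfolding r0_def lins[OF lin\<phi>] using two apos[OF two(2)] by (simp add: \<phi>d w_def)
      have r01: "\<psi>1 r0 = \<psi>1 p - \<epsilon> / 2"
        unfolding r0_def lins[OF linF[OF two(1)]] using two by (simp add: dual1 dual0)
      obtain r where r: "r \<in> S" "\<And>\<psi>. \<psi> \<in> insert \<phi> F \<Longrightarrow> \<bar>\<psi> r - \<psi> r0\<bar> < \<epsilon> / 4"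
        using close[of "\<epsilon> / 4" r0] \<epsilon> by auto
      \<comment> \<open>\<open>s0\<close> has slightly larger \<open>\<psi>1\<close> than \<open>q\<close>, and slightly larger values than \<open>r\<close> for the others.\<close>
      define s0 where "s0 = r + (\<psi>1 q - \<psi>1 r) *\<^sub>R d \<psi>1 + (\<epsilon> / 2) *\<^sub>R E"
      have s01: "\<psi>1 s0 = \<psi>1 q + \<epsilon> / 2"
        unfolding s0_def lins[OF linF[OF two(1)]] using two by (simp add: dual1 E)
      have s0o: "\<psi> s0 = \<psi> r + \<epsilon> / 2" if "\<psi> \<in> F" "\<psi> \<noteq> \<psi>1" for \<psi>
        unfolding s0_def lins[OF linF[OF that(1)]] using two that by (simp add: dual0 E)
      obtain s' where s': "s' \<in> S" "\<And>\<psi>. \<psi> \<in> insert \<phi> F \<Longrightarrow> \<bar>\<psi> s' - \<psi> s0\<bar> < \<epsilon> / 4"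
        using close[of "\<epsilon> / 4" s0] \<epsilon> by auto
      have 1: "D \<phi> s - \<epsilon> \<le> D \<phi> r"
        by (rule up[OF insertI1 r(1) s]) (use r(2)[OF insertI1] \<epsilon> r0\<phi> in linarith)+
      have 2: "D \<psi> q - D \<psi> p - 2 * \<epsilon> \<le> D \<psi> s' - D \<psi> r" if \<psi>: "\<psi> \<in> F" for \<psi>
      proof (cases "\<psi> = \<psi>1")
        case True
        have "D \<psi> q - \<epsilon> \<le> D \<psi> s'"
          by (rule up[OF \<phi>F[OF \<psi>] s'(1) q]) (use s'(2)[OF \<phi>F[OF \<psi>]] s01[folded True] \<epsilon> in linarith)+
        moreover have "D \<psi> r - \<epsilon> \<le> D \<psi> p"
          by (rule up[OF \<phi>F[OF \<psi>] p r(1)]) (use r(2)[OF \<phi>F[OF \<psi>]] r01[folded True] \<epsilon> in linarith)+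
        ultimately show ?thesis by linarith
      next
        case False
        have "D \<psi> r - \<epsilon> \<le> D \<psi> s'"
          by (rule up[OF \<phi>F[OF \<psi>] s'(1) r(1)]) (use s'(2)[OF \<phi>F[OF \<psi>]] s0o[OF \<psi> False] \<epsilon> in linarith)+
        moreover have "D \<psi> q - \<epsilon> \<le> D \<psi> p"
          by (rule up[OF \<phi>F[OF \<psi>] p q]) (use pq[OF \<psi> False] in linarith)+
        ultimately show ?thesis by linarith
      qed
      have "\<delta> - 2 * A * \<epsilon> = (\<Sum>\<psi>\<in>F. a \<psi> * (D \<psi> q - D \<psi> p - 2 * \<epsilon>))"
        unfolding \<delta>_def A_def Dcomb
        by (simp add: right_diff_distrib sum_subtractf sum_distrib_left sum_distrib_right mult_ac)
      also have "\<dots> \<le> (\<Sum>\<psi>\<in>F. a \<psi> * (D \<psi> s' - D \<psi> r))"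
        by (intro sum_mono mult_left_mono 2 less_imp_le[OF apos])
      also have "\<dots> = D \<phi> s' - D \<phi> r"
        unfolding Dcomb by (simp add: right_diff_distrib sum_subtractf)
      finally show ?thesis using 1 s'(1) by (intro bexI[of _ s']) (auto simp: algebra_simps)
    qed
    from bounded_climb[of p S "D \<phi>", OF p this Dbd] show ?thesis unfolding \<delta>_def by simp
  qed
  have main: "D \<phi> y \<le> D \<phi> x" if x: "x \<in> S" and y: "y \<in> S" for x y
  proof (rule field_le_epsilon)
    fix e :: real assume e: "e > 0"
    define \<epsilon> where "\<epsilon> = e / (2 * A + 3)"
    have \<epsilon>: "\<epsilon> > 0" using e A by (simp add: \<epsilon>_def)
    define \<eta> where "\<eta> = \<epsilon> / (4 * (1 + A))"
    have \<eta>: "\<eta> > 0" using \<epsilon> A by (simp add: \<eta>_def)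
    have "\<eta> * (1 + A) = \<epsilon> / 4" unfolding \<eta>_def using A by (simp add: field_simps)
    then have \<eta>A: "\<eta> + \<eta> * A = \<epsilon> / 4" by (simp add: algebra_simps)
    have \<eta>Ap: "\<eta> * A > 0" using \<eta> A by simp
    define \<rho> where "\<rho> = min \<eta> (\<eta> * A)"
    have \<rho>: "\<rho> > 0" "\<rho> \<le> \<eta>" "\<rho> \<le> \<eta> * A" using \<eta> \<eta>Ap by (auto simp: \<rho>_def)
    \<comment> \<open>\<open>p\<close> lies just below \<open>x\<close>, and \<open>q\<close> nearly agrees with \<open>p\<close> up to \<open>\<psi>1\<close> and lies just above \<open>y\<close> with respect to \<open>\<phi>\<close>.\<close>
    obtain p where p: "p \<in> S" "\<And>\<psi>. \<psi> \<in> insert \<phi> F \<Longrightarrow> \<bar>\<psi> p - \<psi> (x - \<eta> *\<^sub>R E)\<bar> < \<rho>"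
      using close[of \<rho> "x - \<eta> *\<^sub>R E"] \<rho> by auto
    define c where "c = (\<phi> y - \<phi> p + \<eta> * A + \<epsilon> / 2) / a \<psi>1"
    define q0 where "q0 = p + c *\<^sub>R d \<psi>1 - \<eta> *\<^sub>R E"
    obtain q where q: "q \<in> S" "\<And>\<psi>. \<psi> \<in> insert \<phi> F \<Longrightarrow> \<bar>\<psi> q - \<psi> q0\<bar> < \<rho>"
      using close[of \<rho> q0] \<rho> by auto
    have q0\<phi>: "\<phi> q0 = \<phi> y + \<epsilon> / 2"
      unfolding q0_def lins[OF lin\<phi>] using two apos[OF two(1)] by (simp add: \<phi>d \<phi>E c_def)
    have 1: "D \<phi> y - \<epsilon> \<le> D \<phi> q"
      by (rule up[OF insertI1 q(1) y]) (use q0\<phi> q(2)[OF insertI1] \<rho> \<eta>A \<eta> \<epsilon> in linarith)+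
    have p\<phi>: "\<phi> (x - \<eta> *\<^sub>R E) = \<phi> x - \<eta> * A"
      unfolding lins[OF lin\<phi>] by (simp add: \<phi>E)
    have 2: "D \<phi> p - \<epsilon> \<le> D \<phi> x"
      by (rule up[OF insertI1 x p(1)]) (use p\<phi> p(2)[OF insertI1] \<rho> \<eta>A \<eta> \<epsilon> in linarith)+
    have "D \<phi> q - D \<phi> p \<le> (2 * A + 1) * \<epsilon>"
    proof (rule step[OF \<epsilon> p(1) q(1)])
      fix \<psi> assume \<psi>: "\<psi> \<in> F" "\<psi> \<noteq> \<psi>1"
      have "\<psi> q0 = \<psi> p - \<eta>"
        unfolding q0_def lins[OF linF[OF \<psi>(1)]] using \<psi> two by (simp add: dual0 E)
      then show "- \<epsilon> < \<psi> q - \<psi> p \<and> \<psi> q - \<psi> p < 0"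
        using q(2)[OF \<phi>F[OF \<psi>(1)]] \<rho> \<eta>A \<eta> \<eta>Ap \<epsilon> by linarith
    qed
    then have "D \<phi> y \<le> D \<phi> x + (2 * A + 3) * \<epsilon>" using 1 2 by (simp add: algebra_simps)
    also have "(2 * A + 3) * \<epsilon> = e" unfolding \<epsilon>_def using A by simp
    finally show "D \<phi> y \<le> D \<phi> x + e" .
  qed
  from main[OF x y] main[OF y x] show ?thesis unfolding D_def by linarith
qed

section \<open>Dependent functionals\<close>

text \<open>
  Add the basis vectors one at a time; each of them makes at most one further functional
  necessary.
\<close>

lemma finite_subfamily_same_kernel:
  fixes \<Psi> :: "('v::real_vector \<Rightarrow> real) set"
  assumes "finite B" and lin: "\<And>\<psi>. \<psi> \<in> \<Psi> \<Longrightarrow> linear \<psi>"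
  shows "\<exists>F. finite F \<and> F \<subseteq> \<Psi> \<and> (\<forall>e\<in>span B. (\<forall>\<psi>\<in>F. \<psi> e = 0) \<longrightarrow> (\<forall>\<psi>\<in>\<Psi>. \<psi> e = 0))"
  using \<open>finite B\<close>
proof induction
  case empty
  show ?case by (intro exI[of _ "{}"]) (simp add: linear_0 lin)
next
  case (insert b B)
  then obtain F where F: "finite F" "F \<subseteq> \<Psi>"
    and ker: "\<And>e. e \<in> span B \<Longrightarrow> (\<forall>\<psi>\<in>F. \<psi> e = 0) \<Longrightarrow> (\<forall>\<psi>\<in>\<Psi>. \<psi> e = 0)" by blast
  have split: "\<exists>k. x - k *\<^sub>R b \<in> span B" if "x \<in> span (insert b B)" for x
    using that by (simp add: span_insert)
  show ?case
  proof (cases "\<exists>s\<in>span B. (\<forall>\<psi>\<in>F. \<psi> (b + s) = 0) \<and> (\<exists>\<psi>\<in>\<Psi>. \<psi> (b + s) \<noteq> 0)")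
    case False
    have "\<forall>\<psi>\<in>\<Psi>. \<psi> e = 0" if e: "e \<in> span (insert b B)" "\<forall>\<psi>\<in>F. \<psi> e = 0" for e
    proof -
      from split[OF e(1)] obtain k where k: "e - k *\<^sub>R b \<in> span B" by blast
      show ?thesis
      proof (cases "k = 0")
        case True
        then have "e \<in> span B" using k by simp
        from ker[OF this e(2)] show ?thesis .
      next
        case k0: False
        define s where "s = (1/k) *\<^sub>R (e - k *\<^sub>R b)"
        have s: "s \<in> span B" unfolding s_def by (intro span_scale k)
        have bs: "b + s = (1/k) *\<^sub>R e" unfolding s_def using k0 by (simp add: scaleR_diff_right)
        have sc: "\<psi> (b + s) = (1/k) * \<psi> e" if "\<psi> \<in> \<Psi>" for \<psi>
          unfolding bs by (simp add: linear_scale[OF lin[OF that]])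
        have "\<forall>\<psi>\<in>F. \<psi> (b + s) = 0"
        proof
          fix \<psi> assume \<psi>: "\<psi> \<in> F"
          then have "\<psi> \<in> \<Psi>" using F(2) by blast
          from sc[OF this] show "\<psi> (b + s) = 0" using bspec[OF e(2) \<psi>] by simp
        qed
        with False s have z: "\<forall>\<psi>\<in>\<Psi>. \<psi> (b + s) = 0" by blast
        show ?thesis
        proof
          fix \<psi> assume \<psi>: "\<psi> \<in> \<Psi>"
          show "\<psi> e = 0" using sc[OF \<psi>] bspec[OF z \<psi>] k0 by simp
        qed
      qed
    qed
    then show ?thesis using F by blast
  next
    case True
    then obtain s \<psi>0 where s: "s \<in> span B" "\<forall>\<psi>\<in>F. \<psi> (b + s) = 0" and \<psi>0: "\<psi>0 \<in> \<Psi>" "\<psi>0 (b + s) \<noteq> 0"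
      by blast
    have "\<forall>\<psi>\<in>\<Psi>. \<psi> e = 0" if e: "e \<in> span (insert b B)" "\<forall>\<psi>\<in>insert \<psi>0 F. \<psi> e = 0" for e
    proof -
      from split[OF e(1)] obtain k where k: "e - k *\<^sub>R b \<in> span B" by blast
      define e' where "e' = e - k *\<^sub>R (b + s)"
      have e': "e' \<in> span B" unfolding e'_def using span_diff[OF k span_scale[OF s(1), of k]]
        by (simp add: algebra_simps)
      have val: "\<psi> e' = \<psi> e - k * \<psi> (b + s)" if "\<psi> \<in> \<Psi>" for \<psi>
        unfolding e'_def by (simp add: linear_diff[OF lin[OF that]] linear_scale[OF lin[OF that]])
      have "\<forall>\<psi>\<in>F. \<psi> e' = 0"
      proof
        fix \<psi> assume \<psi>: "\<psi> \<in> F"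
        then have "\<psi> \<in> \<Psi>" using F(2) by blast
        from val[OF this] show "\<psi> e' = 0" using bspec[OF s(2) \<psi>] e(2) \<psi> by simp
      qed
      from ker[OF e' this] have z: "\<forall>\<psi>\<in>\<Psi>. \<psi> e' = 0" .
      have "\<psi>0 e = 0" using e(2) by blast
      then have "k * \<psi>0 (b + s) = 0" using val[OF \<psi>0(1)] bspec[OF z \<psi>0(1)] by linarith
      then have "k = 0" using \<psi>0(2) by simp
      then have "e' = e" by (simp add: e'_def)
      then show ?thesis using z by blast
    qed
    moreover have "finite (insert \<psi>0 F)" "insert \<psi>0 F \<subseteq> \<Psi>" using F \<psi>0(1) by blast+
    ultimately show ?thesis by blast
  qed
qed

lemma kernel_inclusion_imp_combination:
  fixes \<phi> :: "'v::real_vector \<Rightarrow> real"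
  assumes "finite F" and "\<And>\<psi>. \<psi> \<in> F \<Longrightarrow> linear \<psi>" and "linear \<phi>"
    and "\<And>x. (\<forall>\<psi>\<in>F. \<psi> x = 0) \<Longrightarrow> \<phi> x = 0"
  shows "\<exists>a. \<forall>x. \<phi> x = (\<Sum>\<psi>\<in>F. a \<psi> * \<psi> x)"
  using assms
proof (induction F arbitrary: \<phi>)
  case empty
  have "\<phi> x = 0" for x by (rule empty.prems(3)) simp
  then show ?case by simp
next
  case (insert \<psi> F)
  note lin\<psi> = insert.prems(1)[OF insertI1] and lin\<phi> = insert.prems(2)
  show ?case
  proof (cases "\<exists>e. (\<forall>\<theta>\<in>F. \<theta> e = 0) \<and> \<psi> e \<noteq> 0")
    case True
    then obtain e where e: "\<forall>\<theta>\<in>F. \<theta> e = 0" "\<psi> e \<noteq> 0" by blast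
    define \<theta>0 where "\<theta>0 = (\<lambda>x. \<phi> x - (\<phi> e / \<psi> e) * \<psi> x)"
    have "\<exists>a. \<forall>x. \<theta>0 x = (\<Sum>\<psi>\<in>F. a \<psi> * \<psi> x)"
    proof (rule insert.IH)
      show "linear \<theta>0" unfolding \<theta>0_def
        by (rule linearI) (simp_all add: linear_add[OF lin\<psi>] linear_add[OF lin\<phi>] linear_scale[OF lin\<psi>]
            linear_scale[OF lin\<phi>] algebra_simps add_divide_distrib)
      fix x assume x: "\<forall>\<theta>\<in>F. \<theta> x = 0"
      have "\<phi> (x - (\<psi> x / \<psi> e) *\<^sub>R e) = 0"
      proof (rule insert.prems(3), rule ballI)
        fix \<theta> assume \<theta>: "\<theta> \<in> insert \<psi> F"
        show "\<theta> (x - (\<psi> x / \<psi> e) *\<^sub>R e) = 0"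
        proof (cases "\<theta> = \<psi>")
          case True
          then show ?thesis using e(2) by (simp add: linear_diff[OF lin\<psi>] linear_scale[OF lin\<psi>])
        next
          case False
          then have "\<theta> \<in> F" using \<theta> by blast
          from bspec[OF x this] bspec[OF e(1) this] insert.prems(1)[OF \<theta>] show ?thesis
            by (simp add: linear_diff linear_scale)
        qed
      qed
      then show "\<theta>0 x = 0" unfolding \<theta>0_def
        by (simp add: linear_diff[OF lin\<phi>] linear_scale[OF lin\<phi>])
    qed (rule insert.prems(1)[OF insertI2])
    then obtain a where a: "\<And>x. \<theta>0 x = (\<Sum>\<psi>\<in>F. a \<psi> * \<psi> x)" by blast
    have "\<phi> x = (\<Sum>\<theta>\<in>insert \<psi> F. (a(\<psi> := \<phi> e / \<psi> e)) \<theta> * \<theta> x)" for x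
    proof -
      have "(\<Sum>\<theta>\<in>F. (a(\<psi> := \<phi> e / \<psi> e)) \<theta> * \<theta> x) = \<theta>0 x"
        unfolding a using insert.hyps by (intro sum.cong) auto
      then show ?thesis using insert.hyps by (simp add: \<theta>0_def)
    qed
    then show ?thesis by blast
  next
    case False
    have "\<exists>a. \<forall>x. \<phi> x = (\<Sum>\<psi>\<in>F. a \<psi> * \<psi> x)"
    proof (rule insert.IH)
      fix x assume x: "\<forall>\<theta>\<in>F. \<theta> x = 0"
      with False have "\<psi> x = 0" by blast
      with x have "\<forall>\<theta>\<in>insert \<psi> F. \<theta> x = 0" by blast
      then show "\<phi> x = 0" by (rule insert.prems(3))
    qed (rule insert.prems(1)[OF insertI2], assumption, rule insert.prems(2))
    then obtain a where a: "\<And>x. \<phi> x = (\<Sum>\<psi>\<in>F. a \<psi> * \<psi> x)" by blast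
    have "\<phi> x = (\<Sum>\<theta>\<in>insert \<psi> F. (a(\<psi> := 0)) \<theta> * \<theta> x)" for x
    proof -
      have "(\<Sum>\<theta>\<in>F. (a(\<psi> := 0)) \<theta> * \<theta> x) = \<phi> x"
        unfolding a using insert.hyps by (intro sum.cong) auto
      then show ?thesis using insert.hyps by simp
    qed
    then show ?thesis by blast
  qed
qed

text \<open>
  In a finite-dimensional space this says that \<open>\<phi>\<close> is a linear combination of smooth functionals
  other than \<open>\<phi>\<close> and \<open>- \<phi>\<close>. In matroid terms: up to sign, \<open>\<phi>\<close> is not a coloop among the smooth
  functionals.
\<close>

definition dependent_functional :: "('v::real_normed_vector \<Rightarrow> real) \<Rightarrow> bool" where
  "dependent_functional \<phi> \<longleftrightarrow> \<phi> \<in> smooth_functionals \<and>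
     (\<forall>e. (\<forall>\<psi>\<in>smooth_functionals - {\<phi>, \<lambda>x. - \<phi> x}. \<psi> e = 0) \<longrightarrow> \<phi> e = 0)"

lemma dependent_functional_zero:
  assumes "dependent_functional \<phi>"
    and "\<And>\<psi>. \<psi> \<in> smooth_functionals - {\<phi>, \<lambda>x. - \<phi> x} \<Longrightarrow> \<psi> e = 0"
  shows "\<phi> e = 0"
  by (rule assms(1)[unfolded dependent_functional_def, THEN conjunct2, THEN spec, THEN mp])
    (rule ballI, rule assms(2))

text \<open>
  Both functionals have dual norm \<open>1\<close>.
\<close>

lemma proportional_smooth_functionals:
  fixes \<phi> \<psi> :: "'v::real_normed_vector \<Rightarrow> real"
  assumes \<phi>: "\<phi> \<in> smooth_functionals" and \<psi>: "\<psi> \<in> smooth_functionals" and nz: "\<exists>u::'v. u \<noteq> 0"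
    and scaled: "\<And>x. \<phi> x = a * \<psi> x"
  shows "\<psi> \<in> {\<phi>, \<lambda>x. - \<phi> x}"
proof -
  obtain u :: 'v where u: "u \<noteq> 0" using nz by blast
  have ex: "\<exists>v::'v. v \<noteq> 0 \<and> \<theta> v = norm v" if "\<theta> \<in> smooth_functionals" for \<theta>
  proof -
    from that obtain v C where lin: "linear \<theta>" and up: "\<And>h. norm (v + h) \<le> \<theta> (v + h) + C * (norm h)\<^sup>2"
      and pv: "\<theta> v = norm v" and C: "C \<ge> 0" by (rule smooth_functionalsE) blast
    from smooth_at_nonzero[OF lin up C u] pv show ?thesis by blast
  qed
  obtain v where v: "v \<noteq> 0" "\<phi> v = norm v" using ex[OF \<phi>] by blast
  obtain w where w: "w \<noteq> 0" "\<psi> w = norm w" using ex[OF \<psi>] by blast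
  have "norm v \<le> \<bar>a\<bar> * norm v"
  proof -
    have "norm v \<le> \<bar>a\<bar> * \<bar>\<psi> v\<bar>" using v(2) scaled[of v] by (simp flip: abs_mult)
    also have "\<dots> \<le> \<bar>a\<bar> * norm v" by (intro mult_left_mono smooth_functional_abs_le[OF \<psi>]) simp
    finally show ?thesis .
  qed
  then have 1: "\<bar>a\<bar> \<ge> 1" using v(1) by simp
  have "\<bar>a\<bar> * norm w = \<bar>\<phi> w\<bar>" unfolding scaled[of w] w(2) by (simp add: abs_mult)
  then have "\<bar>a\<bar> * norm w \<le> norm w" using smooth_functional_abs_le[OF \<phi>, of w] by simp
  then have "\<bar>a\<bar> \<le> 1" using w(1) by simp
  then have "a = 1 \<or> a = -1" using 1 by linarith
  then show ?thesis
  proof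
    assume "a = 1" then have "\<psi> = \<phi>" using scaled by auto
    then show ?thesis by simp
  next
    assume "a = -1" then have "\<psi> = (\<lambda>x. - \<phi> x)" using scaled by auto
    then show ?thesis by simp
  qed
qed

text \<open>
  Take a smallest set \<open>F\<close> of other smooth functionals whose common kernel lies in the kernel of
  \<open>\<phi>\<close>. Then \<open>\<phi>\<close> is a combination of \<open>F\<close>; by minimality all coefficients are nonzero and dual
  vectors exist; and \<open>F\<close> has at least two elements, since proportional smooth functionals agree
  up to sign. Changing signs makes the coefficients positive.
\<close>

lemma (in finite_dim_basis) dependent_displacement_constant:
  fixes h :: "'v \<Rightarrow> 'v" and \<phi> :: "'v \<Rightarrow> real"
  assumes dep: "dependent_functional \<phi>" and nz: "\<exists>u::'v. u \<noteq> 0"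
    and dense: "closure S = UNIV"
    and near: "\<And>x. x \<in> S \<Longrightarrow> norm (h x - x) \<le> K"
    and mono: "\<And>\<psi> x y. \<psi> \<in> smooth_functionals \<Longrightarrow> x \<in> S \<Longrightarrow> y \<in> S \<Longrightarrow> \<psi> x > \<psi> y \<Longrightarrow> \<psi> (h x) \<ge> \<psi> (h y)"
    and x: "x \<in> S" and y: "y \<in> S"
  shows "\<phi> (h x) - \<phi> x = \<phi> (h y) - \<phi> y"
proof -
  define \<Psi> where "\<Psi> = smooth_functionals - {\<phi>, \<lambda>x. - \<phi> x}"
  have \<phi>: "\<phi> \<in> smooth_functionals" and ker: "\<And>e. (\<forall>\<psi>\<in>\<Psi>. \<psi> e = 0) \<Longrightarrow> \<phi> e = 0"
    using dep unfolding dependent_functional_def \<Psi>_def by blast+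
  have \<Psi>: "\<psi> \<in> \<Psi> \<Longrightarrow> \<psi> \<in> smooth_functionals" for \<psi> by (simp add: \<Psi>_def)
  let ?P = "\<lambda>F. finite F \<and> F \<subseteq> \<Psi> \<and> (\<forall>e. (\<forall>\<psi>\<in>F. \<psi> e = 0) \<longrightarrow> \<phi> e = 0)"
  have lin\<Psi>: "linear \<psi>" if "\<psi> \<in> \<Psi>" for \<psi>
    using smooth_functional_linear[OF \<Psi>[OF that]] .
  obtain F0 where F0: "finite F0" "F0 \<subseteq> \<Psi>"
    and F0ker: "\<forall>e\<in>span Bs. (\<forall>\<psi>\<in>F0. \<psi> e = 0) \<longrightarrow> (\<forall>\<psi>\<in>\<Psi>. \<psi> e = 0)"
    using finite_subfamily_same_kernel[OF finite_Bs lin\<Psi>] by metis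
  have "?P F0"
  proof (intro conjI allI impI F0)
    fix e assume "\<forall>\<psi>\<in>F0. \<psi> e = 0"
    then have "\<forall>\<psi>\<in>\<Psi>. \<psi> e = 0" using F0ker span_Bs by blast
    then show "\<phi> e = 0" by (rule ker)
  qed
  from ex_has_least_nat[of ?P, OF this, of card]
  obtain F where F: "finite F" "F \<subseteq> \<Psi>" and Fker: "\<And>e. (\<forall>\<psi>\<in>F. \<psi> e = 0) \<Longrightarrow> \<phi> e = 0"
    and least: "\<And>G. ?P G \<Longrightarrow> card F \<le> card G" by blast
  have FS: "\<psi> \<in> F \<Longrightarrow> \<psi> \<in> smooth_functionals" for \<psi> using F(2) \<Psi> by auto
  have linF: "\<psi> \<in> F \<Longrightarrow> linear \<psi>" for \<psi> using FS smooth_functional_linear by blast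
  obtain a where a: "\<And>x. \<phi> x = (\<Sum>\<psi>\<in>F. a \<psi> * \<psi> x)"
    using kernel_inclusion_imp_combination[OF F(1) linF smooth_functional_linear[OF \<phi>] Fker] by blast
  have "\<exists>e. (\<forall>\<theta>\<in>F - {\<psi>}. \<theta> e = 0) \<and> \<phi> e \<noteq> 0" if "\<psi> \<in> F" for \<psi>
  proof (rule ccontr)
    assume "\<not> ?thesis"
    then have "?P (F - {\<psi>})" using F by blast
    from least[OF this] show False using F(1) that by (metis card_Diff1_less not_less)
  qed
  then have "\<forall>\<psi>\<in>F. \<exists>e. (\<forall>\<theta>\<in>F - {\<psi>}. \<theta> e = 0) \<and> \<phi> e \<noteq> 0" by blast
  from bchoice[OF this] obtain e
    where e: "\<forall>\<psi>\<in>F. (\<forall>\<theta>\<in>F - {\<psi>}. \<theta> (e \<psi>) = 0) \<and> \<phi> (e \<psi>) \<noteq> 0" ..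
  have e0: "\<theta> (e \<psi>) = 0" if "\<psi> \<in> F" "\<theta> \<in> F" "\<theta> \<noteq> \<psi>" for \<psi> \<theta> using e that by blast
  have e1: "\<phi> (e \<psi>) \<noteq> 0" if "\<psi> \<in> F" for \<psi> using e that by blast
  have val: "\<phi> (e \<psi>) = a \<psi> * \<psi> (e \<psi>)" if "\<psi> \<in> F" for \<psi>
  proof -
    have "\<phi> (e \<psi>) = (\<Sum>\<theta>\<in>F. if \<theta> = \<psi> then a \<psi> * \<psi> (e \<psi>) else 0)"
      unfolding a
    proof (intro sum.cong refl)
      fix \<theta> assume "\<theta> \<in> F"
      then show "a \<theta> * \<theta> (e \<psi>) = (if \<theta> = \<psi> then a \<psi> * \<psi> (e \<psi>) else 0)"
        using e0[OF that, of \<theta>] by (cases "\<theta> = \<psi>") simp_all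
    qed
    then show ?thesis using F(1) that by simp
  qed
  then have anz: "a \<psi> \<noteq> 0" and enz: "\<psi> (e \<psi>) \<noteq> 0" if "\<psi> \<in> F" for \<psi> using that e1[OF that] by auto
  obtain u :: 'v where u: "u \<noteq> 0" using nz by blast
  have "F \<noteq> {}"
  proof
    assume "F = {}"
    then have z: "\<phi> x = 0" for x using a by simp
    obtain v C where lin: "linear \<phi>" and up: "\<And>h. norm (v + h) \<le> \<phi> (v + h) + C * (norm h)\<^sup>2"
      and pv: "\<phi> v = norm v" and C: "C \<ge> 0" using \<phi> by (rule smooth_functionalsE) blast
    from smooth_at_nonzero[OF lin up C u] pv z show False by simp
  qed
  then obtain \<psi>1 where \<psi>1: "\<psi>1 \<in> F" by blast
  have "F \<noteq> {\<psi>1}"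
  proof
    assume "F = {\<psi>1}"
    then have "\<phi> x = a \<psi>1 * \<psi>1 x" for x using a by simp
    from proportional_smooth_functionals[OF \<phi> FS[OF \<psi>1] nz this] F(2) \<psi>1 show False
      by (auto simp: \<Psi>_def)
  qed
  then obtain \<psi>2 where \<psi>2: "\<psi>2 \<in> F" "\<psi>1 \<noteq> \<psi>2" using \<psi>1 by blast
  \<comment> \<open>The family \<open>\<sigma>\<close> changes the signs so that all coefficients become positive.\<close>
  define \<sigma> where "\<sigma> = (\<lambda>\<psi>::'v \<Rightarrow> real. if a \<psi> > 0 then \<psi> else (\<lambda>x. - \<psi> x))"
  have \<sigma>val: "\<sigma> \<psi> x = sgn (a \<psi>) * \<psi> x" if "\<psi> \<in> F" for \<psi> x
    using anz[OF that] by (auto simp: \<sigma>_def sgn_if)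
  have \<sigma>S: "\<sigma> \<psi> \<in> smooth_functionals" if "\<psi> \<in> F" for \<psi>
    using FS[OF that] smooth_functional_minus[OF FS[OF that]] by (simp add: \<sigma>_def)
  define d where "d = (\<lambda>\<psi>. (1 / \<sigma> \<psi> (e \<psi>)) *\<^sub>R e \<psi>)"
  have sgnz: "sgn (a \<psi>) \<noteq> 0" if "\<psi> \<in> F" for \<psi> using anz[OF that] by (simp add: sgn_zero_iff)
  have d1: "\<sigma> \<psi> (d \<psi>) = 1" if "\<psi> \<in> F" for \<psi>
    unfolding d_def using enz[OF that] anz[OF that] sgnz[OF that] linF[OF that] \<sigma>val[OF that]
    by (simp add: linear_scale)
  have d0: "\<sigma> \<theta> (d \<psi>) = 0" if "\<psi> \<in> F" "\<theta> \<in> F" "\<theta> \<noteq> \<psi>" for \<psi> \<theta>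
    unfolding \<sigma>val[OF that(2)] d_def using e0[OF that] linF[OF that(2)] by (simp add: linear_scale)
  have inj: "inj_on \<sigma> F"
  proof (rule inj_onI, rule ccontr)
    fix \<psi> \<theta> assume "\<psi> \<in> F" "\<theta> \<in> F" "\<sigma> \<psi> = \<sigma> \<theta>" "\<psi> \<noteq> \<theta>"
    then show False using d1[of \<psi>] d0[of \<psi> \<theta>] by simp
  qed
  define \<tau> where "\<tau> = inv_into F \<sigma>"
  have \<tau>: "\<tau> (\<sigma> \<psi>) = \<psi>" if "\<psi> \<in> F" for \<psi> unfolding \<tau>_def using inj that by (rule inv_into_f_f)
  show ?thesis
  proof (rule circuit_displacement_constant[of S h K \<phi> "\<sigma> ` F" "\<lambda>\<theta>. \<bar>a (\<tau> \<theta>)\<bar>" "\<lambda>\<theta>. d (\<tau> \<theta>)" "\<sigma> \<psi>1" "\<sigma> \<psi>2" x y])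
    have ins: "\<psi> \<in> smooth_functionals" if "\<psi> \<in> insert \<phi> (\<sigma> ` F)" for \<psi> using that \<phi> \<sigma>S by auto
    show "linear \<psi>" if "\<psi> \<in> insert \<phi> (\<sigma> ` F)" for \<psi> using smooth_functional_linear[OF ins[OF that]] .
    show "\<bar>\<psi> x\<bar> \<le> norm x" if "\<psi> \<in> insert \<phi> (\<sigma> ` F)" for \<psi> x using smooth_functional_abs_le[OF ins[OF that]] .
    show "\<psi> (h y) \<le> \<psi> (h x)" if "\<psi> \<in> insert \<phi> (\<sigma> ` F)" "x \<in> S" "y \<in> S" "\<psi> y < \<psi> x" for \<psi> x y
      using mono[OF ins[OF that(1)] that(2-4)] .
    show "\<phi> x = (\<Sum>\<psi>\<in>\<sigma> ` F. \<bar>a (\<tau> \<psi>)\<bar> * \<psi> x)" for x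
    proof -
      have "(\<Sum>\<psi>\<in>\<sigma> ` F. \<bar>a (\<tau> \<psi>)\<bar> * \<psi> x) = (\<Sum>\<psi>\<in>F. \<bar>a \<psi>\<bar> * \<sigma> \<psi> x)"
        by (subst sum.reindex[OF inj]) (auto intro!: sum.cong simp: \<tau>)
      also have "\<dots> = (\<Sum>\<psi>\<in>F. a \<psi> * \<psi> x)"
        by (intro sum.cong refl) (simp only: \<sigma>val mult.assoc[symmetric] abs_mult_sgn)
      finally show ?thesis using a by simp
    qed
    show "\<sigma> \<psi>1 \<noteq> \<sigma> \<psi>2" using inj \<psi>1 \<psi>2 by (auto dest: inj_onD)
    show "0 < \<bar>a (\<tau> \<theta>)\<bar>" if "\<theta> \<in> \<sigma> ` F" for \<theta>
    using that anz by (auto simp: \<tau>)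
    show "\<theta> (d (\<tau> \<theta>)) = 1" if "\<theta> \<in> \<sigma> ` F" for \<theta>
      using that d1 by (auto simp: \<tau>)
    show "\<eta> (d (\<tau> \<theta>)) = 0" if "\<theta> \<in> \<sigma> ` F" "\<eta> \<in> \<sigma> ` F" "\<eta> \<noteq> \<theta>" for \<theta> \<eta>
    proof -
      from that obtain \<psi> \<xi> where "\<psi> \<in> F" "\<xi> \<in> F" "\<theta> = \<sigma> \<psi>" "\<eta> = \<sigma> \<xi>" "\<xi> \<noteq> \<psi>" by blast
      then show ?thesis using d0[of \<psi> \<xi>] by (simp add: \<tau>)
    qed
    show "norm (h x - x) \<le> K" if "x \<in> S" for x using near[OF that] .
  qed (use dense F(1) \<psi>1 \<psi>2(1) x y in simp_all)
qed

section \<open>Coordinates of a direct sum with a maximum-norm summand\<close>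

lemma linf_norm_less_iff: "r > 0 \<Longrightarrow> linf_norm d x < r \<longleftrightarrow> (\<forall>i<d. \<bar>x i\<bar> < r)"
  unfolding linf_norm_def by (subst Max_less_iff) auto

lemma linf_norm_le_iff: "r \<ge> 0 \<Longrightarrow> linf_norm d x \<le> r \<longleftrightarrow> (\<forall>i<d. \<bar>x i\<bar> \<le> r)"
  unfolding linf_norm_def by (subst Max_le_iff) auto

lemma linf_norm_attained: "linf_norm d x > 0 \<Longrightarrow> \<exists>i<d. linf_norm d x = \<bar>x i\<bar>"
proof -
  assume a: "linf_norm d x > 0"
  have "linf_norm d x \<in> insert 0 ((\<lambda>i. \<bar>x i\<bar>) ` {..<d})"
    unfolding linf_norm_def by (rule Max_in) auto
  with a show ?thesis by auto
qed

lemma linf_norm_Suc: "linf_norm (Suc d) x = max \<bar>x d\<bar> (linf_norm d x)"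
proof -
  have "insert 0 ((\<lambda>i. \<bar>x i\<bar>) ` {..<Suc d}) = insert \<bar>x d\<bar> (insert 0 ((\<lambda>i. \<bar>x i\<bar>) ` {..<d}))"
    unfolding lessThan_Suc by blast
  then show ?thesis unfolding linf_norm_def by (simp only:) (rule Max_insert, auto)
qed

lemma linf_norm_cong: "(\<And>i. i < d \<Longrightarrow> x i = y i) \<Longrightarrow> linf_norm d x = linf_norm d y"
  unfolding linf_norm_def by (intro arg_cong[of _ _ Max] arg_cong[of _ _ "insert 0"] image_cong) auto

locale linf_direct_sum =
  fixes U W :: "'v::real_normed_vector set" and d :: nat and T :: "'v \<Rightarrow> nat \<Rightarrow> real"
  assumes direct_sum: "max_direct_sum U W" and isometry: "linf_isometry W d T"
begin

abbreviation "u_part \<equiv> component U W"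
abbreviation "w_part \<equiv> component W U"
abbreviation "cc v \<equiv> T (component W U v)"

lemma subspaces: "subspace U" "subspace W"
  using direct_sum by (auto simp: max_direct_sum_def)

lemma disjoint: "u \<in> U \<Longrightarrow> u \<in> W \<Longrightarrow> u = 0"
  using direct_sum by (auto simp: max_direct_sum_def)

lemma parts_unique:
  assumes "u \<in> U" "w \<in> W"
  shows "u_part (u + w) = u" "w_part (u + w) = w"
proof -
  show "u_part (u + w) = u"
    unfolding component_def
  proof (rule the_equality)
    fix a assume a: "a \<in> U \<and> u + w - a \<in> W"
    have "a - u \<in> U" using a assms subspaces by (simp add: subspace_diff)
    moreover have "w - (u + w - a) \<in> W" using a assms subspaces by (blast intro: subspace_diff)
    ultimately show "a = u" using disjoint[of "a - u"] by simp
  qed (use assms in auto)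
  show "w_part (u + w) = w"
    unfolding component_def
  proof (rule the_equality)
    fix a assume a: "a \<in> W \<and> u + w - a \<in> U"
    have "a - w \<in> W" using a assms subspaces by (simp add: subspace_diff)
    moreover have "u - (u + w - a) \<in> U" using a assms subspaces by (blast intro: subspace_diff)
    ultimately show "a = w" using disjoint[of "a - w"] by simp
  qed (use assms in auto)
qed

lemma parts: "u_part v \<in> U" "w_part v \<in> W" "u_part v + w_part v = v"
proof -
  obtain u w where "u \<in> U" "w \<in> W" "v = u + w"
    using direct_sum unfolding max_direct_sum_def by blast
  then show "u_part v \<in> U" "w_part v \<in> W" "u_part v + w_part v = v"
    using parts_unique[of u w] by auto
qed

lemma parts_add: "u_part (x + y) = u_part x + u_part y" "w_part (x + y) = w_part x + w_part y"
proof -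
  have "(u_part x + u_part y) + (w_part x + w_part y) = (u_part x + w_part x) + (u_part y + w_part y)"
    by (simp add: algebra_simps)
  then have eq: "x + y = (u_part x + u_part y) + (w_part x + w_part y)" unfolding parts(3) by (rule sym)
  show "u_part (x + y) = u_part x + u_part y" "w_part (x + y) = w_part x + w_part y"
    by (subst eq, intro parts_unique subspace_add subspaces parts)+
qed

lemma parts_scale: "u_part (c *\<^sub>R x) = c *\<^sub>R u_part x" "w_part (c *\<^sub>R x) = c *\<^sub>R w_part x"
proof -
  have eq: "c *\<^sub>R x = c *\<^sub>R u_part x + c *\<^sub>R w_part x"
    using parts(3)[of x] by (simp flip: scaleR_add_right)
  show "u_part (c *\<^sub>R x) = c *\<^sub>R u_part x" "w_part (c *\<^sub>R x) = c *\<^sub>R w_part x"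
    by (subst eq, intro parts_unique subspace_scale subspaces parts)+
qed

lemma linear_parts: "linear u_part" "linear w_part"
  by (auto intro!: linearI simp: parts_add parts_scale)

lemma bij_T: "bij_betw T W (linf_space d)"
  and T_add: "x \<in> W \<Longrightarrow> y \<in> W \<Longrightarrow> T (x + y) i = T x i + T y i"
  and T_scale: "x \<in> W \<Longrightarrow> T (c *\<^sub>R x) i = c * T x i"
  and norm_T: "x \<in> W \<Longrightarrow> linf_norm d (T x) = norm x"
  using isometry unfolding linf_isometry_def by blast+

lemma linear_cc: "linear (\<lambda>v. cc v i)"
  by (rule linearI) (simp_all add: parts_add parts_scale T_add T_scale parts(2))

lemma cc_in: "cc v \<in> linf_space d"
  using bij_betw_apply[OF bij_T parts(2)] .

lemma cc_zero: "u \<in> U \<Longrightarrow> cc u i = 0"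
proof -
  assume u: "u \<in> U"
  have "w_part u = w_part 0"
    using parts_unique(2)[OF u subspace_0[OF subspaces(2)]] linear_0[OF linear_parts(2)] by simp
  then show ?thesis using linear_0[OF linear_cc[of i]] by simp
qed

lemma norm_w_part: "norm (w_part v) = linf_norm d (cc v)"
  using norm_T[OF parts(2)] by (rule sym)

lemma norm_parts: "norm v = max (norm (u_part v)) (norm (w_part v))"
proof -
  have "\<forall>u\<in>U. \<forall>w\<in>W. norm (u + w) = max (norm u) (norm w)"
    using direct_sum unfolding max_direct_sum_def by blast
  from bspec[OF bspec[OF this parts(1)[of v]] parts(2)[of v]] show ?thesis unfolding parts(3) .
qed

lemma norm_less_iff: "r > 0 \<Longrightarrow> norm v < r \<longleftrightarrow> norm (u_part v) < r \<and> (\<forall>i<d. \<bar>cc v i\<bar> < r)"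
  unfolding norm_parts[of v] norm_w_part by (simp add: linf_norm_less_iff)

lemma norm_le_iff: "r \<ge> 0 \<Longrightarrow> norm v \<le> r \<longleftrightarrow> norm (u_part v) \<le> r \<and> (\<forall>i<d. \<bar>cc v i\<bar> \<le> r)"
  unfolding norm_parts[of v] norm_w_part by (simp add: linf_norm_le_iff)

lemma norm_u_part_le: "norm (u_part v) \<le> norm v"
  unfolding norm_parts[of v] by simp

lemma cc_le_norm: "i < d \<Longrightarrow> \<bar>cc v i\<bar> \<le> norm v"
  using norm_le_iff[OF norm_ge_zero, of v v] by blast

lemma cc_diff: "cc (x - y) i = cc x i - cc y i"
  by (rule linear_diff[OF linear_cc])

lemma u_part_diff: "u_part (x - y) = u_part x - u_part y"
  by (rule linear_diff[OF linear_parts(1)])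

lemma vector_eqI: "u_part x = u_part y \<Longrightarrow> (\<And>i. i < d \<Longrightarrow> cc x i = cc y i) \<Longrightarrow> x = y"
proof -
  assume a: "u_part x = u_part y" "\<And>i. i < d \<Longrightarrow> cc x i = cc y i"
  have "norm (x - y) \<le> 0"
      by (rule norm_le_iff[OF order_refl, THEN iffD2]) (simp add: cc_diff u_part_diff a)
  then show ?thesis by simp
qed

lemma vector_exists:
  assumes "u \<in> U"
  obtains v where "u_part v = u" "\<And>i. i < d \<Longrightarrow> cc v i = c i"
proof -
  define c' where "c' = (\<lambda>i. if i < d then c i else 0)"
  have "c' \<in> linf_space d" by (auto simp: c'_def linf_space_def)
  moreover have "T ` W = linf_space d" using bij_T by (rule bij_betw_imp_surj_on)
  ultimately have "c' \<in> T ` W" by simp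
  then obtain w where w': "c' = T w" and w1: "w \<in> W" by (rule imageE)
  note w = w1 w'[symmetric]
  show ?thesis
  proof (rule that[of "u + w"])
    show "u_part (u + w) = u" by (rule parts_unique(1)[OF assms w(1)])
    show "cc (u + w) i = c i" if "i < d" for i
      unfolding parts_unique(2)[OF assms w(1)] w(2) c'_def using that by simp
  qed
qed

lemma in_W_iff: "v \<in> W \<longleftrightarrow> u_part v = 0"
proof
  assume "u_part v = 0"
  then show "v \<in> W" using parts(2,3)[of v] by simp
next
  assume "v \<in> W"
  from parts_unique(1)[OF subspace_0[OF subspaces(1)] this] show "u_part v = 0" by simp
qed

text \<open>
  A smooth functional is the only functional of norm at most \<open>1\<close> that attains the norm at its
  point \<open>v\<close>. If \<open>norm v\<close> is attained by the \<open>W\<close>-component, then some signed coordinate attains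
  it too and must be \<open>\<phi>\<close>. Otherwise small changes in \<open>W\<close> do not increase the norm of \<open>v\<close>, so \<open>\<phi>\<close>
  vanishes on \<open>W\<close>.
\<close>

lemma smooth_functional_cases:
  assumes \<phi>: "\<phi> \<in> smooth_functionals" and nz: "\<exists>u::'v. u \<noteq> 0"
  shows "(\<forall>w\<in>W. \<phi> w = 0) \<or> (\<exists>i<d. \<phi> = (\<lambda>v. cc v i) \<or> \<phi> = (\<lambda>v. - cc v i))"
proof -
  from \<phi> obtain v C where lin: "linear \<phi>" and le: "\<And>x. \<phi> x \<le> norm x"
    and up: "\<And>h. norm (v + h) \<le> \<phi> (v + h) + C * (norm h)\<^sup>2" and pv: "\<phi> v = norm v" and C: "C \<ge> 0"
    by (rule smooth_functionalsE) blast
  have v: "v \<noteq> 0" using smooth_at_nonzero[OF lin up C] nz by auto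
  have unique: "\<theta> = \<phi>" if \<theta>: "linear \<theta>" "\<And>x. \<theta> x \<le> norm x" "\<theta> v = norm v" for \<theta>
  proof -
    have "\<theta> h \<le> \<phi> h" for h
    proof (rule field_le_epsilon)
      fix e :: real assume e: "e > 0"
      define s where "s = e / (C * (norm h)\<^sup>2 + 1)"
      have den: "C * (norm h)\<^sup>2 + 1 > 0" using C by (simp add: add_nonneg_pos)
      have s: "s > 0" unfolding s_def using e den by simp
      have "s * (C * (norm h)\<^sup>2) \<le> s * (C * (norm h)\<^sup>2 + 1)" using s by simp
      also have "\<dots> = e" unfolding s_def using den by simp
      finally have se: "s * (C * (norm h)\<^sup>2) \<le> e" .
      have "\<theta> (v + s *\<^sub>R h) \<le> \<phi> (v + s *\<^sub>R h) + C * (norm (s *\<^sub>R h))\<^sup>2"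
        using \<theta>(2)[of "v + s *\<^sub>R h"] up[of "s *\<^sub>R h"] by linarith
      then have "s * \<theta> h \<le> s * \<phi> h + C * (s * norm h)\<^sup>2"
        using s by (simp add: linear_add[OF lin] linear_add[OF \<theta>(1)] linear_scale[OF lin] linear_scale[OF \<theta>(1)] pv \<theta>(3))
      also have "C * (s * norm h)\<^sup>2 = s * (s * (C * (norm h)\<^sup>2))" by (simp add: power2_eq_square)
      also have "\<dots> \<le> s * e" using se s by (intro mult_left_mono) auto
      finally have "s * \<theta> h \<le> s * (\<phi> h + e)" by (simp add: distrib_left)
      then show "\<theta> h \<le> \<phi> h + e" using s by simp
    qed
    from this this[of "- h" for h] show ?thesis
      by (intro ext antisym) (auto simp: linear_neg[OF lin] linear_neg[OF \<theta>(1)])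
  qed
  show ?thesis
  proof (cases "norm (w_part v) = norm v")
    case True
    then have "linf_norm d (cc v) > 0" using v by (simp flip: norm_w_part)
    then obtain i where i: "i < d" "\<bar>cc v i\<bar> = norm v"
      using linf_norm_attained[of d "cc v"] True by (auto simp flip: norm_w_part)
    have bound: "cc x i \<le> norm x" "- cc x i \<le> norm x" for x using cc_le_norm[OF i(1), of x] by auto
    show ?thesis
    proof (cases "cc v i \<ge> 0")
      case True
      then have "(\<lambda>v. cc v i) = \<phi>" using i bound by (intro unique linear_cc) auto
      then show ?thesis using i(1) by blast
    next
      case False
      then have "(\<lambda>v. - cc v i) = \<phi>" using i bound by (intro unique linear_compose_neg linear_cc) auto
      then show ?thesis using i(1) by blast
    qed
  next
    case False
    then have lt: "norm (w_part v) < norm v" using norm_parts[of v] by linarith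
    have le0: "\<phi> w \<le> 0" if w: "w \<in> W" for w
    proof -
      define s where "s = (norm v - norm (w_part v)) / (norm w + 1)"
      have s: "s > 0" unfolding s_def using lt by (simp add: add_nonneg_pos)
      have "s * norm w \<le> s * (norm w + 1)" using s by simp
      also have "\<dots> = norm v - norm (w_part v)"
        unfolding s_def using norm_ge_zero[of w] by (simp add: add_nonneg_eq_0_iff)
      finally have "norm (w_part v + s *\<^sub>R w) \<le> norm v"
        using norm_triangle_ineq[of "w_part v" "s *\<^sub>R w"] s by simp
      moreover have "w_part (v + s *\<^sub>R w) = w_part v + s *\<^sub>R w" "u_part (v + s *\<^sub>R w) = u_part v"
        using w parts_unique[of 0 w] subspace_0[OF subspaces(1)] by (simp_all add: parts_add parts_scale)
      ultimately have "norm (v + s *\<^sub>R w) \<le> norm v"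
        using norm_parts[of "v + s *\<^sub>R w"] norm_u_part_le[of v] by simp
      then have "\<phi> v + s * \<phi> w \<le> norm v"
        using le[of "v + s *\<^sub>R w"] by (simp add: linear_add[OF lin] linear_scale[OF lin])
      then have "s * \<phi> w \<le> 0" using pv by simp
      then show ?thesis using s by (simp add: mult_le_0_iff)
    qed
    have "\<phi> w = 0" if "w \<in> W" for w
      using le0[OF that] le0[of "- w"] subspace_neg[OF subspaces(2) that] by (simp add: linear_neg[OF lin])
    then show ?thesis by blast
  qed
qed

text \<open>
  A coordinate of \<open>W\<close> is the only smooth functional, up to sign, that does not vanish on the
  corresponding basis vector of \<open>W\<close>, so it is not dependent.
\<close>

lemma dependent_functional_vanishes:
  assumes dep: "dependent_functional \<phi>" and nz: "\<exists>u::'v. u \<noteq> 0" and w: "w \<in> W"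
  shows "\<phi> w = 0"
proof (rule ccontr)
  assume nw: "\<phi> w \<noteq> 0"
  have \<phi>: "\<phi> \<in> smooth_functionals" using dep by (simp add: dependent_functional_def)
  from smooth_functional_cases[OF \<phi> nz]
  have "\<exists>i<d. \<phi> = (\<lambda>v. cc v i) \<or> \<phi> = (\<lambda>v. - cc v i)"
  proof
    assume "\<forall>w\<in>W. \<phi> w = 0"
    then have "\<phi> w = 0" using w by (rule bspec)
    with nw show ?thesis by (rule notE)
  qed
  then obtain i where i: "i < d" "\<phi> = (\<lambda>v. cc v i) \<or> \<phi> = (\<lambda>v. - cc v i)"
    by (elim exE conjE) (rule that)
  obtain e where e: "u_part e = 0" "\<And>j. j < d \<Longrightarrow> cc e j = (if j = i then 1 else 0)"
    using vector_exists[OF subspace_0[OF subspaces(1)], of "\<lambda>j. if j = i then 1 else 0"] by blast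
  have eW: "e \<in> W" using e(1) by (simp add: in_W_iff)
  have "\<psi> e = 0" if \<psi>: "\<psi> \<in> smooth_functionals - {\<phi>, \<lambda>x. - \<phi> x}" for \<psi>
  proof -
    from \<psi> have "\<psi> \<in> smooth_functionals" by blast
    from smooth_functional_cases[OF this nz] show ?thesis
    proof
      assume "\<forall>w\<in>W. \<psi> w = 0" then show ?thesis using eW by (rule bspec)
    next
      assume "\<exists>j<d. \<psi> = (\<lambda>v. cc v j) \<or> \<psi> = (\<lambda>v. - cc v j)"
      then obtain j where j: "j < d" "\<psi> = (\<lambda>v. cc v j) \<or> \<psi> = (\<lambda>v. - cc v j)"
  by (elim exE conjE) (rule that)
      have "j \<noteq> i"
      proof
        assume "j = i"
        with i(2) j(2) have "\<psi> = \<phi> \<or> \<psi> = (\<lambda>x. - \<phi> x)" by (elim disjE) simp_all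
        with \<psi> show False by simp
      qed
      then have "cc e j = 0" using e(2)[OF j(1)] by simp
      with j(2) show ?thesis by (elim disjE) simp_all
    qed
  qed
  with dep have "\<phi> e = 0" by (rule dependent_functional_zero)
  moreover have "cc e i = 1" using e(2)[OF i(1)] by simp
  ultimately show False using i(2) by (elim disjE) simp_all
qed

end

section \<open>Maximality\<close>

text \<open>
  Otherwise there is a vector \<open>e\<close> on which \<open>\<phi>\<close> is \<open>1\<close> and all smooth functionals other than \<open>\<phi>\<close>
  and \<open>- \<phi>\<close> vanish. As the smooth functionals determine the norm, \<open>norm (v + c *\<^sub>R e)\<close> is the
  maximum of \<open>\<bar>c\<bar>\<close> and \<open>norm v\<close> whenever \<open>\<phi> v = 0\<close>. Hence \<open>W\<close> together with \<open>e\<close> spans a larger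
  maximum-norm summand, complemented by the kernel of \<open>\<phi>\<close> in \<open>U\<close>.
\<close>

lemma maximal_summand_imp_dependent:
  fixes U W :: "'v::real_normed_vector set"
  assumes dec: "linf_decomposition U W d T" and fd: "finite_dim_basis (Bs :: 'v set)"
    and nz: "\<exists>u::'v. u \<noteq> 0" and \<phi>: "\<phi> \<in> smooth_functionals" and van: "\<And>w. w \<in> W \<Longrightarrow> \<phi> w = 0"
  shows "dependent_functional \<phi>"
proof (rule ccontr)
  interpret linf_direct_sum U W d T
    using dec by unfold_locales (auto simp: linf_decomposition_def)
  interpret finite_dim_basis Bs by (rule fd)
  have lin: "linear \<phi>" using \<phi> by (rule smooth_functional_linear)
  assume "\<not> dependent_functional \<phi>"
  then have "\<exists>e0. (\<forall>\<psi>\<in>smooth_functionals - {\<phi>, \<lambda>x. - \<phi> x}. \<psi> e0 = 0) \<and> \<phi> e0 \<noteq> 0"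
    using \<phi> unfolding dependent_functional_def by blast
  then obtain e0 where e0: "\<forall>\<psi>\<in>smooth_functionals - {\<phi>, \<lambda>x. - \<phi> x}. \<psi> e0 = 0" "\<phi> e0 \<noteq> 0"
    by (elim exE conjE) (rule that)
  define e where "e = (1 / \<phi> e0) *\<^sub>R u_part e0"
  have split: "\<psi> (u_part x) + \<psi> (w_part x) = \<psi> x" if "linear \<psi>" for \<psi> :: "'v \<Rightarrow> real" and x
    using linear_add[OF that, of "u_part x" "w_part x"] unfolding parts(3) by simp
  have \<phi>u: "\<phi> (u_part x) = \<phi> x" for x using split[OF lin, of x] van[OF parts(2)[of x]] by simp
  have \<phi>e: "\<phi> e = 1" unfolding e_def linear_scale[OF lin] \<phi>u using e0(2) by simp
  have eU: "e \<in> U" unfolding e_def by (intro subspace_scale subspaces parts)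
  have other: "\<psi> e = 0" if \<psi>: "\<psi> \<in> smooth_functionals" "\<psi> \<noteq> \<phi>" "\<psi> \<noteq> (\<lambda>x. - \<phi> x)" for \<psi>
  proof -
    have lin\<psi>: "linear \<psi>" using \<psi>(1) by (rule smooth_functional_linear)
    have "\<psi> \<in> smooth_functionals - {\<phi>, \<lambda>x. - \<phi> x}" using \<psi> by simp
    with e0(1) have z: "\<psi> e0 = 0" by (rule bspec)
    have "\<psi> (u_part e0) = 0"
    proof (rule disjE[OF smooth_functional_cases[OF \<psi>(1) nz]])
      assume "\<forall>w\<in>W. \<psi> w = 0"
      then have "\<psi> (w_part e0) = 0" using parts(2) by (rule bspec)
      then show ?thesis using split[OF lin\<psi>, of e0] z by simp
    next
      assume "\<exists>i<d. \<psi> = (\<lambda>v. cc v i) \<or> \<psi> = (\<lambda>v. - cc v i)"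
      then obtain i where "\<psi> = (\<lambda>v. cc v i) \<or> \<psi> = (\<lambda>v. - cc v i)" by (elim exE conjE) (rule that)
      then show ?thesis using cc_zero[OF parts(1), of e0 i] by (elim disjE) simp_all
    qed
    then show ?thesis unfolding e_def by (simp add: linear_scale[OF lin\<psi>])
  qed
  have norm_e: "norm (v + c *\<^sub>R e) = max \<bar>c\<bar> (norm v)" if v: "\<phi> v = 0" for v c
  proof (rule antisym)
    have val: "\<phi> (v + c *\<^sub>R e) = c" by (simp add: linear_add[OF lin] linear_scale[OF lin] v \<phi>e)
    have oth: "\<psi> (v + c *\<^sub>R e) = \<psi> v" if "\<psi> \<in> smooth_functionals" "\<psi> \<noteq> \<phi>" "\<psi> \<noteq> (\<lambda>x. - \<phi> x)" for \<psi>
      using other[OF that] smooth_functional_linear[OF that(1)] by (simp add: linear_add linear_scale)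
    show "norm (v + c *\<^sub>R e) \<le> max \<bar>c\<bar> (norm v)"
    proof (rule norm_le_by_smooth_functionals)
      fix \<psi> :: "'v \<Rightarrow> real" assume \<psi>: "\<psi> \<in> smooth_functionals"
      consider "\<psi> = \<phi>" | "\<psi> = (\<lambda>x. - \<phi> x)" | "\<psi> \<noteq> \<phi>" "\<psi> \<noteq> (\<lambda>x. - \<phi> x)" by argo
      then show "\<psi> (v + c *\<^sub>R e) \<le> max \<bar>c\<bar> (norm v)"
        using val oth[OF \<psi>] smooth_functional_le[OF \<psi>, of v] abs_ge_self[of c] abs_ge_minus_self[of c]
by cases (simp_all add: le_max_iff_disj)
    qed
    have "\<bar>c\<bar> \<le> norm (v + c *\<^sub>R e)" using smooth_functional_abs_le[OF \<phi>, of "v + c *\<^sub>R e"] val by simp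
    moreover have "norm v \<le> norm (v + c *\<^sub>R e)"
    proof (rule norm_le_by_smooth_functionals)
      fix \<psi> :: "'v \<Rightarrow> real" assume \<psi>: "\<psi> \<in> smooth_functionals"
      consider "\<psi> = \<phi>" | "\<psi> = (\<lambda>x. - \<phi> x)" | "\<psi> \<noteq> \<phi>" "\<psi> \<noteq> (\<lambda>x. - \<phi> x)" by argo
      then show "\<psi> v \<le> norm (v + c *\<^sub>R e)"
        using v oth[OF \<psi>] smooth_functional_le[OF \<psi>, of "v + c *\<^sub>R e"] by cases simp_all
    qed
    ultimately show "max \<bar>c\<bar> (norm v) \<le> norm (v + c *\<^sub>R e)" by simp
  qed
  define W2 where "W2 = {v. v - \<phi> v *\<^sub>R e \<in> W}"
  define U2 where "U2 = {u \<in> U. \<phi> u = 0}"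
  define T2 where "T2 = (\<lambda>v. (cc v)(d := \<phi> v))"
  have W2I: "w + c *\<^sub>R e \<in> W2" if "w \<in> W" for w c
    unfolding W2_def using that by (simp add: linear_add[OF lin] linear_scale[OF lin] \<phi>e van)
  have W2E: "\<exists>w\<in>W. v = w + \<phi> v *\<^sub>R e" if "v \<in> W2" for v
    using that unfolding W2_def by (intro bexI[of _ "v - \<phi> v *\<^sub>R e"]) auto
  have sub2: "subspace W2" "subspace U2"
  proof -
    show "subspace W2"
    proof (rule subspaceI)
      show "0 \<in> W2" using W2I[OF subspace_0[OF subspaces(2)], of 0] by simp
    next
      fix x y assume "x \<in> W2" "y \<in> W2"
      then have "(x - \<phi> x *\<^sub>R e) + (y - \<phi> y *\<^sub>R e) \<in> W" unfolding W2_def by (intro subspace_add subspaces) auto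
      then show "x + y \<in> W2" unfolding W2_def by (simp add: linear_add[OF lin] algebra_simps)
    next
      fix c x assume "x \<in> W2"
      then have "c *\<^sub>R (x - \<phi> x *\<^sub>R e) \<in> W" unfolding W2_def by (intro subspace_scale subspaces) auto
      then show "c *\<^sub>R x \<in> W2" unfolding W2_def by (simp add: linear_scale[OF lin] algebra_simps)
    qed
    show "subspace U2"
      unfolding U2_def
      by (rule subspaceI) (auto simp: linear_0[OF lin] linear_add[OF lin] linear_scale[OF lin]
          intro: subspace_0 subspace_add subspace_scale subspaces)
  qed
  have sum2: "max_direct_sum U2 W2"
    unfolding max_direct_sum_def
  proof (intro conjI sub2 ballI allI)
    show "U2 \<inter> W2 = {0}"
    proof
      show "U2 \<inter> W2 \<subseteq> {0}"
      proof
        fix v assume "v \<in> U2 \<inter> W2"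
        then have "v \<in> U" "v \<in> W" by (auto simp: U2_def W2_def)
        then show "v \<in> {0}" using disjoint by simp
      qed
      show "{0} \<subseteq> U2 \<inter> W2" using sub2 by (simp add: subspace_0)
    qed
    show "\<exists>u\<in>U2. \<exists>w\<in>W2. v = u + w" for v
    proof (intro bexI)
      show "v = (u_part v - \<phi> v *\<^sub>R e) + (w_part v + \<phi> v *\<^sub>R e)" using parts(3)[of v] by simp
      show "w_part v + \<phi> v *\<^sub>R e \<in> W2" by (rule W2I[OF parts(2)])
      show "u_part v - \<phi> v *\<^sub>R e \<in> U2"
        unfolding U2_def using subspaces(1) parts(1) eU
        by (simp add: subspace_diff subspace_scale linear_diff[OF lin] linear_scale[OF lin] \<phi>u \<phi>e)
    qed
    fix u w2 assume u: "u \<in> U2" and w2: "w2 \<in> W2"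
    obtain w where w: "w \<in> W" "w2 = w + \<phi> w2 *\<^sub>R e" using W2E[OF w2] by blast
    have uU: "u \<in> U" "\<phi> u = 0" using u by (auto simp: U2_def)
    have "norm (u + w2) = norm ((u + w) + \<phi> w2 *\<^sub>R e)" by (subst w(2)) (simp add: add.assoc)
    also have "\<dots> = max \<bar>\<phi> w2\<bar> (norm (u + w))"
      by (rule norm_e) (simp add: linear_add[OF lin] uU van[OF w(1)])
    also have "norm (u + w) = max (norm u) (norm w)"
      using norm_parts[of "u + w"] parts_unique[OF uU(1) w(1)] by simp
    also have "max \<bar>\<phi> w2\<bar> (max (norm u) (norm w)) = max (norm u) (max \<bar>\<phi> w2\<bar> (norm w))"
      by (simp add: max.left_commute)
    also have "max \<bar>\<phi> w2\<bar> (norm w) = norm (w + \<phi> w2 *\<^sub>R e)"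
      by (rule norm_e[symmetric]) (rule van[OF w(1)])
    also have "w + \<phi> w2 *\<^sub>R e = w2" using w(2) by simp
    finally show "norm (u + w2) = max (norm u) (norm w2)" .
  qed
  have cc_W2: "cc (w + c *\<^sub>R e) i = T w i" if "w \<in> W" for w c i
  proof -
    have "w_part (w + c *\<^sub>R e) = w"
      using parts_unique(2)[OF subspace_scale[OF subspaces(1) eU, of c] that] by (simp add: add.commute)
    then show ?thesis by simp
  qed
  have iso2: "linf_isometry W2 (Suc d) T2"
    unfolding linf_isometry_def
  proof (intro conjI ballI allI)
    show "bij_betw T2 W2 (linf_space (Suc d))"
      unfolding bij_betw_def
    proof
      show "inj_on T2 W2"
      proof (rule inj_onI)
        fix x y assume x: "x \<in> W2" and y: "y \<in> W2" and eq: "T2 x = T2 y"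
        obtain wx where wx: "wx \<in> W" "x = wx + \<phi> x *\<^sub>R e" using W2E[OF x] by blast
        obtain wy where wy: "wy \<in> W" "y = wy + \<phi> y *\<^sub>R e" using W2E[OF y] by blast
        have \<phi>xy: "\<phi> x = \<phi> y" using fun_cong[OF eq, of d] by (simp add: T2_def)
        have ccxy: "cc x i = cc y i" if "i < d" for i using fun_cong[OF eq, of i] that by (simp add: T2_def)
        have "u_part x = u_part y"
          using parts_unique(1)[OF subspace_scale[OF subspaces(1) eU, of "\<phi> x"] wx(1)]
            parts_unique(1)[OF subspace_scale[OF subspaces(1) eU, of "\<phi> y"] wy(1)] wx(2) wy(2) \<phi>xy
          by (metis add.commute)
        then show "x = y" using ccxy by (rule vector_eqI)
      qed
      show "T2 ` W2 = linf_space (Suc d)"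
      proof (intro equalityI subsetI)
        fix t assume "t \<in> T2 ` W2"
        then obtain v where "t = (cc v)(d := \<phi> v)" unfolding T2_def by (elim imageE)
        then show "t \<in> linf_space (Suc d)" using cc_in[of v] by (simp add: linf_space_def)
      next
        fix t assume t: "t \<in> linf_space (Suc d)"
        have "t(d := 0) \<in> linf_space d" using t by (auto simp: linf_space_def Suc_le_eq)
        then have "t(d := 0) \<in> T ` W" using bij_betw_imp_surj_on[OF bij_T] by simp
        then obtain w where w: "t(d := 0) = T w" "w \<in> W" by (rule imageE)
        have "T2 (w + t d *\<^sub>R e) = t"
        proof
          fix i
          show "T2 (w + t d *\<^sub>R e) i = t i"
          proof (cases "i = d")
            case True
            then show ?thesis by (simp add: T2_def linear_add[OF lin] linear_scale[OF lin] \<phi>e van[OF w(2)])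
          next
            case False
            then show ?thesis using cc_W2[OF w(2)] fun_cong[OF w(1), of i] by (simp add: T2_def)
          qed
        qed
        then show "t \<in> T2 ` W2" using W2I[OF w(2), of "t d"] by (rule image_eqI[OF sym])
      qed
    qed
    show "T2 (x + y) i = T2 x i + T2 y i" for x y i
      using linear_add[OF linear_cc[of i], of x y] linear_add[OF lin, of x y] by (simp add: T2_def)
    show "T2 (c *\<^sub>R x) i = c * T2 x i" for c x i
      using linear_scale[OF linear_cc[of i], of c x] linear_scale[OF lin, of c x] by (simp add: T2_def)
    fix x assume x: "x \<in> W2"
    obtain w where w: "w \<in> W" "x = w + \<phi> x *\<^sub>R e" using W2E[OF x] by blast
    have "linf_norm d (T2 x) = linf_norm d (T w)"
    proof (rule linf_norm_cong)
      fix i assume "i < d"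
      then show "T2 x i = T w i" using cc_W2[OF w(1), of "\<phi> x" i] w(2) by (simp add: T2_def)
    qed
    then have "linf_norm (Suc d) (T2 x) = max \<bar>\<phi> x\<bar> (norm w)"
      unfolding linf_norm_Suc using norm_T[OF w(1)] by (simp add: T2_def)
    also have "\<dots> = norm (w + \<phi> x *\<^sub>R e)" by (rule norm_e[symmetric]) (rule van[OF w(1)])
    finally show "linf_norm (Suc d) (T2 x) = norm x" using w(2) by simp
  qed
  have "linf_summand W2" unfolding linf_summand_def using sum2 iso2 by blast
  moreover have "W \<subseteq> W2" using W2I[of _ 0] by auto
  ultimately have "W2 = W" using dec unfolding linf_decomposition_def by blast
  moreover have "e \<in> W2" using W2I[OF subspace_0[OF subspaces(2)], of 1] by simp
  ultimately show False using van[of e] \<phi>e by simp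
qed

section \<open>Rigidity of step isometries\<close>

lemma smooth_functional_compose:
  fixes B :: "'v::real_normed_vector \<Rightarrow> 'v"
  assumes \<phi>: "\<phi> \<in> smooth_functionals" and B: "linear B" "\<And>x. norm (B x) = norm x" "surj B"
  shows "(\<lambda>x. \<phi> (B x)) \<in> smooth_functionals"
proof -
  obtain v C where sm: "smooth_at \<phi> v C" using \<phi> by (auto simp: smooth_functionals_def)
  obtain v' where v': "v = B v'" using surjD[OF B(3)] by blast
  have "smooth_at (\<lambda>x. \<phi> (B x)) v' C"
    unfolding smooth_at_def
  proof (intro conjI allI)
    show "linear (\<lambda>x. \<phi> (B x))"
      using linear_compose[OF B(1) smooth_functional_linear[OF \<phi>]] by (simp add: o_def)
    show "\<phi> (B x) \<le> norm x" for x using smooth_functional_le[OF \<phi>, of "B x"] B(2) by simp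
    show "norm (v' + h) \<le> \<phi> (B (v' + h)) + C * (norm h)\<^sup>2" for h
    proof -
      have "norm (v + B h) \<le> \<phi> (v + B h) + C * (norm (B h))\<^sup>2"
        using sm unfolding smooth_at_def by blast
      then show ?thesis unfolding v' linear_add[OF B(1), symmetric] B(2) .
    qed
  qed
  then show ?thesis by (auto simp: smooth_functionals_def)
qed

lemma dependent_functional_compose:
  fixes B :: "'v::real_normed_vector \<Rightarrow> 'v"
  assumes dep: "dependent_functional \<phi>" and B: "linear B" "\<And>x. norm (B x) = norm x" "surj B"
  shows "dependent_functional (\<lambda>x. \<phi> (B x))"
  unfolding dependent_functional_def
proof (intro conjI allI impI)
  have \<phi>: "\<phi> \<in> smooth_functionals" using dep by (simp add: dependent_functional_def)
  then show "(\<lambda>x. \<phi> (B x)) \<in> smooth_functionals" using B by (rule smooth_functional_compose)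
  fix e assume e: "\<forall>\<psi>\<in>smooth_functionals - {\<lambda>x. \<phi> (B x), \<lambda>x. - \<phi> (B x)}. \<psi> e = 0"
  show "\<phi> (B e) = 0"
  proof (rule dependent_functional_zero[OF dep])
    fix \<theta> assume \<theta>: "\<theta> \<in> smooth_functionals - {\<phi>, \<lambda>x. - \<phi> x}"
    have ext: "\<theta> = \<eta>" if "(\<lambda>x. \<theta> (B x)) = (\<lambda>x. \<eta> (B x))" for \<eta> :: "'v \<Rightarrow> real"
    proof
      fix y
      obtain x where "y = B x" using surjD[OF B(3)] by blast
      then show "\<theta> y = \<eta> y" using fun_cong[OF that, of x] by simp
    qed
    have "\<theta> \<in> smooth_functionals" using \<theta> by simp
    then have "(\<lambda>x. \<theta> (B x)) \<in> smooth_functionals" using B by (rule smooth_functional_compose)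
    moreover have "(\<lambda>x. \<theta> (B x)) \<noteq> (\<lambda>x. \<phi> (B x))"
    proof
      assume "(\<lambda>x. \<theta> (B x)) = (\<lambda>x. \<phi> (B x))"
      from ext[OF this] \<theta> show False by simp
    qed
    moreover have "(\<lambda>x. \<theta> (B x)) \<noteq> (\<lambda>x. - \<phi> (B x))"
    proof
      assume "(\<lambda>x. \<theta> (B x)) = (\<lambda>x. - \<phi> (B x))"
      from ext[of "\<lambda>x. - \<phi> x", OF this] \<theta> show False by simp
    qed
    ultimately have "(\<lambda>x. \<theta> (B x)) \<in> smooth_functionals - {\<lambda>x. \<phi> (B x), \<lambda>x. - \<phi> (B x)}" by simp
    from bspec[OF e this] show "\<theta> (B e) = 0" .
  qed
qed

lemma linear_isometry_inj:
  fixes B :: "'v::real_normed_vector \<Rightarrow> 'w::real_normed_vector"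
  assumes B: "linear B" "\<And>x. norm (B x) = norm x"
  shows "inj B"
proof (rule injI)
  fix x y assume "B x = B y"
  then have "norm (B (x - y)) = 0" by (simp add: linear_diff[OF B(1)])
  then show "x = y" using B(2) by simp
qed

lemma (in finite_dim_basis) linear_isometry_surj:
  fixes B :: "'v \<Rightarrow> 'v"
  assumes B: "linear B" "\<And>x. norm (B x) = norm x"
  shows "surj B"
proof -
  interpret V: finite_dimensional_vector_space "scaleR :: real \<Rightarrow> 'v \<Rightarrow> 'v" Bs
    by unfold_locales (auto simp: finite_Bs independent_Bs[unfolded dependent_raw_def] span_Bs[unfolded span_raw_def]
        dependent_raw_def span_raw_def)
  have "inj B" using B by (rule linear_isometry_inj)
  then show ?thesis using B(1) by (intro V.linear_inj_imp_surj) (auto simp: linear_def)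
qed

text \<open>
  The value \<open>k = 1\<close> has to be left out: vertices at distance less than \<open>1\<close> need not be adjacent.
\<close>

definition step_isometry :: "('v::real_normed_vector \<Rightarrow> 'v) \<Rightarrow> 'v set \<Rightarrow> bool" where
  "step_isometry f S \<longleftrightarrow> bij_betw f S S \<and>
     (\<forall>x\<in>S. \<forall>y\<in>S. \<forall>k::nat. k \<ge> 2 \<longrightarrow> (norm (x - y) < real k \<longleftrightarrow> norm (f x - f y) < real k))"

lemma step_isometryD:
  assumes "step_isometry f S"
  shows "bij_betw f S S"
    and "x \<in> S \<Longrightarrow> y \<in> S \<Longrightarrow> k \<ge> 2 \<Longrightarrow> norm (x - y) < real k \<longleftrightarrow> norm (f x - f y) < real k"
  using assms unfolding step_isometry_def by blast+

lemma step_isometry_coarse: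
  assumes f: "step_isometry f S" and x: "x \<in> S" and y: "y \<in> S"
  shows "\<bar>norm (f x - f y) - norm (x - y)\<bar> \<le> 2"
proof -
  have *: "b \<le> a + 2" if "a \<ge> 0" and ab: "\<And>k. k \<ge> 2 \<Longrightarrow> a < real k \<Longrightarrow> b < real k" for a b :: real
  proof -
    define k where "k = nat \<lfloor>a\<rfloor> + 2"
    have "real k = of_int \<lfloor>a\<rfloor> + 2" using \<open>a \<ge> 0\<close> by (simp add: k_def)
    then have "a < real k" "real k \<le> a + 2" by linarith+
    then show ?thesis using ab[of k] by (simp add: k_def)
  qed
  have "norm (f x - f y) \<le> norm (x - y) + 2"
    by (rule *) (use step_isometryD(2)[OF f x y] in auto)
  moreover have "norm (x - y) \<le> norm (f x - f y) + 2"
    by (rule *) (use step_isometryD(2)[OF f x y] in auto)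
  ultimately show ?thesis by linarith
qed

lemma (in finite_dim_basis) step_isometry_structure:
  fixes f :: "'v \<Rightarrow> 'v"
  assumes dense: "closure S = UNIV" and nz: "\<exists>u::'v. u \<noteq> 0" and f: "step_isometry f S"
  shows "\<exists>B K. linear B \<and> (\<forall>y. norm (B y) = norm y) \<and> (\<forall>x\<in>S. norm (B (f x) - x) \<le> K) \<and>
    (\<forall>\<phi>\<in>smooth_functionals. \<forall>x\<in>S. \<forall>y\<in>S. \<forall>m.
      \<phi> x - \<phi> y > of_int m \<longrightarrow> \<phi> (B (f x)) - \<phi> (B (f y)) \<ge> of_int m)"
proof -
  obtain B K where B: "linear B" "\<And>y. norm (B y) = norm y" and near: "\<And>x. x \<in> S \<Longrightarrow> norm (B (f x) - x) \<le> K"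
    using coarse_isometry_straightening[OF dense bij_betw_imp_surj_on[OF step_isometryD(1)[OF f]]
        step_isometry_coarse[OF f]] by blast
  have step: "norm (x - y) < real k \<longleftrightarrow> norm (B (f x) - B (f y)) < real k" if "x \<in> S" "y \<in> S" "k \<ge> 2" for x y k
    using step_isometryD(2)[OF f that] by (simp add: linear_diff[OF B(1), symmetric] B(2))
  show ?thesis
  proof (intro exI[of _ B] exI[of _ K] conjI allI ballI impI)
    show "\<phi> (B (f x)) - \<phi> (B (f y)) \<ge> of_int m"
      if "\<phi> \<in> smooth_functionals" "x \<in> S" "y \<in> S" "\<phi> x - \<phi> y > of_int m" for \<phi> x y m
      using step_displacement_monotone[OF dense nz step near that] .
  qed (fact B near)+
qed

text \<open>
  Both claims rest on \<open>W\<close> being the common kernel of the dependent functionals: these have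
  constant displacement, and they are permuted by linear isometries.
\<close>

theorem step_isometry_rigid:
  fixes U W :: "'v::real_normed_vector set"
  assumes dec: "linf_decomposition U W d T" and fd: "finite_dim_basis (Bs :: 'v set)"
    and nz: "\<exists>u::'v. u \<noteq> 0" and dense: "closure S = UNIV" and f: "step_isometry f S"
  obtains B where "linear B" "\<And>x y. x \<in> S \<Longrightarrow> y \<in> S \<Longrightarrow> B (f x - f y) - (x - y) \<in> W"
    "\<And>y. B y \<in> W \<Longrightarrow> y \<in> W"
proof -
  interpret linf_direct_sum U W d T
    using dec by unfold_locales (auto simp: linf_decomposition_def)
  interpret finite_dim_basis Bs by (rule fd)
  from step_isometry_structure[OF dense nz f]
  obtain B K where B: "linear B" and normB: "\<forall>y. norm (B y) = norm y"
      and nearB: "\<forall>x\<in>S. norm (B (f x) - x) \<le> K"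
      and mono: "\<forall>\<phi>\<in>smooth_functionals. \<forall>x\<in>S. \<forall>y\<in>S. \<forall>m.
        \<phi> x - \<phi> y > of_int m \<longrightarrow> \<phi> (B (f x)) - \<phi> (B (f y)) \<ge> of_int m"
      by (elim exE conjE) (rule that)
  note B = B normB[rule_format]
  note near = nearB[rule_format]
  have mono0: "\<psi> (B (f x)) \<ge> \<psi> (B (f y))" if "\<psi> \<in> smooth_functionals" "x \<in> S" "y \<in> S" "\<psi> x > \<psi> y" for \<psi> x y
    using mono[rule_format, OF that(1-3), of 0] that(4) by simp
  have in_W: "z \<in> W" if z: "\<And>\<phi>. dependent_functional \<phi> \<Longrightarrow> \<phi> z = 0" for z
  proof -
    have "u_part z = 0"
    proof (rule smooth_functionals_separate)
      fix \<phi> :: "'v \<Rightarrow> real" assume \<phi>: "\<phi> \<in> smooth_functionals"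
      have lin: "linear \<phi>" using \<phi> by (rule smooth_functional_linear)
      have "\<phi> (u_part z) = 0"
      proof (rule disjE[OF smooth_functional_cases[OF \<phi> nz]])
        assume van: "\<forall>w\<in>W. \<phi> w = 0"
        have "dependent_functional \<phi>"
          by (rule maximal_summand_imp_dependent[OF dec fd nz \<phi>]) (rule bspec[OF van])
        then have "\<phi> z = 0" by (rule z)
        moreover have "\<phi> (w_part z) = 0" using bspec[OF van parts(2)] .
        ultimately show ?thesis
          using linear_add[OF lin, of "u_part z" "w_part z"] unfolding parts(3) by simp
      next
        assume "\<exists>i<d. \<phi> = (\<lambda>v. cc v i) \<or> \<phi> = (\<lambda>v. - cc v i)"
        then obtain i where "\<phi> = (\<lambda>v. cc v i) \<or> \<phi> = (\<lambda>v. - cc v i)" by (elim exE conjE) (rule that)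
        then show ?thesis using cc_zero[OF parts(1), of z i] by (elim disjE) simp_all
      qed
      then show "\<phi> (u_part z) = \<phi> 0" by (simp add: linear_0[OF lin])
    qed
    then show ?thesis by (simp add: in_W_iff)
  qed
  have surj: "surj B" using B by (rule linear_isometry_surj)
  have injB: "inj B" using B by (rule linear_isometry_inj)
  define A where "A = inv B"
  have BA: "B (A y) = y" for y unfolding A_def using surj by (rule surj_f_inv_f)
  have AB: "A (B y) = y" for y unfolding A_def using injB by (rule inv_f_f)
  have A: "linear A" "\<And>y. norm (A y) = norm y" "surj A"
  proof -
    show "linear A"
    proof (rule linearI)
      show "A (x + y) = A x + A y" for x y
        using AB[of "A x + A y"] by (simp add: linear_add[OF B(1)] BA)
      show "A (c *\<^sub>R x) = c *\<^sub>R A x" for c x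
        using AB[of "c *\<^sub>R A x"] by (simp add: linear_scale[OF B(1)] BA)
    qed
    show "norm (A y) = norm y" for y using B(2)[of "A y"] by (simp add: BA)
    show "surj A" using AB by (metis surjI)
  qed
  show ?thesis
  proof (rule that[OF B(1)])
    fix x y assume x: "x \<in> S" and y: "y \<in> S"
    show "B (f x - f y) - (x - y) \<in> W"
    proof (rule in_W)
      fix \<phi> :: "'v \<Rightarrow> real" assume dep: "dependent_functional \<phi>"
      then have lin: "linear \<phi>" by (simp add: dependent_functional_def smooth_functional_linear)
      have "\<phi> (B (f x)) - \<phi> x = \<phi> (B (f y)) - \<phi> y"
        by (rule dependent_displacement_constant[OF dep nz dense near mono0 x y])
      then show "\<phi> (B (f x - f y) - (x - y)) = 0"
        by (simp add: linear_diff[OF lin] linear_diff[OF B(1)])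
    qed
  next
    fix y assume By: "B y \<in> W"
    show "y \<in> W"
    proof (rule in_W)
      fix \<phi> :: "'v \<Rightarrow> real" assume dep: "dependent_functional \<phi>"
      have "dependent_functional (\<lambda>x. \<phi> (A x))" using dep A by (rule dependent_functional_compose)
      from dependent_functional_vanishes[OF this nz By] show "\<phi> y = 0" by (simp add: AB)
    qed
  qed
qed

text \<open>
  Let \<open>x0\<close> and finitely many further points of \<open>S\<close> span \<open>S\<close> affinely. By rigidity, the affine
  combination that expresses \<open>x\<close> by these points also expresses \<open>f x\<close> by their images, modulo
  \<open>W\<close>; the isometry \<open>B\<close> drops out, because it maps no vector outside \<open>W\<close> into \<open>W\<close>. Hence the
  images determine the \<open>U\<close>-component of \<open>f x\<close>, and thereby \<open>f x\<close>.
\<close>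

lemma countable_step_isometries:
  fixes U W :: "'v::real_normed_vector set"
  assumes dec: "linf_decomposition U W d T" and fd: "finite_dim_basis (Bs :: 'v set)"
    and nz: "\<exists>u::'v. u \<noteq> 0" and S: "countable_dense S" and inj: "inj_on (component U W) S"
  shows "countable ((\<lambda>f. restrict f S) ` {f. step_isometry f S})"
proof -
  interpret linf_direct_sum U W d T
    using dec by unfold_locales (auto simp: linf_decomposition_def)
  interpret finite_dim_basis Bs by (rule fd)
  have dense: "closure S = UNIV" and count: "countable S" using S by (auto simp: countable_dense_def)
  obtain x0 where x0: "x0 \<in> S" using dense_approx[OF dense, of 1] by auto
  define Q where "Q = (\<lambda>x. x - x0) ` S"
  obtain C where C: "C \<subseteq> Q" "independent C" "Q \<subseteq> span C"
    by (rule maximal_independent_subset)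
  have finC: "finite C"
    using independent_span_bound[OF finite_Bs C(2)] span_Bs by simp
  define P where "P = insert x0 ((\<lambda>c. x0 + c) ` C)"
  have P: "P \<subseteq> S" "finite P" unfolding P_def using C(1) x0 finC by (auto simp: Q_def)
  have agree: "f x = g x" if f: "step_isometry f S" and g: "step_isometry g S"
    and eq: "\<And>p. p \<in> P \<Longrightarrow> f p = g p" and x: "x \<in> S" for f g x
  proof -
    have "x - x0 \<in> span C" using C(3) x by (auto simp: Q_def)
    then obtain k where k: "x - x0 = (\<Sum>c\<in>C. k c *\<^sub>R c)"
      unfolding span_finite[OF finC] by auto
    define z where "z = f x0 + (\<Sum>c\<in>C. k c *\<^sub>R (f (x0 + c) - f x0))"
    have z': "z = g x0 + (\<Sum>c\<in>C. k c *\<^sub>R (g (x0 + c) - g x0))"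
    proof -
      have "(\<Sum>c\<in>C. k c *\<^sub>R (f (x0 + c) - f x0)) = (\<Sum>c\<in>C. k c *\<^sub>R (g (x0 + c) - g x0))"
        using eq by (intro sum.cong) (auto simp: P_def)
      then show ?thesis unfolding z_def using eq[of x0] by (simp add: P_def)
    qed
    have mod_W: "h x - (h x0 + (\<Sum>c\<in>C. k c *\<^sub>R (h (x0 + c) - h x0))) \<in> W" if h: "step_isometry h S" for h
    proof -
      obtain B where B: "linear B" "\<And>x y. x \<in> S \<Longrightarrow> y \<in> S \<Longrightarrow> B (h x - h y) - (x - y) \<in> W"
        "\<And>y. B y \<in> W \<Longrightarrow> y \<in> W"
        using step_isometry_rigid[OF dec fd nz dense h] by blast
      have c: "B (h (x0 + c) - h x0) - c \<in> W" if "c \<in> C" for c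
      proof -
        have "x0 + c \<in> S" using that P(1) by (auto simp: P_def)
        from B(2)[OF this x0] show ?thesis by simp
      qed
      have "(B (h x - h x0) - (x - x0)) - (\<Sum>c\<in>C. k c *\<^sub>R (B (h (x0 + c) - h x0) - c)) \<in> W"
        by (intro subspace_diff subspace_sum subspace_scale subspaces B(2) x x0 c)
      also have "(\<Sum>c\<in>C. k c *\<^sub>R (B (h (x0 + c) - h x0) - c)) =
          B (\<Sum>c\<in>C. k c *\<^sub>R (h (x0 + c) - h x0)) - (x - x0)"
        unfolding k linear_sum[OF B(1)] linear_scale[OF B(1)] scaleR_diff_right[of _ "B _"] sum_subtractf by (rule refl)
      finally have "B (h x - h x0) - B (\<Sum>c\<in>C. k c *\<^sub>R (h (x0 + c) - h x0)) \<in> W" by simp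
      then have "B (h x - h x0 - (\<Sum>c\<in>C. k c *\<^sub>R (h (x0 + c) - h x0))) \<in> W"
        by (simp only: linear_diff[OF B(1)])
      from B(3)[OF this] show ?thesis by (simp add: diff_diff_eq)
    qed
    have "(f x - z) - (g x - z) \<in> W"
      using mod_W[OF f] mod_W[OF g] unfolding z_def[symmetric] z'[symmetric]
      by (rule subspace_diff[OF subspaces(2)])
    then have "f x - g x \<in> W" by simp
    then have "u_part (f x) = u_part (g x)" unfolding in_W_iff u_part_diff by simp
    moreover have "f x \<in> S" "g x \<in> S"
      using x step_isometryD(1)[OF f] step_isometryD(1)[OF g] by (auto dest: bij_betwE)
    ultimately show ?thesis using inj by (auto dest: inj_onD)
  qed
  show ?thesis
  proof (rule countable_image_inj_on)
    show "inj_on (\<lambda>h. restrict h P) ((\<lambda>f. restrict f S) ` {f. step_isometry f S})"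
    proof (rule inj_onI)
      fix h1 h2 assume "h1 \<in> (\<lambda>f. restrict f S) ` {f. step_isometry f S}" "h2 \<in> (\<lambda>f. restrict f S) ` {f. step_isometry f S}"
        and eq: "restrict h1 P = restrict h2 P"
      then obtain f g where f: "step_isometry f S" "h1 = restrict f S" and g: "step_isometry g S" "h2 = restrict g S"
        by blast
      have "f p = g p" if "p \<in> P" for p
        using fun_cong[OF eq, of p] that P(1) f(2) g(2) by (auto simp: restrict_def split: if_splits)
      from agree[OF f(1) g(1) this] show "h1 = h2" unfolding f(2) g(2) by (intro restrict_ext) auto
    qed
    have "(\<lambda>h. restrict h P) ` (\<lambda>f. restrict f S) ` {f. step_isometry f S} \<subseteq> P \<rightarrow>\<^sub>E S"
    proof (intro subsetI)
      fix h assume "h \<in> (\<lambda>h. restrict h P) ` (\<lambda>f. restrict f S) ` {f. step_isometry f S}"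
      then obtain f where f: "step_isometry f S" "h = restrict (restrict f S) P" by blast
      have "f x \<in> S" if "x \<in> S" for x using step_isometryD(1)[OF f(1)] that by (auto dest: bij_betwE)
      then show "h \<in> P \<rightarrow>\<^sub>E S" unfolding f(2) using P(1) by auto
    qed
    moreover have "countable (P \<rightarrow>\<^sub>E S)" using P(2) count by (intro countable_PiE) auto
    ultimately show "countable ((\<lambda>h. restrict h P) ` (\<lambda>f. restrict f S) ` {f. step_isometry f S})"
      by (rule countable_subset)
  qed
qed

section \<open>Random graphs\<close>

lemma infinite_dense_inter_open:
  fixes S :: "'v::real_normed_vector set"
  assumes nz: "\<exists>u::'v. u \<noteq> 0" and dense: "closure S = UNIV" and G: "open G" "x \<in> G"
  shows "infinite (S \<inter> G)"
proof
  assume fin: "finite (S \<inter> G)"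
  obtain u :: 'v where u: "u \<noteq> 0" using nz by blast
  obtain r where r: "r > 0" "ball x r \<subseteq> G" using G by (auto simp: open_contains_ball)
  have "(\<lambda>s. x + s *\<^sub>R u) ` {0<..<r / norm u} \<subseteq> ball x r"
    using u by (auto simp: dist_norm field_simps)
  moreover have "inj_on (\<lambda>s. x + s *\<^sub>R u) {0<..<r / norm u}" using u by (auto intro!: inj_onI)
  moreover have "infinite {0<..<r / norm u}" using r u by (simp add: infinite_Ioo)
  ultimately have "infinite (ball x r)" by (metis finite_imageD finite_subset)
  then have "infinite G" using r(2) by (rule infinite_super[rotated])
  then obtain y where y: "y \<in> G - (S \<inter> G)" using fin by (metis Diff_infinite_finite finite.emptyI ex_in_conv)
  have "open (G - (S \<inter> G))" using G(1) fin by (intro open_Diff finite_imp_closed)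
  then obtain e where e: "e > 0" "ball y e \<subseteq> G - (S \<inter> G)" using y open_contains_ball by blast
  obtain s where "s \<in> S" "norm (s - y) < e" using dense_approx[OF dense e(1)] by blast
  then have "s \<in> ball y e" "s \<in> S" by (auto simp: dist_norm norm_minus_commute)
  then show False using e(2) by blast
qed

lemma product_prob_space_bernoulli: "product_prob_space (\<lambda>_. measure_pmf (bernoulli_pmf p))"
  by unfold_locales

lemma prob_space_random_graph: "prob_space (random_graph p S)"
  unfolding random_graph_def by (intro prob_space_PiM measure_pmf.prob_space_axioms)

lemma edge_indicator_measurable:
  "e \<in> unit_edges S \<Longrightarrow> (\<lambda>\<omega>. \<omega> e) \<in> random_graph p S \<rightarrow>\<^sub>M count_space UNIV"
  unfolding random_graph_def by measurable

lemma emeasure_random_graph_cylinder: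
  assumes p: "0 < p" "p < 1" and J: "finite J" "J \<subseteq> unit_edges S"
  shows "emeasure (random_graph p S) {\<omega> \<in> space (random_graph p S). \<forall>e\<in>J. \<omega> e = b e} =
    ennreal (\<Prod>e\<in>J. if b e then p else 1 - p)"
proof -
  interpret P: product_prob_space "\<lambda>_. measure_pmf (bernoulli_pmf p)" "unit_edges S"
    by (rule product_prob_space_bernoulli)
  have "emeasure (random_graph p S) {\<omega> \<in> space (random_graph p S). \<forall>e\<in>J. \<omega> e \<in> {b e}} =
      (\<Prod>e\<in>J. emeasure (measure_pmf (bernoulli_pmf p)) {b e})"
    unfolding random_graph_def using J by (intro P.emeasure_PiM_Collect) auto
  also have "\<dots> = (\<Prod>e\<in>J. ennreal (if b e then p else 1 - p))"
    using p by (intro prod.cong refl) (auto simp: emeasure_pmf_single)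
  also have "\<dots> = ennreal (\<Prod>e\<in>J. if b e then p else 1 - p)"
    using p by (intro prod_ennreal) auto
  finally show ?thesis by simp
qed

lemma indep_edges:
  assumes "unit_edges S \<noteq> {}"
  shows "prob_space.indep_vars (random_graph p S) (\<lambda>_. measure_pmf (bernoulli_pmf p)) (\<lambda>e \<omega>. \<omega> e) (unit_edges S)"
proof -
  interpret prob_space "random_graph p S" by (rule prob_space_random_graph)
  interpret P: product_prob_space "\<lambda>_. measure_pmf (bernoulli_pmf p)" "unit_edges S"
    by (rule product_prob_space_bernoulli)
  let ?E = "unit_edges S" and ?M = "random_graph p S"
  have "distr ?M (\<Pi>\<^sub>M e\<in>?E. measure_pmf (bernoulli_pmf p)) (\<lambda>\<omega>. \<lambda>e\<in>?E. \<omega> e) = distr ?M ?M (\<lambda>\<omega>. \<omega>)"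
    by (intro distr_cong) (auto simp: random_graph_def space_PiM PiE_def extensional_restrict)
  also have "\<dots> = ?M" by (simp add: distr_id)
  also have "?M = (\<Pi>\<^sub>M e\<in>?E. distr ?M (measure_pmf (bernoulli_pmf p)) (\<lambda>\<omega>. \<omega> e))"
    unfolding random_graph_def by (intro PiM_cong refl) (simp add: P.PiM_component)
  finally show ?thesis
    using assms by (subst indep_vars_iff_distr_eq_PiM') (auto simp: random_graph_def)
qed

text \<open>
  The set \<open>B\<close> prescribes to which points of \<open>A\<close> the vertex \<open>z\<close> shall be adjacent. Saturation is
  inherited by larger sets \<open>Z\<close>, as the condition on \<open>A\<close> becomes stronger.
\<close>

definition saturated :: "'v::real_normed_vector set \<Rightarrow> ('v set \<Rightarrow> bool) \<Rightarrow> 'v set \<Rightarrow> bool" where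
  "saturated S \<omega> Z \<longleftrightarrow> (\<forall>A B. finite A \<and> A \<subseteq> S \<and> (\<forall>z\<in>Z. \<forall>a\<in>A. {z, a} \<in> unit_edges S) \<longrightarrow>
     (\<exists>z\<in>Z. \<forall>a\<in>A. \<omega> {z, a} \<longleftrightarrow> a \<in> B))"

lemma saturatedD:
  assumes "saturated S \<omega> Z" "finite A" "A \<subseteq> S" "\<forall>z\<in>Z. \<forall>a\<in>A. {z, a} \<in> unit_edges S"
  shows "\<exists>z\<in>Z. \<forall>a\<in>A. \<omega> {z, a} \<longleftrightarrow> a \<in> B"
  using assms(1)[unfolded saturated_def, THEN spec, THEN spec, THEN mp, OF conjI[OF assms(2) conjI[OF assms(3,4)]]] .

text \<open>
  For different \<open>z\<close> outside \<open>A\<close> the edges to \<open>A\<close> are different, so the patterns are independent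
  events whose probabilities have a common positive lower bound; the zero-one law applies.
\<close>

lemma AE_pattern_occurs:
  fixes S :: "'v::real_normed_vector set"
  assumes p: "0 < p" "p < 1" and Z: "infinite Z" and A: "finite A"
    and edges: "\<And>z a. z \<in> Z \<Longrightarrow> a \<in> A \<Longrightarrow> {z, a} \<in> unit_edges S"
  shows "AE \<omega> in random_graph p S. \<exists>z\<in>Z. \<forall>a\<in>A. \<omega> {z, a} \<longleftrightarrow> a \<in> B"
proof (cases "A = {}")
  case True
  have "Z \<noteq> {}" using Z by auto
  then have "\<exists>z\<in>Z. \<forall>a\<in>A. \<omega> {z, a} \<longleftrightarrow> a \<in> B" for \<omega> unfolding True by simp blast
  then show ?thesis by simp
next
  case False
  let ?M = "random_graph p S"
  interpret prob_space ?M by (rule prob_space_random_graph)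
  have "infinite (Z - A)" using Z A by simp
  from infinite_countable_subset[OF this] obtain z :: "nat \<Rightarrow> 'v"
    where z: "inj z" "range z \<subseteq> Z - A" by (elim exE conjE)
  have zZ: "z n \<in> Z" "z n \<notin> A" for n using rangeI[of z n] z(2) by blast+
  define K where "K = (\<lambda>n. (\<lambda>a. {z n, a}) ` A)"
  have K: "K n \<subseteq> unit_edges S" "finite (K n)" for n using edges zZ A by (auto simp: K_def)
  have disj: "disjoint_family K"
    unfolding disjoint_family_on_def
  proof (intro ballI impI equals0I)
    fix m n e assume "m \<noteq> n" "e \<in> K m \<inter> K n"
    then obtain a b where ab: "{z m, a} = {z n, b}" "a \<in> A" "b \<in> A" unfolding K_def by blast
    have "z m \<noteq> z n" using z(1) \<open>m \<noteq> n\<close> by (simp add: inj_eq)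
    moreover have "z m \<noteq> b" using zZ(2)[of m] ab(3) by blast
    ultimately show False using ab(1) by (simp add: doubleton_eq_iff)
  qed
  have ne: "unit_edges S \<noteq> {}" using edges[OF zZ(1)] False by blast
  define t where "t = (\<lambda>n e. \<exists>a\<in>B. e = {z n, a})"
  have pat: "(\<forall>e\<in>K n. \<omega> e = t n e) \<longleftrightarrow> (\<forall>a\<in>A. \<omega> {z n, a} \<longleftrightarrow> a \<in> B)" for n \<omega>
  proof -
    have "t n {z n, a} \<longleftrightarrow> a \<in> B" if "a \<in> A" for a
      unfolding t_def using that zZ(2)[of n] by (auto simp: doubleton_eq_iff)
    then show ?thesis by (auto simp: K_def)
  qed
  have "indep_vars (\<lambda>n. PiM (K n) (\<lambda>_. measure_pmf (bernoulli_pmf p))) (\<lambda>n \<omega>. restrict (\<lambda>e. \<omega> e) (K n)) UNIV"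
    by (rule indep_vars_restrict[OF indep_edges[OF ne] K(1) disj])
  then have "indep_events (\<lambda>n. {\<omega>\<in>space ?M. \<forall>e\<in>K n. restrict (\<lambda>e. \<omega> e) (K n) e = t n e}) UNIV"
  proof (rule indep_eventsI_indep_vars)
    show "{x \<in> space (PiM (K n) (\<lambda>_. measure_pmf (bernoulli_pmf p))). \<forall>e\<in>K n. x e = t n e}
        \<in> sets (PiM (K n) (\<lambda>_. measure_pmf (bernoulli_pmf p)))" for n
      using K(2)[of n] by measurable
  qed
  then have ind: "indep_events (\<lambda>n. {\<omega>\<in>space ?M. \<forall>e\<in>K n. \<omega> e = t n e}) UNIV" by simp
  define q where "q = (min p (1 - p)) ^ card A"
  have q: "q > 0" using p by (simp add: q_def)
  have prob_ge: "prob {\<omega>\<in>space ?M. \<forall>e\<in>K n. \<omega> e = t n e} \<ge> q" for n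
  proof -
    have "card (K n) \<le> card A" unfolding K_def using A by (rule card_image_le)
    then have "q \<le> (min p (1 - p)) ^ card (K n)" unfolding q_def using p by (intro power_decreasing) auto
    also have "\<dots> = (\<Prod>e\<in>K n. min p (1 - p))" by simp
    also have "\<dots> \<le> (\<Prod>e\<in>K n. if t n e then p else 1 - p)" using p by (intro prod_mono) auto
    also have "\<dots> = prob {\<omega>\<in>space ?M. \<forall>e\<in>K n. \<omega> e = t n e}"
      using emeasure_random_graph_cylinder[OF p K(2,1), of n "t n"] p
      by (simp add: measure_def prod_nonneg)
    finally show ?thesis .
  qed
  have "AE \<omega> in ?M. infinite {n. \<forall>e\<in>K n. \<omega> e = t n e}"
  proof (rule disjE[OF borel_0_1_law_AE[OF ind]])
    assume fin: "AE \<omega> in ?M. finite {n. \<forall>e\<in>K n. \<omega> e = t n e}"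
    let ?X = "\<lambda>n. {\<omega>\<in>space ?M. \<forall>e\<in>K n. \<omega> e = t n e}"
    have X: "?X n \<in> events" for n using ind by (auto simp: indep_events_def)
    have "(\<lambda>n. prob (\<Union>m\<in>{n..}. ?X m)) \<longlonglongrightarrow> prob (\<Inter>n. \<Union>m\<in>{n..}. ?X m)"
      using X by (intro finite_Lim_measure_decseq) (auto intro!: decseq_SucI dest: Suc_leD)
    moreover have "prob (\<Union>m\<in>{n..}. ?X m) \<ge> q" for n
    proof -
      have "q \<le> prob (?X n)" by (rule prob_ge)
      also have "\<dots> \<le> prob (\<Union>m\<in>{n..}. ?X m)" using X by (intro finite_measure_mono) auto
      finally show ?thesis .
    qed
    ultimately have "q \<le> prob (\<Inter>n. \<Union>m\<in>{n..}. ?X m)" by (intro LIMSEQ_le_const) auto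
    moreover have "prob (\<Inter>n. \<Union>m\<in>{n..}. ?X m) = 0"
    proof -
      have "AE \<omega> in ?M. \<omega> \<notin> (\<Inter>n. \<Union>m\<in>{n..}. ?X m)"
        using fin
      proof eventually_elim
        case (elim \<omega>)
        then obtain n where "\<forall>m\<in>{n. \<forall>e\<in>K n. \<omega> e = t n e}. m < n" using finite_nat_iff_bounded by (auto simp: subset_eq)
        then show ?case by (auto intro!: exI[of _ n])
      qed
      then show ?thesis using X by (subst prob_eq_0) auto
    qed
    ultimately show ?thesis using q by simp
  qed
  then show ?thesis
  proof eventually_elim
    case (elim \<omega>)
    then have "{n. \<forall>e\<in>K n. \<omega> e = t n e} \<noteq> {}" by (metis finite.emptyI)
    then obtain n where "\<forall>e\<in>K n. \<omega> e = t n e" by blast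
    then have "\<forall>a\<in>A. \<omega> {z n, a} \<longleftrightarrow> a \<in> B" by (simp only: pat)
    then show ?case using zZ(1)[of n] by blast
  qed
qed

lemma AE_saturated:
  fixes S :: "'v::real_normed_vector set"
  assumes p: "0 < p" "p < 1" and S: "countable S" and Z: "infinite Z"
  shows "AE \<omega> in random_graph p S. saturated S \<omega> Z"
proof -
  let ?P = "{A. finite A \<and> A \<subseteq> S}"
  have "AE \<omega> in random_graph p S. \<forall>A\<in>?P. \<forall>B\<in>?P. (\<forall>z\<in>Z. \<forall>a\<in>A. {z, a} \<in> unit_edges S) \<longrightarrow>
      (\<exists>z\<in>Z. \<forall>a\<in>A. \<omega> {z, a} \<longleftrightarrow> a \<in> B)"
    unfolding AE_ball_countable[OF countable_Collect_finite_subset[OF S]]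
  proof (intro ballI)
    fix A B assume A: "A \<in> ?P"
    show "AE \<omega> in random_graph p S. (\<forall>z\<in>Z. \<forall>a\<in>A. {z, a} \<in> unit_edges S) \<longrightarrow>
        (\<exists>z\<in>Z. \<forall>a\<in>A. \<omega> {z, a} \<longleftrightarrow> a \<in> B)"
    proof (cases "\<forall>z\<in>Z. \<forall>a\<in>A. {z, a} \<in> unit_edges S")
      case True
      then have "AE \<omega> in random_graph p S. \<exists>z\<in>Z. \<forall>a\<in>A. \<omega> {z, a} \<longleftrightarrow> a \<in> B"
        using A by (intro AE_pattern_occurs[OF p Z]) auto
      then show ?thesis by eventually_elim blast
    next
      case False
      then show ?thesis by (intro AE_I2) blast
    qed
  qed
  then show ?thesis
  proof eventually_elim
    case (elim \<omega>)
    show ?case unfolding saturated_def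
    proof (intro allI impI; elim conjE)
      fix A B assume A: "finite A" "A \<subseteq> S" "\<forall>z\<in>Z. \<forall>a\<in>A. {z, a} \<in> unit_edges S"
      then have "A \<in> ?P" "B \<inter> A \<in> ?P" by auto
      with elim A(3) have "\<exists>z\<in>Z. \<forall>a\<in>A. \<omega> {z, a} \<longleftrightarrow> a \<in> B \<inter> A" by blast
      then show "\<exists>z\<in>Z. \<forall>a\<in>A. \<omega> {z, a} \<longleftrightarrow> a \<in> B" by auto
    qed
  qed
qed

lemma AE_no_infinite_agreement:
  assumes p: "0 < p" "p < 1" and e: "inj e" "range e \<subseteq> unit_edges S"
  shows "AE \<omega> in random_graph p S. \<exists>n::nat. \<omega> (e n) \<noteq> b n"
proof -
  let ?M = "random_graph p S"
  interpret prob_space ?M by (rule prob_space_random_graph)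
  define c where "c = max p (1 - p)"
  have c: "0 \<le> c" "c < 1" using p by (auto simp: c_def)
  define X where "X = (\<lambda>N. {\<omega>\<in>space ?M. \<forall>n<N. \<omega> (e n) = b n})"
  have Xeq: "X N = {\<omega>\<in>space ?M. \<forall>d\<in>e ` {..<N}. \<omega> d = b (inv e d)}" for N
    unfolding X_def using e(1) by (auto simp: inv_f_f)
  have prob: "prob (X N) \<le> c ^ N" for N
  proof -
    have "emeasure ?M (X N) = ennreal (\<Prod>d\<in>e ` {..<N}. if b (inv e d) then p else 1 - p)"
      unfolding Xeq using e(2) by (intro emeasure_random_graph_cylinder p) auto
    then have "prob (X N) = (\<Prod>d\<in>e ` {..<N}. if b (inv e d) then p else 1 - p)"
      using p by (simp add: measure_def prod_nonneg)
    also have "\<dots> \<le> (\<Prod>d\<in>e ` {..<N}. c)" using p by (intro prod_mono) (auto simp: c_def)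
    also have "\<dots> = c ^ N" using e(1) by (simp add: card_image inj_on_subset)
    finally show ?thesis .
  qed
  have Xm: "X N \<in> events" for N
  proof -
    have "(\<lambda>\<omega>. \<omega> (e n)) \<in> ?M \<rightarrow>\<^sub>M count_space UNIV" for n using e(2) by (intro edge_indicator_measurable) auto
    note [measurable] = this
    show ?thesis unfolding X_def by measurable
  qed
  have "prob (\<Inter>N. X N) \<le> c ^ N" for N
  proof -
    have "prob (\<Inter>N. X N) \<le> prob (X N)" using Xm by (intro finite_measure_mono) auto
    then show ?thesis using prob[of N] by linarith
  qed
  moreover have "(\<lambda>N. c ^ N) \<longlonglongrightarrow> 0" using c by (rule LIMSEQ_realpow_zero)
  ultimately have "prob (\<Inter>N. X N) \<le> 0" by (intro LIMSEQ_le_const[of _ 0]) auto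
  then have "prob (\<Inter>N. X N) = 0" using measure_nonneg antisym by blast
  then have "AE \<omega> in ?M. \<omega> \<notin> (\<Inter>N. X N)" using Xm by (subst (asm) prob_eq_0) auto
  then show ?thesis using AE_space
  proof eventually_elim
    case (elim \<omega>)
    then obtain N where "\<omega> \<notin> X N" by blast
    then show ?case using elim(2) unfolding X_def by blast
  qed
qed

section \<open>Pairs of random graphs\<close>

lemma pair_prob_space_random_graph: "pair_prob_space (random_graph p S) (random_graph p S)"
  unfolding pair_prob_space_def pair_sigma_finite_def
  using prob_space_random_graph[of p S] by (simp add: prob_space_imp_sigma_finite)

lemma AE_fst_random_graph:
  assumes "AE \<omega> in random_graph p S. Q \<omega>"
  shows "AE x in random_graph_pair p S. Q (fst x)"
proof -
  let ?M = "random_graph p S"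
  interpret pair_prob_space ?M ?M by (rule pair_prob_space_random_graph)
  obtain N where N: "{x \<in> space ?M. \<not> Q x} \<subseteq> N" "N \<in> sets ?M" "emeasure ?M N = 0" using assms by (rule AE_E)
  show ?thesis unfolding random_graph_pair_def
  proof (rule AE_I)
    show "{x \<in> space (?M \<Otimes>\<^sub>M ?M). \<not> Q (fst x)} \<subseteq> N \<times> space ?M" using N(1) by (auto simp: space_pair_measure)
    show "emeasure (?M \<Otimes>\<^sub>M ?M) (N \<times> space ?M) = 0" using N by (simp add: M1.emeasure_pair_measure_Times)
    show "N \<times> space ?M \<in> sets (?M \<Otimes>\<^sub>M ?M)" using N by auto
  qed
qed

lemma AE_snd_random_graph:
  assumes "AE \<omega> in random_graph p S. Q \<omega>"
  shows "AE x in random_graph_pair p S. Q (snd x)"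
proof -
  let ?M = "random_graph p S"
  interpret pair_prob_space ?M ?M by (rule pair_prob_space_random_graph)
  obtain N where N: "{x \<in> space ?M. \<not> Q x} \<subseteq> N" "N \<in> sets ?M" "emeasure ?M N = 0" using assms by (rule AE_E)
  show ?thesis unfolding random_graph_pair_def
  proof (rule AE_I)
    show "{x \<in> space (?M \<Otimes>\<^sub>M ?M). \<not> Q (snd x)} \<subseteq> space ?M \<times> N" using N(1) by (auto simp: space_pair_measure)
    show "emeasure (?M \<Otimes>\<^sub>M ?M) (space ?M \<times> N) = 0" using N by (simp add: M1.emeasure_pair_measure_Times)
    show "space ?M \<times> N \<in> sets (?M \<Otimes>\<^sub>M ?M)" using N by auto
  qed
qed

text \<open>
  Once the second graph is fixed, the first one would have to realise a given infinite sequence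
  of edge indicators. The \<open>g n\<close> are arbitrary sets; one that is not a unit edge is never kept.
\<close>

lemma AE_pair_disagreement:
  assumes p: "0 < p" "p < 1" and e: "inj e" "range e \<subseteq> unit_edges S"
  shows "AE x in random_graph_pair p S. \<exists>n::nat. \<not> (e n \<in> kept_edges S (fst x) \<longleftrightarrow> g n \<in> kept_edges S (snd x))"
proof -
  let ?M = "random_graph p S"
  interpret pair_prob_space ?M ?M by (rule pair_prob_space_random_graph)
  have eE: "e n \<in> unit_edges S" for n using e(2) by auto
  have m1[measurable]: "(\<lambda>\<omega>. \<omega> (e n)) \<in> ?M \<rightarrow>\<^sub>M count_space UNIV" for n using eE by (rule edge_indicator_measurable)
  have m2[measurable]: "(\<lambda>\<omega>. g n \<in> unit_edges S \<and> \<omega> (g n)) \<in> ?M \<rightarrow>\<^sub>M count_space UNIV" for n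
    using edge_indicator_measurable[of "g n" S p] by (cases "g n \<in> unit_edges S") auto
  have eq: "(\<exists>n. \<not> (e n \<in> kept_edges S (fst x) \<longleftrightarrow> g n \<in> kept_edges S (snd x))) \<longleftrightarrow>
      (\<exists>n. fst x (e n) \<noteq> (g n \<in> unit_edges S \<and> snd x (g n)))" for x
    using eE by (simp add: kept_edges_def)
  have meas: "{x \<in> space (?M \<Otimes>\<^sub>M ?M). \<exists>n. fst x (e n) \<noteq> (g n \<in> unit_edges S \<and> snd x (g n))} \<in> sets (?M \<Otimes>\<^sub>M ?M)"
    by measurable
  have "AE \<omega>' in ?M. AE \<omega> in ?M. \<exists>n. \<omega> (e n) \<noteq> (g n \<in> unit_edges S \<and> \<omega>' (g n))"
    by (intro AE_I2 AE_no_infinite_agreement p e)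
  then have "AE \<omega> in ?M. AE \<omega>' in ?M. \<exists>n. \<omega> (e n) \<noteq> (g n \<in> unit_edges S \<and> \<omega>' (g n))"
    using AE_commute[OF meas] by simp
  then have "AE x in ?M \<Otimes>\<^sub>M ?M. \<exists>n. fst x (e n) \<noteq> (g n \<in> unit_edges S \<and> snd x (g n))"
    using meas by (intro AE_pair_measure) auto
  then show ?thesis unfolding random_graph_pair_def eq .
qed

section \<open>Graph distance and step isometries\<close>

text \<open>
  Loops are included, so that the \<open>k\<close>-th power of the relation stands for distance at most \<open>k\<close>.
\<close>

definition adjacency :: "'v::real_normed_vector set \<Rightarrow> ('v set \<Rightarrow> bool) \<Rightarrow> ('v \<times> 'v) set" where
  "adjacency S \<omega> = {(x, y). x \<in> S \<and> y \<in> S \<and> (x = y \<or> {x, y} \<in> kept_edges S \<omega>)}"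

lemma unit_edges_pair_iff:
  "{x, y} \<in> unit_edges S \<longleftrightarrow> x \<in> S \<and> y \<in> S \<and> x \<noteq> y \<and> norm (x - y) < 1"
  unfolding unit_edges_def by (auto simp: doubleton_eq_iff norm_minus_commute)

lemma adjacency_power_norm:
  assumes "(x, y) \<in> adjacency S \<omega> ^^ Suc k"
  shows "norm (x - y) < real (Suc k)"
  using assms
proof (induction k arbitrary: y)
  case 0
  then show ?case by (auto simp: adjacency_def kept_edges_def unit_edges_pair_iff)
next
  case (Suc k)
  from Suc.prems obtain z where z: "(x, z) \<in> adjacency S \<omega> ^^ Suc k" "(z, y) \<in> adjacency S \<omega>"
    by (rule relpow_Suc_E)
  have "norm (z - y) < 1" using z(2) by (auto simp: adjacency_def kept_edges_def unit_edges_pair_iff)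
  moreover have "norm (x - y) \<le> norm (x - z) + norm (z - y)" using norm_triangle_ineq[of "x - z" "z - y"] by simp
  ultimately show ?case using Suc.IH[OF z(1)] by simp
qed

definition geodesic_graph :: "'v::real_normed_vector set \<Rightarrow> ('v set \<Rightarrow> bool) \<Rightarrow> bool" where
  "geodesic_graph S \<omega> \<longleftrightarrow>
     (\<forall>x\<in>S. \<forall>y\<in>S. \<forall>k::nat. k \<ge> 2 \<longrightarrow> norm (x - y) < real k \<longrightarrow> (x, y) \<in> adjacency S \<omega> ^^ k)"

text \<open>
  If \<open>norm (x - y) < k + 1\<close>, then infinitely many points \<open>z\<close> of \<open>S\<close> satisfy \<open>norm (x - z) < k\<close>
  and \<open>norm (z - y) < 1\<close>, and saturation provides one adjacent to \<open>y\<close>. This is the induction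
  step; for \<open>k = 1\<close> the point can be chosen adjacent to \<open>x\<close> as well, which starts the induction
  at \<open>2\<close>.
\<close>

lemma AE_geodesic_graph:
  fixes S :: "'v::real_normed_vector set"
  assumes p: "0 < p" "p < 1" and nz: "\<exists>u::'v. u \<noteq> 0" and S: "countable_dense S"
  shows "AE \<omega> in random_graph p S. geodesic_graph S \<omega>"
proof -
  have dense: "closure S = UNIV" and count: "countable S" using S by (auto simp: countable_dense_def)
  define Z where "Z = (\<lambda>x y k. {z \<in> S. z \<noteq> x \<and> z \<noteq> y \<and> norm (x - z) < real k \<and> norm (z - y) < 1})"
  have infZ: "infinite (Z x y k)" if k: "norm (x - y) < real k + 1" "k \<ge> 1" for x y :: 'v and k :: nat
  proof -
    define G where "G = ball x (real k) \<inter> ball y 1"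
    define s where "s = real k / (real k + 1)"
    have s: "0 < s" "s < 1" "s * (real k + 1) = real k" "(1 - s) * (real k + 1) = 1"
      using k(2) by (auto simp: s_def field_simps)
    define m where "m = x + s *\<^sub>R (y - x)"
    have xm: "x - m = s *\<^sub>R (x - y)" and ym: "y - m = (1 - s) *\<^sub>R (y - x)" by (auto simp: m_def algebra_simps)
    have "norm (x - m) < real k" unfolding xm using s mult_strict_left_mono[OF k(1) s(1)] by simp
    moreover have "norm (y - m) < 1"
      unfolding ym using s mult_strict_left_mono[OF k(1), of "1 - s"] by (simp add: norm_minus_commute)
    ultimately have m: "m \<in> G" by (simp add: G_def dist_norm)
    have "open G" by (simp add: G_def open_Int)
    then have "infinite (S \<inter> G)" using m by (rule infinite_dense_inter_open[OF nz dense])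
    then have "infinite (S \<inter> G - {x, y})" by simp
    moreover have "S \<inter> G - {x, y} \<subseteq> Z x y k" by (auto simp: Z_def G_def dist_norm norm_minus_commute)
    ultimately show ?thesis by (rule infinite_super[rotated])
  qed
  have "AE \<omega> in random_graph p S. \<forall>x\<in>S. \<forall>y\<in>S. \<forall>k\<in>{1::nat..}. norm (x - y) < real k + 1 \<longrightarrow> saturated S \<omega> (Z x y k)"
  proof -
    have "AE \<omega> in random_graph p S. norm (x - y) < real k + 1 \<longrightarrow> saturated S \<omega> (Z x y k)" if "k \<ge> 1" for x y :: 'v and k
    proof (cases "norm (x - y) < real k + 1")
      case True
      then show ?thesis using AE_saturated[OF p count infZ[OF True that]] by simp
    qed simp
    then show ?thesis unfolding AE_ball_countable[OF count]
      by (intro ballI) (subst AE_ball_countable, auto)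
  qed
  then show ?thesis
  proof eventually_elim
    case (elim \<omega>)
    have sat: "saturated S \<omega> (Z x y k)" if "x \<in> S" "y \<in> S" "k \<ge> 1" "norm (x - y) < real k + 1" for x y k
      using elim that by auto
    have Zx: "{z, x} \<in> unit_edges S" if "x \<in> S" "z \<in> Z x y 1" for x y z
      using that by (auto simp: Z_def unit_edges_pair_iff norm_minus_commute)
    have Zy: "{z, y} \<in> unit_edges S" if "y \<in> S" "z \<in> Z x y k" for x y z k
      using that by (auto simp: Z_def unit_edges_pair_iff)
    have adjI: "(z, y) \<in> adjacency S \<omega>" "(y, z) \<in> adjacency S \<omega>" if "{z, y} \<in> unit_edges S" "\<omega> {z, y}" for z y
      using that by (auto simp: adjacency_def kept_edges_def unit_edges_pair_iff insert_commute norm_minus_commute)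
    have "(x, y) \<in> adjacency S \<omega> ^^ Suc (Suc j)" if "x \<in> S" "y \<in> S" "norm (x - y) < real (Suc (Suc j))" for x y j
      using that
    proof (induction j arbitrary: y)
      case 0
      have "saturated S \<omega> (Z x y 1)" using 0 by (intro sat) auto
      moreover have "finite {x, y} \<and> {x, y} \<subseteq> S \<and> (\<forall>z\<in>Z x y 1. \<forall>a\<in>{x, y}. {z, a} \<in> unit_edges S)"
        using 0 Zx[of x _ y] Zy[of y _ x 1] by blast
      ultimately have "\<exists>z\<in>Z x y 1. \<forall>a\<in>{x, y}. \<omega> {z, a} \<longleftrightarrow> a \<in> {x, y}" unfolding saturated_def by blast
      then obtain z where z: "z \<in> Z x y 1" "\<omega> {z, x}" "\<omega> {z, y}" by blast
      have "(x, z) \<in> adjacency S \<omega>" "(z, y) \<in> adjacency S \<omega>"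
        using adjI[OF Zx[OF 0(1) z(1)] z(2)] adjI[OF Zy[OF 0(2) z(1)] z(3)] by auto
      then show ?case by (auto simp: relcomp_unfold)
    next
      case (Suc j)
      have "saturated S \<omega> (Z x y (Suc (Suc j)))" using Suc.prems by (intro sat) auto
      moreover have "finite {y} \<and> {y} \<subseteq> S \<and> (\<forall>z\<in>Z x y (Suc (Suc j)). \<forall>a\<in>{y}. {z, a} \<in> unit_edges S)"
        using Suc.prems Zy[of y _ x "Suc (Suc j)"] by blast
      ultimately have "\<exists>z\<in>Z x y (Suc (Suc j)). \<forall>a\<in>{y}. \<omega> {z, a} \<longleftrightarrow> a \<in> {y}" unfolding saturated_def by blast
      then obtain z where z: "z \<in> Z x y (Suc (Suc j))" "\<omega> {z, y}" by blast
      have "(x, z) \<in> adjacency S \<omega> ^^ Suc (Suc j)"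
        using z(1) by (intro Suc.IH Suc.prems) (auto simp: Z_def)
      moreover have "(z, y) \<in> adjacency S \<omega>" using adjI[OF Zy[OF Suc.prems(2) z(1)] z(2)] by simp
      ultimately show ?case by (rule relpow_Suc_I)
    qed
    note pow = this
    show ?case unfolding geodesic_graph_def
    proof (intro ballI allI impI)
      fix x y and k :: nat assume xy: "x \<in> S" "y \<in> S" "k \<ge> 2" "norm (x - y) < real k"
      then obtain j where "k = Suc (Suc j)" by (metis Suc_le_D numeral_2_eq_2 Suc_le_mono)
      then show "(x, y) \<in> adjacency S \<omega> ^^ k" using pow[OF xy(1,2), of j] xy(4) by simp
    qed
  qed
qed

lemma relpow_map:
  assumes "\<And>x y. (x, y) \<in> R \<Longrightarrow> (f x, f y) \<in> R'" "(x, y) \<in> R ^^ k"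
  shows "(f x, f y) \<in> R' ^^ k"
  using assms(2)
proof (induction k arbitrary: y)
  case (Suc k)
  from Suc.prems obtain z where "(x, z) \<in> R ^^ k" "(z, y) \<in> R" by (rule relpow_Suc_E)
  then show ?case using Suc.IH assms(1) by (blast intro: relpow_Suc_I)
qed simp

lemma isomorphism_is_step_isometry:
  assumes good: "geodesic_graph S \<omega>" "geodesic_graph S \<omega>'"
    and f: "bij_betw f S S"
    and iso: "\<And>x y. x \<in> S \<Longrightarrow> y \<in> S \<Longrightarrow> {x, y} \<in> kept_edges S \<omega> \<longleftrightarrow> {f x, f y} \<in> kept_edges S \<omega>'"
  shows "step_isometry f S"
  unfolding step_isometry_def
proof (intro conjI ballI allI impI f)
  fix x y and k :: nat assume xy: "x \<in> S" "y \<in> S" and k: "k \<ge> 2"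
  define g where "g = inv_into S f"
  have fS: "f x \<in> S" if "x \<in> S" for x using f that by (auto dest: bij_betwE)
  have gS: "g x \<in> S" "f (g x) = x" if "x \<in> S" for x
    using f that unfolding g_def by (auto simp: bij_betw_def inv_into_into f_inv_into_f)
  have gf: "g (f x) = x" if "x \<in> S" for x using f that unfolding g_def by (simp add: bij_betw_def)
  have adj1: "(f x, f y) \<in> adjacency S \<omega>'" if "(x, y) \<in> adjacency S \<omega>" for x y
    using that fS iso[of x y] by (auto simp: adjacency_def)
  have adj2: "(g x, g y) \<in> adjacency S \<omega>" if "(x, y) \<in> adjacency S \<omega>'" for x y
    using that gS[of x] gS[of y] iso[of "g x" "g y"] by (auto simp: adjacency_def)
  obtain j where j: "k = Suc j" using k by (cases k) auto
  show "norm (x - y) < real k \<longleftrightarrow> norm (f x - f y) < real k"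
  proof
    assume "norm (x - y) < real k"
    then have "(x, y) \<in> adjacency S \<omega> ^^ k" using good(1) xy k by (simp add: geodesic_graph_def)
    then have "(f x, f y) \<in> adjacency S \<omega>' ^^ k" using adj1 by (rule relpow_map[rotated])
    then show "norm (f x - f y) < real k" using adjacency_power_norm unfolding j by blast
  next
    assume "norm (f x - f y) < real k"
    then have "(f x, f y) \<in> adjacency S \<omega>' ^^ k" using good(2) fS xy k by (simp add: geodesic_graph_def)
    then have "(g (f x), g (f y)) \<in> adjacency S \<omega> ^^ k" using adj2 by (rule relpow_map[rotated])
    then show "norm (x - y) < real k" using adjacency_power_norm unfolding j by (simp add: gf xy)
  qed
qed

lemma AE_isomorphism_is_step_isometry:
  fixes S :: "'v::real_normed_vector set"
  assumes p: "0 < p" "p < 1" and nz: "\<exists>u::'v. u \<noteq> 0" and S: "countable_dense S"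
  shows "AE x in random_graph_pair p S. \<forall>f. bij_betw f S S \<longrightarrow>
    (\<forall>y\<in>S. \<forall>z\<in>S. {y, z} \<in> kept_edges S (fst x) \<longleftrightarrow> {f y, f z} \<in> kept_edges S (snd x)) \<longrightarrow> step_isometry f S"
  using AE_fst_random_graph[OF AE_geodesic_graph[OF p nz S]] AE_snd_random_graph[OF AE_geodesic_graph[OF p nz S]]
proof eventually_elim
  case (elim x)
  then show ?case using isomorphism_is_step_isometry by blast
qed

text \<open>
  An isomorphism would carry the sequence of edges \<open>e\<close> to one of countably many sequences, and
  each of these almost surely disagrees with \<open>e\<close> somewhere.
\<close>

lemma strongly_non_radoI:
  fixes S :: "'v::real_normed_vector set"
  assumes p: "0 < p" "p < 1" and nz: "\<exists>u::'v. u \<noteq> 0" and S: "countable_dense S"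
    and e: "inj e" "range e \<subseteq> unit_edges S"
    and count: "countable ((\<lambda>f (n::nat). f ` e n) ` {f. step_isometry f S})"
  shows "strongly_non_rado p S"
proof -
  let ?G = "(\<lambda>f (n::nat). f ` e n) ` {f. step_isometry f S}"
  have "AE x in random_graph_pair p S. \<forall>g\<in>?G. \<exists>n. \<not> (e n \<in> kept_edges S (fst x) \<longleftrightarrow> g n \<in> kept_edges S (snd x))"
    unfolding AE_ball_countable[OF count] by (intro ballI AE_pair_disagreement p e)
  with AE_isomorphism_is_step_isometry[OF p nz S] show ?thesis
    unfolding strongly_non_rado_def
  proof eventually_elim
    case (elim x)
    show ?case
    proof
      assume "graph_isomorphic S (kept_edges S (fst x)) (kept_edges S (snd x))"
      then obtain f where f: "bij_betw f S S"
        "\<forall>y\<in>S. \<forall>z\<in>S. {y, z} \<in> kept_edges S (fst x) \<longleftrightarrow> {f y, f z} \<in> kept_edges S (snd x)"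
        unfolding graph_isomorphic_def by blast
      then have "step_isometry f S" using elim(1) by blast
      then have "(\<lambda>n. f ` e n) \<in> ?G" by blast
      from bspec[OF elim(2) this]
      obtain n where n: "\<not> (e n \<in> kept_edges S (fst x) \<longleftrightarrow> f ` e n \<in> kept_edges S (snd x))" ..
      have "e n \<in> unit_edges S" using e(2) by auto
      then obtain y z where "e n = {y, z}" "y \<in> S" "z \<in> S" unfolding unit_edges_def by blast
      then show False using n f(2) by simp
    qed
  qed
qed

text \<open>
  Up to a null set the isomorphism event is the measurable event that the two indicators of \<open>e\<close>
  agree; the two cases in which both are true, and in which only the first is true, have
  positive probability.
\<close>

lemma iso_prob_strictly_between:
  assumes p: "0 < p" "p < 1" and e: "e \<in> unit_edges S"
    and ae: "AE x in random_graph_pair p S.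
      graph_isomorphic S (kept_edges S (fst x)) (kept_edges S (snd x)) \<longleftrightarrow>
      (e \<in> kept_edges S (fst x) \<longleftrightarrow> e \<in> kept_edges S (snd x))"
  shows "0 < iso_prob p S \<and> iso_prob p S < 1"
proof -
  let ?M = "random_graph p S" and ?P = "random_graph_pair p S"
  interpret pair_prob_space ?M ?M by (rule pair_prob_space_random_graph)
  let ?I = "{x \<in> space ?P. graph_isomorphic S (kept_edges S (fst x)) (kept_edges S (snd x))}"
  define Q where "Q = {x \<in> space ?P. fst x e \<longleftrightarrow> snd x e}"
  have [measurable]: "(\<lambda>\<omega>. \<omega> e) \<in> ?M \<rightarrow>\<^sub>M count_space UNIV" using e by (rule edge_indicator_measurable)
  have Q: "Q \<in> sets ?P" unfolding Q_def random_graph_pair_def by measurable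
  have ae': "AE x in completion ?P. x \<in> Q \<longleftrightarrow> x \<in> ?I"
    by (rule AE_completion) (use ae AE_space in \<open>eventually_elim, use e in \<open>simp add: Q_def kept_edges_def\<close>\<close>)
  have I: "?I \<in> sets (completion ?P)"
    by (rule completion.in_sets_AE[OF ae']) (use Q in auto)
  have "emeasure (completion ?P) Q = emeasure (completion ?P) ?I"
    using ae' Q I by (intro emeasure_eq_AE) auto
  then have iso: "iso_prob p S = measure ?P Q"
    unfolding iso_prob_def using Q by (simp add: measure_def)
  define A where "A = (\<lambda>b. {\<omega> \<in> space ?M. \<omega> e = b})"
  have A[measurable]: "A b \<in> sets ?M" for b unfolding A_def by measurable
  have emA: "emeasure ?M (A b) = ennreal (if b then p else 1 - p)" for b
    using emeasure_random_graph_cylinder[OF p, of "{e}" S "\<lambda>_. b"] e by (simp add: A_def)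
  have meas: "measure ?P (A b \<times> A b') = (if b then p else 1 - p) * (if b' then p else 1 - p)" for b b'
    unfolding random_graph_pair_def measure_def
    using A p by (simp add: M1.emeasure_pair_measure_Times emA flip: ennreal_mult)
  have PP: "prob_space ?P" unfolding random_graph_pair_def by unfold_locales
  interpret PP: prob_space ?P by (rule PP)
  have "A True \<times> A True \<subseteq> Q" by (auto simp: A_def Q_def random_graph_pair_def space_pair_measure)
  then have "measure ?P (A True \<times> A True) \<le> measure ?P Q" using Q by (rule PP.finite_measure_mono)
  then have "p * p \<le> measure ?P Q" using meas[of True True] by simp
  moreover have "p * p > 0" "p * (1 - p) > 0" using p by simp_all
  ultimately have pos: "measure ?P Q > 0" by linarith
  have AA: "A True \<times> A False \<in> sets ?P" unfolding random_graph_pair_def by measurable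
  have disj: "Q \<inter> (A True \<times> A False) = {}" by (auto simp: A_def Q_def)
  have "measure ?P Q + measure ?P (A True \<times> A False) = measure ?P (Q \<union> (A True \<times> A False))"
    using Q AA disj by (rule PP.finite_measure_Union[symmetric])
  also have "\<dots> \<le> 1" by (rule PP.prob_le_1)
  finally have "measure ?P Q < 1" using meas[of True False] \<open>p * (1 - p) > 0\<close> by simp
  with pos show ?thesis unfolding iso by blast
qed

text \<open>
  As there are only countably many step isometries, any infinite family of edges serves; here
  those of a star.
\<close>

lemma strongly_non_rado_if_inj:
  fixes U W :: "'v::real_normed_vector set"
  assumes p: "0 < p" "p < 1" and dec: "linf_decomposition U W d T" and fd: "finite_dim_basis (Bs :: 'v set)"
    and nz: "\<exists>u::'v. u \<noteq> 0" and S: "countable_dense S" and inj: "inj_on (component U W) S"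
  shows "strongly_non_rado p S"
proof -
  have dense: "closure S = UNIV" using S by (simp add: countable_dense_def)
  obtain x where x: "x \<in> S" using dense_approx[OF dense, of 1] by auto
  have "infinite (S \<inter> ball x 1)" by (rule infinite_dense_inter_open[OF nz dense, where x = x]) auto
  then have "infinite (S \<inter> ball x 1 - {x})" by simp
  from infinite_countable_subset[OF this] obtain y :: "nat \<Rightarrow> 'v"
    where y: "inj y" "range y \<subseteq> S \<inter> ball x 1 - {x}" by (elim exE conjE)
  have yn: "y n \<in> S" "y n \<noteq> x" "norm (x - y n) < 1" for n
    using subsetD[OF y(2) rangeI[of y n]] by (auto simp: dist_norm)
  define e where "e = (\<lambda>n. {x, y n})"
  have eE: "e n \<in> unit_edges S" for n unfolding e_def unit_edges_pair_iff using x yn(1,3) yn(2)[of n] by auto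
  have inje: "inj e"
  proof (rule injI)
    fix m n assume "e m = e n"
    then have "y m = y n" using yn(2) unfolding e_def by (auto simp: doubleton_eq_iff)
    then show "m = n" using y(1) by (simp add: inj_eq)
  qed
  show ?thesis
  proof (rule strongly_non_radoI[OF p nz S inje])
    show "range e \<subseteq> unit_edges S" using eE by blast
    have eq: "f ` e n = restrict f S ` e n" for f :: "'v \<Rightarrow> 'v" and n
      using x yn(1) by (auto simp: e_def)
    have "countable ((\<lambda>g (n::nat). g ` e n) ` (\<lambda>f. restrict f S) ` {f. step_isometry f S})"
      using countable_step_isometries[OF dec fd nz S inj] by (rule countable_image)
    then show "countable ((\<lambda>f (n::nat). f ` e n) ` {f. step_isometry f S})"
      by (simp only: image_image eq[symmetric])
  qed
qed

section \<open>Back and forth\<close>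

lemma back_and_forth:
  assumes S: "countable S" and p0: "P p0"
    and sub: "\<And>p. P p \<Longrightarrow> p \<subseteq> S \<times> S"
    and inj: "\<And>p x y x' y'. P p \<Longrightarrow> (x, y) \<in> p \<Longrightarrow> (x', y') \<in> p \<Longrightarrow> x = x' \<longleftrightarrow> y = y'"
    and forth: "\<And>p x. P p \<Longrightarrow> x \<in> S \<Longrightarrow> \<exists>q. P q \<and> p \<subseteq> q \<and> x \<in> Domain q"
    and backward: "\<And>p y. P p \<Longrightarrow> y \<in> S \<Longrightarrow> \<exists>q. P q \<and> p \<subseteq> q \<and> y \<in> Range q"
  shows "\<exists>f. bij_betw f S S \<and> (\<forall>x\<in>S. \<forall>y\<in>S. \<exists>p. P p \<and> (x, f x) \<in> p \<and> (y, f y) \<in> p)"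
proof (cases "S = {}")
  case True
  then show ?thesis by (auto simp: bij_betw_def)
next
  case False
  define s where "s = from_nat_into S"
  have s: "range s = S" unfolding s_def using S False by (simp add: range_from_nat_into)
  have sS: "s n \<in> S" for n using s by auto
  have "\<exists>q. P q \<and> (p \<subseteq> q \<and> s n \<in> Domain q \<and> s n \<in> Range q)" if p: "P p" for p n
  proof -
    obtain q where q: "P q" "p \<subseteq> q" "s n \<in> Domain q" using forth[OF p sS] by blast
    obtain r where r: "P r" "q \<subseteq> r" "s n \<in> Range r" using backward[OF q(1) sS] by blast
    have "s n \<in> Domain r" using q(3) r(2) by (meson Domain_mono subsetD)
    then show ?thesis using q r by (intro exI[of _ r]) auto
  qed
  then have "\<exists>c. \<forall>n. P (c n) \<and> (c n \<subseteq> c (Suc n) \<and> s n \<in> Domain (c (Suc n)) \<and> s n \<in> Range (c (Suc n)))"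
    using p0 by (intro dependent_nat_choice) auto
  then obtain c where c: "\<And>n. P (c n)" "\<And>n. c n \<subseteq> c (Suc n)" "\<And>n. s n \<in> Domain (c (Suc n))" "\<And>n. s n \<in> Range (c (Suc n))"
    by blast
  have mono: "c m \<subseteq> c n" if "m \<le> n" for m n using that c(2) by (rule lift_Suc_mono_le[rotated])
  define R where "R = (\<Union>n. c n)"
  have common: "\<exists>n. (x, y) \<in> c n \<and> (x', y') \<in> c n" if xy: "(x, y) \<in> R" "(x', y') \<in> R" for x y x' y'
  proof -
    obtain m n where "(x, y) \<in> c m" "(x', y') \<in> c n" using xy unfolding R_def by blast
    then show ?thesis using mono[of m "max m n"] mono[of n "max m n"] by (intro exI[of _ "max m n"]) auto
  qed
  have injR: "x = x' \<longleftrightarrow> y = y'" if "(x, y) \<in> R" "(x', y') \<in> R" for x y x' y'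
    using common[OF that] inj[OF c(1)] by blast
  have RS: "x \<in> S" "y \<in> S" if "(x, y) \<in> R" for x y
    using that sub[OF c(1)] by (auto simp: R_def)
  have domR: "\<exists>y. (x, y) \<in> R" if xS: "x \<in> S" for x
  proof -
    obtain n where "x = s n" using xS s by blast
    then show ?thesis using c(3)[of n] by (auto simp: R_def)
  qed
  have ranR: "\<exists>x. (x, y) \<in> R" if yS: "y \<in> S" for y
  proof -
    obtain n where "y = s n" using yS s by blast
    then show ?thesis using c(4)[of n] by (auto simp: R_def)
  qed
  obtain f where f: "\<And>x. x \<in> S \<Longrightarrow> (x, f x) \<in> R" using domR by metis
  have "bij_betw f S S"
    unfolding bij_betw_def
  proof
    show "inj_on f S" using f injR by (intro inj_onI) blast
    show "f ` S = S"
    proof (intro equalityI subsetI)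
      fix y assume "y \<in> f ` S" then show "y \<in> S" using f RS(2) by blast
    next
      fix y assume "y \<in> S"
      then obtain x where x: "(x, y) \<in> R" using ranR by blast
      then have "f x = y" using injR[OF x f[OF RS(1)[OF x]]] by simp
      then show "y \<in> f ` S" using RS(1)[OF x] by blast
    qed
  qed
  moreover have "\<exists>p. P p \<and> (x, f x) \<in> p \<and> (y, f y) \<in> p" if "x \<in> S" "y \<in> S" for x y
    using common[OF f[OF that(1)] f[OF that(2)]] c(1) by blast
  ultimately show ?thesis by blast
qed

text \<open>
  The weak inequalities leave a whole open interval between \<open>A\<close> and \<open>B\<close>, also when one of them
  is empty.
\<close>

lemma finite_real_gap:
  fixes A B :: "real set"
  assumes "finite A" "finite B" "\<And>a b. a \<in> A \<Longrightarrow> b \<in> B \<Longrightarrow> a < b"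
  shows "\<exists>l r. l < r \<and> (\<forall>a\<in>A. a \<le> l) \<and> (\<forall>b\<in>B. r \<le> b)"
proof (cases "A = {} \<or> B = {}")
  case True
  then show ?thesis
  proof
    assume "A = {}"
    moreover have "\<forall>b\<in>B. Min (insert 0 B) \<le> b" using assms(2) by (intro ballI Min_le) auto
    ultimately show ?thesis
      by (intro exI[of _ "Min (insert 0 B) - 1"] exI[of _ "Min (insert 0 B)"]) simp
  next
    assume "B = {}"
    moreover have "\<forall>a\<in>A. a \<le> Max (insert 0 A)" using assms(1) by (intro ballI Max_ge) auto
    ultimately show ?thesis
      by (intro exI[of _ "Max (insert 0 A)"] exI[of _ "Max (insert 0 A) + 1"]) simp
  qed
next
  case False
  then have "Max A \<in> A" "Min B \<in> B" using assms by auto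
  then show ?thesis using assms by (intro exI[of _ "Max A"] exI[of _ "Min B"]) auto
qed

text \<open>
  Rational boxes are coded by lists, which form a countable type.
\<close>

lemma rational_box:
  fixes l r :: "nat \<Rightarrow> real"
  assumes lr: "\<forall>i<d. l i < r i"
  shows "\<exists>ls rs :: rat list. \<forall>i<d. l i < of_rat (ls ! i) \<and> real_of_rat (ls ! i) < of_rat (rs ! i) \<and> of_rat (rs ! i) < r i"
proof -
  have "\<exists>a b. l i < real_of_rat a \<and> real_of_rat a < real_of_rat b \<and> real_of_rat b < r i" if i: "i < d" for i
  proof -
    have "l i < r i" using lr i by blast
    then obtain a where a: "l i < real_of_rat a" "real_of_rat a < r i" using of_rat_dense by blast
    obtain b where "real_of_rat a < real_of_rat b" "real_of_rat b < r i" using of_rat_dense[OF a(2)] by blast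
    with a show ?thesis by blast
  qed
  then have "\<forall>i\<in>{..<d}. \<exists>ab. l i < real_of_rat (fst ab) \<and> real_of_rat (fst ab) < real_of_rat (snd ab) \<and> real_of_rat (snd ab) < r i"
    by auto
  from bchoice[OF this] obtain ab where ab: "\<And>i. i < d \<Longrightarrow> l i < real_of_rat (fst (ab i)) \<and>
      real_of_rat (fst (ab i)) < real_of_rat (snd (ab i)) \<and> real_of_rat (snd (ab i)) < r i" by auto
  show ?thesis
    by (rule exI[of _ "map (\<lambda>i. fst (ab i)) [0..<d]"], rule exI[of _ "map (\<lambda>i. snd (ab i)) [0..<d]"])
      (simp add: ab)
qed

lemma abs_less_one_iff_floor:
  fixes t :: real
  assumes "t \<notin> \<int>"
  shows "\<bar>t\<bar> < 1 \<longleftrightarrow> \<lfloor>t\<rfloor> = 0 \<or> \<lfloor>t\<rfloor> = -1"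
proof -
  have "t \<noteq> of_int \<lfloor>t\<rfloor>" using assms by (metis Ints_of_int)
  then show ?thesis by linarith
qed

context linf_direct_sum
begin

definition fibre_box :: "'v set \<Rightarrow> 'v \<Rightarrow> (nat \<Rightarrow> real) \<Rightarrow> (nat \<Rightarrow> real) \<Rightarrow> 'v set" where
  "fibre_box S x l r = {y \<in> S. u_part y = u_part x \<and> (\<forall>i<d. l i < cc y i \<and> cc y i < r i)}"

definition nonintegral_outside :: "'v set \<Rightarrow> 'v set \<Rightarrow> bool" where
  "nonintegral_outside F S \<longleftrightarrow>
     (\<forall>x\<in>S. \<forall>y\<in>S. x \<noteq> y \<and> \<not> (x \<in> F \<and> y \<in> F) \<longrightarrow> (\<forall>i<d. cc x i - cc y i \<notin> \<int>))"

definition fibred_outside :: "'v set \<Rightarrow> 'v set \<Rightarrow> bool" where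
  "fibred_outside F S \<longleftrightarrow>
     (\<forall>x\<in>S - F. \<forall>l r. (\<forall>i<d. l i < r i) \<longrightarrow> infinite (fibre_box S x l r))"

lemma nonintegral_outsideD:
  assumes "nonintegral_outside F S" "x \<in> S" "y \<in> S" "x \<noteq> y" "\<not> (x \<in> F \<and> y \<in> F)" "i < d"
  shows "cc x i - cc y i \<notin> \<int>"
  using assms unfolding nonintegral_outside_def by blast

lemma fibred_outsideD:
  assumes "fibred_outside F S" "x \<in> S - F" "\<forall>i<d. l i < r i"
  shows "infinite (fibre_box S x l r)"
  using assms unfolding fibred_outside_def by blast

definition box_saturated :: "'v set \<Rightarrow> 'v set \<Rightarrow> ('v set \<Rightarrow> bool) \<Rightarrow> bool" where
  "box_saturated S F \<omega> \<longleftrightarrow>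
     (\<forall>x\<in>S - F. \<forall>l r. (\<forall>i<d. l i < r i) \<longrightarrow> saturated S \<omega> (fibre_box S x l r))"

text \<open>
  Countably many boxes suffice, namely the rational ones, since saturation is inherited by
  larger sets.
\<close>

lemma AE_box_saturated:
  assumes p: "0 < p" "p < 1" and S: "countable S"
    and fib: "fibred_outside F S"
  shows "AE \<omega> in random_graph p S. box_saturated S F \<omega>"
proof -
  let ?q = "\<lambda>(xs :: rat list) i. real_of_rat (xs ! i)"
  have "AE \<omega> in random_graph p S. \<forall>x\<in>S - F. \<forall>ls\<in>UNIV. \<forall>rs\<in>UNIV.
      (\<forall>i<d. ?q ls i < ?q rs i) \<longrightarrow> saturated S \<omega> (fibre_box S x (?q ls) (?q rs))"
  proof -
    have "AE \<omega> in random_graph p S. (\<forall>i<d. ?q ls i < ?q rs i) \<longrightarrow> saturated S \<omega> (fibre_box S x (?q ls) (?q rs))"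
      if x: "x \<in> S - F" for x ls rs
    proof (cases "\<forall>i<d. ?q ls i < ?q rs i")
      case True
      then have "infinite (fibre_box S x (?q ls) (?q rs))" by (rule fibred_outsideD[OF fib x])
      from AE_saturated[OF p S this] show ?thesis by eventually_elim simp
    next
      case False
      then show ?thesis by (intro AE_I2) blast
    qed
    then show ?thesis
      by (simp only: AE_ball_countable S countable_Diff countableI_type ball_UNIV[symmetric]) blast
  qed
  then show ?thesis
  proof eventually_elim
    case (elim \<omega>)
    show ?case unfolding box_saturated_def
    proof (intro ballI allI impI)
      fix x l r assume x: "x \<in> S - F" and lr: "\<forall>i<d. l i < (r i :: real)"
      from rational_box[OF lr] obtain ls rs
        where ls_rs: "\<forall>i<d. l i < ?q ls i \<and> ?q ls i < ?q rs i \<and> ?q rs i < r i" by blast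
      then have q: "l i < ?q ls i" "?q ls i < ?q rs i" "?q rs i < r i" if "i < d" for i using that by blast+
      have sat: "saturated S \<omega> (fibre_box S x (?q ls) (?q rs))" using elim x q(2) by blast
      have sub: "fibre_box S x (?q ls) (?q rs) \<subseteq> fibre_box S x l r"
      proof
        fix y assume "y \<in> fibre_box S x (?q ls) (?q rs)"
        then have y: "y \<in> S" "u_part y = u_part x" "\<And>i. i < d \<Longrightarrow> ?q ls i < cc y i \<and> cc y i < ?q rs i"
          by (auto simp: fibre_box_def)
        have "l i < cc y i \<and> cc y i < r i" if "i < d" for i using q[OF that] y(3)[OF that] by linarith
        with y(1,2) show "y \<in> fibre_box S x l r" by (simp add: fibre_box_def)
      qed
      show "saturated S \<omega> (fibre_box S x l r)"
        unfolding saturated_def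
      proof (intro allI impI; elim conjE)
        fix A B assume A: "finite A" "A \<subseteq> S" "\<forall>z\<in>fibre_box S x l r. \<forall>a\<in>A. {z, a} \<in> unit_edges S"
        have "\<forall>z\<in>fibre_box S x (?q ls) (?q rs). \<forall>a\<in>A. {z, a} \<in> unit_edges S" using A(3) sub by blast
        from saturatedD[OF sat A(1,2) this]
        obtain z where z: "z \<in> fibre_box S x (?q ls) (?q rs)" "\<forall>a\<in>A. \<omega> {z, a} \<longleftrightarrow> a \<in> B" by (rule bexE)
        show "\<exists>z\<in>fibre_box S x l r. \<forall>a\<in>A. \<omega> {z, a} \<longleftrightarrow> a \<in> B"
          using z(2) subsetD[OF sub z(1)] by (rule bexI)
      qed
    qed
  qed
qed

text \<open>
  Equal \<open>U\<close>-components and equal integer parts of all coordinate differences ensure that two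
  points are at distance less than \<open>1\<close> if and only if their images are, as long as coordinate
  differences are not integers. The points of \<open>F\<close> are fixed from the beginning.
\<close>

definition partial_iso :: "'v set \<Rightarrow> 'v set \<Rightarrow> ('v set \<Rightarrow> bool) \<Rightarrow> ('v set \<Rightarrow> bool) \<Rightarrow> ('v \<times> 'v) set \<Rightarrow> bool" where
  "partial_iso S F \<omega> \<omega>' p \<longleftrightarrow> finite p \<and> p \<subseteq> S \<times> S \<and> (\<forall>a\<in>F. (a, a) \<in> p) \<and>
     (\<forall>(x, y)\<in>p. u_part x = u_part y) \<and>
     (\<forall>(x, y)\<in>p. \<forall>(x', y')\<in>p. (x = x' \<longleftrightarrow> y = y') \<and> (\<forall>i<d. \<lfloor>cc x i - cc x' i\<rfloor> = \<lfloor>cc y i - cc y' i\<rfloor>) \<and>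
        ({x, x'} \<in> kept_edges S \<omega> \<longleftrightarrow> {y, y'} \<in> kept_edges S \<omega>'))"

lemma partial_iso_edges:
  assumes "partial_iso S F \<omega> \<omega>' p" "(a, b) \<in> p" "(a', b') \<in> p"
  shows "{a, a'} \<in> kept_edges S \<omega> \<longleftrightarrow> {b, b'} \<in> kept_edges S \<omega>'"
  using assms unfolding partial_iso_def by fast

lemma partial_iso_converse: "partial_iso S F \<omega> \<omega>' p \<Longrightarrow> partial_iso S F \<omega>' \<omega> (p\<inverse>)"
  unfolding partial_iso_def by (simp add: finite_converse) fastforce

text \<open>
  The image \<open>z\<close> of \<open>x\<close> needs the same \<open>U\<close>-component, and its \<open>i\<close>-th coordinate must lie strictly
  between \<open>b\<^sub>i + \<lfloor>x\<^sub>i - a\<^sub>i\<rfloor>\<close> and \<open>b\<^sub>i + \<lfloor>x\<^sub>i - a\<^sub>i\<rfloor> + 1\<close> for all pairs \<open>(a, b)\<close> already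
  matched. These intervals have a common open part because integer parts have been kept so far.
  Any \<open>z\<close> of \<open>S\<close> in the resulting box has the right neighbours in the unit graph, and saturation
  chooses one with the right neighbours in the random graph.
\<close>

lemma partial_iso_extend:
  assumes d: "d > 0" and gen: "nonintegral_outside F S"
    and sat: "box_saturated S F \<omega>'" and p: "partial_iso S F \<omega> \<omega>' p" and x: "x \<in> S"
  shows "\<exists>q. partial_iso S F \<omega> \<omega>' q \<and> p \<subseteq> q \<and> x \<in> Domain q"
proof (cases "x \<in> Domain p")
  case True
  then show ?thesis using p by blast
next
  case False
  have fin: "finite p" and pS: "p \<subseteq> S \<times> S" and Fp: "\<And>a. a \<in> F \<Longrightarrow> (a, a) \<in> p"
    and up: "\<And>a b. (a, b) \<in> p \<Longrightarrow> u_part a = u_part b"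
    and pinj: "\<And>a b a' b'. (a, b) \<in> p \<Longrightarrow> (a', b') \<in> p \<Longrightarrow> a = a' \<longleftrightarrow> b = b'"
    and pfl: "\<And>a b a' b' i. (a, b) \<in> p \<Longrightarrow> (a', b') \<in> p \<Longrightarrow> i < d \<Longrightarrow> \<lfloor>cc a i - cc a' i\<rfloor> = \<lfloor>cc b i - cc b' i\<rfloor>"
    and pe: "\<And>a b a' b'. (a, b) \<in> p \<Longrightarrow> (a', b') \<in> p \<Longrightarrow> {a, a'} \<in> kept_edges S \<omega> \<longleftrightarrow> {b, b'} \<in> kept_edges S \<omega>'"
    using p unfolding partial_iso_def by fast+
  have xF: "x \<notin> F" using False Fp by blast
  have xne: "x \<noteq> a" if "(a, b) \<in> p" for a b using that False by blast
  have nonint: "cc x i - cc a i \<notin> \<int>" if "(a, b) \<in> p" "i < d" for a b i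
    using nonintegral_outsideD[OF gen x, of a i] pS that xne[OF that(1)] xF by blast
  have gap: "\<exists>l r. l < r \<and> (\<forall>t\<in>(\<lambda>(a, b). cc b i + of_int \<lfloor>cc x i - cc a i\<rfloor>) ` p. t \<le> l) \<and>
      (\<forall>t\<in>(\<lambda>(a, b). cc b i + of_int \<lfloor>cc x i - cc a i\<rfloor> + 1) ` p. r \<le> t)" if i: "i < d" for i
  proof (rule finite_real_gap)
    fix s t assume "s \<in> (\<lambda>(a, b). cc b i + of_int \<lfloor>cc x i - cc a i\<rfloor>) ` p"
      "t \<in> (\<lambda>(a, b). cc b i + of_int \<lfloor>cc x i - cc a i\<rfloor> + 1) ` p"
    then obtain a b a' b' where ab: "(a, b) \<in> p" "s = cc b i + of_int \<lfloor>cc x i - cc a i\<rfloor>"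
      and ab': "(a', b') \<in> p" "t = cc b' i + of_int \<lfloor>cc x i - cc a' i\<rfloor> + 1" by auto
    have "cc a i - cc a' i < of_int (\<lfloor>cc x i - cc a' i\<rfloor> - \<lfloor>cc x i - cc a i\<rfloor> + 1)" by (simp, linarith)
    then have "\<lfloor>cc a i - cc a' i\<rfloor> < \<lfloor>cc x i - cc a' i\<rfloor> - \<lfloor>cc x i - cc a i\<rfloor> + 1" by (simp only: floor_less_iff)
    then have "\<lfloor>cc b i - cc b' i\<rfloor> < \<lfloor>cc x i - cc a' i\<rfloor> - \<lfloor>cc x i - cc a i\<rfloor> + 1"
      using pfl[OF ab(1) ab'(1) i] by simp
    then have "cc b i - cc b' i < of_int (\<lfloor>cc x i - cc a' i\<rfloor> - \<lfloor>cc x i - cc a i\<rfloor> + 1)" by (simp only: floor_less_iff)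
    then show "s < t" unfolding ab(2) ab'(2) by simp
  qed (use fin in auto)
  have "\<forall>i\<in>{..<d}. \<exists>lr. fst lr < snd lr \<and> (\<forall>a b. (a, b) \<in> p \<longrightarrow>
      cc b i + of_int \<lfloor>cc x i - cc a i\<rfloor> \<le> fst lr \<and> snd lr \<le> cc b i + of_int \<lfloor>cc x i - cc a i\<rfloor> + 1)"
  proof
    fix i assume "i \<in> {..<d}"
    then have "i < d" by simp
    from gap[OF this] obtain l r where "l < r"
      and lr: "\<forall>t\<in>(\<lambda>(a, b). cc b i + of_int \<lfloor>cc x i - cc a i\<rfloor>) ` p. t \<le> l"
        "\<forall>t\<in>(\<lambda>(a, b). cc b i + of_int \<lfloor>cc x i - cc a i\<rfloor> + 1) ` p. r \<le> t" by blast
    moreover have "cc b i + of_int \<lfloor>cc x i - cc a i\<rfloor> \<le> l \<and> r \<le> cc b i + of_int \<lfloor>cc x i - cc a i\<rfloor> + 1"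
      if "(a, b) \<in> p" for a b
      using bspec[OF lr(1) imageI[OF that]] bspec[OF lr(2) imageI[OF that]] by simp
    ultimately show "\<exists>lr. fst lr < snd lr \<and> (\<forall>a b. (a, b) \<in> p \<longrightarrow>
      cc b i + of_int \<lfloor>cc x i - cc a i\<rfloor> \<le> fst lr \<and> snd lr \<le> cc b i + of_int \<lfloor>cc x i - cc a i\<rfloor> + 1)"
      by (intro exI[of _ "(l, r)"]) simp
  qed
  from bchoice[OF this] obtain lr where lr_all: "\<forall>i\<in>{..<d}. fst (lr i) < snd (lr i) \<and> (\<forall>a b. (a, b) \<in> p \<longrightarrow>
      cc b i + of_int \<lfloor>cc x i - cc a i\<rfloor> \<le> fst (lr i) \<and> snd (lr i) \<le> cc b i + of_int \<lfloor>cc x i - cc a i\<rfloor> + 1)" ..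
  define l r where "l = (\<lambda>i. fst (lr i))" and "r = (\<lambda>i. snd (lr i))"
  have lr: "l i < r i" if "i < d" for i using lr_all that by (simp add: l_def r_def)
  have l: "cc b i + of_int \<lfloor>cc x i - cc a i\<rfloor> \<le> l i" and r: "r i \<le> cc b i + of_int \<lfloor>cc x i - cc a i\<rfloor> + 1"
    if "i < d" "(a, b) \<in> p" for i a b using lr_all that by (simp_all add: l_def r_def)
  let ?Z = "fibre_box S x l r"
  have Z: "z \<in> S" "u_part z = u_part x" "\<And>i. i < d \<Longrightarrow> l i < cc z i \<and> cc z i < r i" if "z \<in> ?Z" for z
    using that by (auto simp: fibre_box_def)
  have strict: "of_int \<lfloor>cc x i - cc a i\<rfloor> < cc z i - cc b i \<and> cc z i - cc b i < of_int \<lfloor>cc x i - cc a i\<rfloor> + 1"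
    if "z \<in> ?Z" "(a, b) \<in> p" "i < d" for z a b i
    using Z(3)[OF that(1,3)] l[OF that(3,2)] r[OF that(3,2)] by linarith
  have fl: "\<lfloor>cc z i - cc b i\<rfloor> = \<lfloor>cc x i - cc a i\<rfloor>" if "z \<in> ?Z" "(a, b) \<in> p" "i < d" for z a b i
    using strict[OF that] by (simp add: floor_eq_iff)
  have fl': "\<lfloor>cc b i - cc z i\<rfloor> = \<lfloor>cc a i - cc x i\<rfloor>" if "z \<in> ?Z" "(a, b) \<in> p" "i < d" for z a b i
  proof -
    have "cc x i - cc a i \<noteq> of_int \<lfloor>cc x i - cc a i\<rfloor>" using nonint[OF that(2,3)] by (metis Ints_of_int)
    then have "\<lfloor>cc a i - cc x i\<rfloor> = - \<lfloor>cc x i - cc a i\<rfloor> - 1" by linarith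
    moreover have "\<lfloor>cc b i - cc z i\<rfloor> = - \<lfloor>cc x i - cc a i\<rfloor> - 1" using strict[OF that] by linarith
    ultimately show ?thesis by simp
  qed
  have znonint: "cc z i - cc b i \<notin> \<int>" if "z \<in> ?Z" "(a, b) \<in> p" "i < d" for z a b i
  proof
    assume "cc z i - cc b i \<in> \<int>"
    then obtain k where k: "cc z i - cc b i = of_int k" by (auto elim: Ints_cases)
    have "real_of_int \<lfloor>cc x i - cc a i\<rfloor> < of_int k" "real_of_int k < of_int (\<lfloor>cc x i - cc a i\<rfloor> + 1)"
      using strict[OF that] unfolding k by simp_all
    then show False unfolding of_int_less_iff by linarith
  qed
  have zne: "z \<noteq> b" if "z \<in> ?Z" "(a, b) \<in> p" for z a b
    using znonint[OF that d] by auto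
  have near: "norm (z - b) < 1 \<longleftrightarrow> norm (x - a) < 1" if zab: "z \<in> ?Z" "(a, b) \<in> p" for z a b
  proof -
    have "u_part (z - b) = u_part (x - a)" using Z(2)[OF zab(1)] up[OF zab(2)] by (simp add: u_part_diff)
    moreover have "\<bar>cc (z - b) i\<bar> < 1 \<longleftrightarrow> \<bar>cc (x - a) i\<bar> < 1" if "i < d" for i
      unfolding cc_diff abs_less_one_iff_floor[OF znonint[OF zab that]]
        abs_less_one_iff_floor[OF nonint[OF zab(2) that]] fl[OF zab that] by (rule refl)
    ultimately show ?thesis
  unfolding norm_less_iff[OF zero_less_one, of "z - b"] norm_less_iff[OF zero_less_one, of "x - a"] by simp
  qed
  \<comment> \<open>\<open>A\<close> consists of the images to which \<open>z\<close> may be adjacent, \<open>B\<close> of those to which it must be.\<close>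
  define A where "A = {b. \<exists>a. (a, b) \<in> p \<and> norm (x - a) < 1}"
  define B where "B = {b. \<exists>a. (a, b) \<in> p \<and> {x, a} \<in> kept_edges S \<omega>}"
  have "A \<subseteq> Range p" by (auto simp: A_def)
  then have finA: "finite A" using fin by (meson finite_Range finite_subset)
  have AS: "A \<subseteq> S" using pS by (auto simp: A_def)
  have edges: "\<forall>z\<in>?Z. \<forall>b\<in>A. {z, b} \<in> unit_edges S"
  proof (intro ballI)
    fix z b assume z: "z \<in> ?Z" and b: "b \<in> A"
    then obtain a where a: "(a, b) \<in> p" "norm (x - a) < 1" by (auto simp: A_def)
    show "{z, b} \<in> unit_edges S"
      using Z(1)[OF z] subsetD[OF AS b] zne[OF z a(1)] near[OF z a(1)] a(2) by (simp add: unit_edges_pair_iff)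
  qed
  have "\<forall>i<d. l i < r i" using lr by blast
  with sat x xF have "saturated S \<omega>' ?Z" unfolding box_saturated_def by blast
  from saturatedD[OF this finA AS edges]
  have "\<exists>z\<in>?Z. \<forall>b\<in>A. \<omega>' {z, b} \<longleftrightarrow> b \<in> B" .
  then obtain z where z: "z \<in> ?Z" and zB: "\<And>b. b \<in> A \<Longrightarrow> \<omega>' {z, b} \<longleftrightarrow> b \<in> B" by blast
  have ze: "{z, b} \<in> kept_edges S \<omega>' \<longleftrightarrow> {x, a} \<in> kept_edges S \<omega>" if ab: "(a, b) \<in> p" for a b
  proof (cases "norm (x - a) < 1")
    case True
    then have bA: "b \<in> A" using ab by (auto simp: A_def)
    have "b \<in> B \<longleftrightarrow> {x, a} \<in> kept_edges S \<omega>" unfolding B_def using ab pinj by blast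
    then show ?thesis using zB[OF bA] edges z bA by (auto simp: kept_edges_def)
  next
    case False
    then show ?thesis using near[OF z ab] by (auto simp: kept_edges_def unit_edges_pair_iff)
  qed
  have loop: "{a, a} \<notin> kept_edges S \<theta>" for a and \<theta> :: "'v set \<Rightarrow> bool"
    by (simp add: kept_edges_def unit_edges_pair_iff del: insert_absorb2)
  have "partial_iso S F \<omega> \<omega>' (insert (x, z) p)"
    unfolding partial_iso_def
  proof (intro conjI)
    show "finite (insert (x, z) p)" using fin by simp
    show "insert (x, z) p \<subseteq> S \<times> S" using pS x Z(1)[OF z] by blast
    show "\<forall>a\<in>F. (a, a) \<in> insert (x, z) p" using Fp by blast
    show "\<forall>(a, b)\<in>insert (x, z) p. u_part a = u_part b" using up Z(2)[OF z] by auto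
    show "\<forall>(a, b)\<in>insert (x, z) p. \<forall>(a', b')\<in>insert (x, z) p. (a = a' \<longleftrightarrow> b = b') \<and>
        (\<forall>i<d. \<lfloor>cc a i - cc a' i\<rfloor> = \<lfloor>cc b i - cc b' i\<rfloor>) \<and>
        ({a, a'} \<in> kept_edges S \<omega> \<longleftrightarrow> {b, b'} \<in> kept_edges S \<omega>')"
    proof (clarify)
      fix a b a' b' assume ab: "(a, b) \<in> insert (x, z) p" and ab': "(a', b') \<in> insert (x, z) p"
      consider "a = x" "b = z" "a' = x" "b' = z" | "a = x" "b = z" "(a', b') \<in> p" | "(a, b) \<in> p" "a' = x" "b' = z"
        | "(a, b) \<in> p" "(a', b') \<in> p" using ab ab' by blast
      then show "(a = a' \<longleftrightarrow> b = b') \<and> (\<forall>i<d. \<lfloor>cc a i - cc a' i\<rfloor> = \<lfloor>cc b i - cc b' i\<rfloor>) \<and>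
        ({a, a'} \<in> kept_edges S \<omega> \<longleftrightarrow> {b, b'} \<in> kept_edges S \<omega>')"
      proof cases
        case 1
        then show ?thesis using loop[of x \<omega>] loop[of z \<omega>'] by simp
      next
        case 2
        then show ?thesis using xne[OF 2(3)] zne[OF z 2(3)] fl[OF z 2(3)] ze[OF 2(3)] by simp
      next
        case 3
        then show ?thesis using xne[OF 3(1)] zne[OF z 3(1)] fl'[OF z 3(1)] ze[OF 3(1)] by (auto simp: insert_commute)
      next
        case 4
        then show ?thesis using pinj[OF 4] pfl[OF 4] pe[OF 4] by blast
      qed
    qed
  qed
  then show ?thesis by blast
qed

theorem isomorphic_if_agree_on_exceptional:
  assumes p: "0 < p" "p < 1" and d: "d > 0" and S: "countable S" and F: "finite F" "F \<subseteq> S"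
    and gen: "nonintegral_outside F S"
    and fib: "fibred_outside F S"
  shows "AE x in random_graph_pair p S.
    (\<forall>a\<in>F. \<forall>b\<in>F. {a, b} \<in> kept_edges S (fst x) \<longleftrightarrow> {a, b} \<in> kept_edges S (snd x)) \<longrightarrow>
    graph_isomorphic S (kept_edges S (fst x)) (kept_edges S (snd x))"
proof -
  have "AE \<omega> in random_graph p S. box_saturated S F \<omega>" by (rule AE_box_saturated[OF p S fib])
  from AE_fst_random_graph[OF this] AE_snd_random_graph[OF this] show ?thesis
  proof eventually_elim
    case (elim x)
    obtain \<omega> \<omega>' where x: "x = (\<omega>, \<omega>')" by (cases x)
    have sat: "box_saturated S F \<omega>" "box_saturated S F \<omega>'" using elim x by auto
    show ?case unfolding x fst_conv snd_conv
    proof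
      assume agree: "\<forall>a\<in>F. \<forall>b\<in>F. {a, b} \<in> kept_edges S \<omega> \<longleftrightarrow> {a, b} \<in> kept_edges S \<omega>'"
      have "\<exists>f. bij_betw f S S \<and> (\<forall>x\<in>S. \<forall>y\<in>S. \<exists>p. partial_iso S F \<omega> \<omega>' p \<and> (x, f x) \<in> p \<and> (y, f y) \<in> p)"
      proof (rule back_and_forth[OF S])
        show "partial_iso S F \<omega> \<omega>' (Id_on F)"
          using F agree unfolding partial_iso_def by (auto simp: Id_on_def)
        show "q \<subseteq> S \<times> S" if "partial_iso S F \<omega> \<omega>' q" for q using that by (simp add: partial_iso_def)
        show "a = a' \<longleftrightarrow> b = b'" if "partial_iso S F \<omega> \<omega>' q" "(a, b) \<in> q" "(a', b') \<in> q" for q a b a' b'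
          using that unfolding partial_iso_def by blast
        show "\<exists>r. partial_iso S F \<omega> \<omega>' r \<and> q \<subseteq> r \<and> a \<in> Domain r" if "partial_iso S F \<omega> \<omega>' q" "a \<in> S" for q a
          by (rule partial_iso_extend[OF d gen sat(2) that])
        show "\<exists>r. partial_iso S F \<omega> \<omega>' r \<and> q \<subseteq> r \<and> b \<in> Range r" if q: "partial_iso S F \<omega> \<omega>' q" "b \<in> S" for q b
        proof -
          obtain r where r: "partial_iso S F \<omega>' \<omega> r" "q\<inverse> \<subseteq> r" "b \<in> Domain r"
            using partial_iso_extend[OF d gen sat(1) partial_iso_converse[OF q(1)] q(2)] by blast
          have "q \<subseteq> r\<inverse>" "b \<in> Range (r\<inverse>)" using r(2,3) by auto
          with partial_iso_converse[OF r(1)] show ?thesis by blast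
        qed
      qed
      then obtain f where f: "bij_betw f S S"
        "\<And>x y. x \<in> S \<Longrightarrow> y \<in> S \<Longrightarrow> \<exists>p. partial_iso S F \<omega> \<omega>' p \<and> (x, f x) \<in> p \<and> (y, f y) \<in> p" by blast
      have "{a, b} \<in> kept_edges S \<omega> \<longleftrightarrow> {f a, f b} \<in> kept_edges S \<omega>'" if ab: "a \<in> S" "b \<in> S" for a b
      proof -
        obtain q where q: "partial_iso S F \<omega> \<omega>' q" "(a, f a) \<in> q" "(b, f b) \<in> q" using f(2)[OF ab] by blast
        then show ?thesis by (rule partial_iso_edges)
      qed
      with f(1) show "graph_isomorphic S (kept_edges S \<omega>) (kept_edges S \<omega>')"
        unfolding graph_isomorphic_def by blast
    qed
  qed
qed

lemma rado_if_generic_and_fibred: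
  assumes p: "0 < p" "p < 1" and d: "d > 0" and S: "countable S"
    and gen: "nonintegral_outside {} S" and fib: "fibred_outside {} S"
  shows "rado p S"
proof -
  have "AE x in random_graph_pair p S.
    (\<forall>a\<in>{}. \<forall>b\<in>{}. {a, b} \<in> kept_edges S (fst x) \<longleftrightarrow> {a, b} \<in> kept_edges S (snd x)) \<longrightarrow>
    graph_isomorphic S (kept_edges S (fst x)) (kept_edges S (snd x))"
    by (rule isomorphic_if_agree_on_exceptional[OF p d S]) (use gen fib in auto)
  then show ?thesis unfolding rado_def by simp
qed

text \<open>
  There is only one fibre, and the box contains a ball of the space.
\<close>

lemma fibre_box_infinite_if_no_complement:
  assumes U: "U = {0}" and nz: "\<exists>u::'v. u \<noteq> 0" and dense: "closure S = UNIV" and lr: "\<forall>i<d. l i < r i"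
  shows "infinite (fibre_box S x l r)"
proof -
  have u0: "u_part y = 0" for y using parts(1)[of y] U by simp
  have "0 \<in> U" using U by simp
  from vector_exists[OF this, of "\<lambda>i. (l i + r i) / 2"]
  obtain v where v: "\<And>i. i < d \<Longrightarrow> cc v i = (l i + r i) / 2" by blast
  define \<epsilon> where "\<epsilon> = Min (insert 1 ((\<lambda>i. (r i - l i) / 2) ` {..<d}))"
  have \<epsilon>: "\<epsilon> > 0" unfolding \<epsilon>_def using lr by (subst Min_gr_iff) auto
  have \<epsilon>le: "\<epsilon> \<le> (r i - l i) / 2" if "i < d" for i unfolding \<epsilon>_def using that by (intro Min_le) auto
  have "S \<inter> ball v \<epsilon> \<subseteq> fibre_box S x l r"
  proof
    fix y assume y: "y \<in> S \<inter> ball v \<epsilon>"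
    have "l i < cc y i \<and> cc y i < r i" if i: "i < d" for i
    proof -
      have "norm (y - v) < \<epsilon>" using y by (simp add: dist_norm norm_minus_commute)
      then have "\<bar>cc y i - cc v i\<bar> < (r i - l i) / 2" using cc_le_norm[OF i, of "y - v"] \<epsilon>le[OF i] unfolding cc_diff by linarith
      then show ?thesis unfolding v[OF i] abs_less_iff by argo
    qed
    then show "y \<in> fibre_box S x l r" using y by (simp add: fibre_box_def u0)
  qed
  moreover have "infinite (S \<inter> ball v \<epsilon>)" by (rule infinite_dense_inter_open[OF nz dense, where x = v]) (use \<epsilon> in auto)
  ultimately show ?thesis by (rule infinite_super)
qed

end

section \<open>Constructions\<close>

text \<open>
  The numbers are chosen one after the other; each choice avoids countably many values.
  Half-integers are avoided too, in order to allow points with half-integer coordinates to be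
  added later.
\<close>

lemma generic_reals:
  fixes a b :: "nat \<Rightarrow> real"
  assumes ab: "\<And>n. a n < b n"
  shows "\<exists>r. \<forall>n. a n < r n \<and> r n < b n \<and> 2 * r n \<notin> \<int> \<and> (\<forall>m<n. r n - r m \<notin> \<int>)"
proof (rule dependent_wellorder_choice)
  fix x :: nat and f :: "nat \<Rightarrow> real"
  define X where "X = (\<lambda>k. of_int k / 2) ` (UNIV :: int set) \<union> (\<Union>m<x. (\<lambda>k. f m + of_int k) ` (UNIV :: int set))"
  have "countable X" unfolding X_def by (intro countable_Un countable_UN countable_image) auto
  then have "uncountable ({a x<..<b x} - X)"
    using ab[of x] by (intro uncountable_minus_countable) (simp add: uncountable_open_interval)
  then have "{a x<..<b x} - X \<noteq> {}" by (metis countable_empty)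
  then obtain r where r: "r \<in> {a x<..<b x}" "r \<notin> X" by blast
  have "2 * r \<notin> \<int>"
  proof
    assume "2 * r \<in> \<int>"
    then obtain k where "2 * r = of_int k" by (auto elim: Ints_cases)
    then have "r = of_int k / 2" by simp
    then show False using r(2) by (auto simp: X_def)
  qed
  moreover have "r - f m \<notin> \<int>" if "m < x" for m
  proof
    assume "r - f m \<in> \<int>"
    then obtain k where "r - f m = of_int k" by (auto elim: Ints_cases)
    then have "r = f m + of_int k" by simp
    then show False using r(2) that by (auto simp: X_def)
  qed
  ultimately show "\<exists>r. a x < r \<and> r < b x \<and> 2 * r \<notin> \<int> \<and> (\<forall>m<x. r - f m \<notin> \<int>)" using r(1) by auto
qed auto

text \<open>
  Take countably many \<open>U\<close>-components and all rational boxes, list all combinations with infinite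
  repetition, and put into each of them a point with generic coordinates. The \<open>U\<close>-components are
  the projections of a countable dense set, multiplied by a factor \<open>c\<close> for which no norm of a
  difference is \<open>2\<close> or \<open>3\<close>.
\<close>

lemma (in finite_dim_basis) generic_fibred_set:
  fixes U W :: "'v set"
  assumes "linf_direct_sum U W d T" and d: "d > 0"
  obtains S0 where "countable S0" "closure S0 = UNIV"
    "\<And>x i. x \<in> S0 \<Longrightarrow> i < d \<Longrightarrow> 2 * T (component W U x) i \<notin> \<int>"
    "linf_direct_sum.nonintegral_outside U W d T {} S0" "linf_direct_sum.fibred_outside U W d T {} S0"
    "\<And>x y. x \<in> S0 \<Longrightarrow> y \<in> S0 \<Longrightarrow> norm (component U W x - component U W y) \<notin> {2, 3}"
    "\<And>x. x \<in> S0 \<Longrightarrow> norm (component U W x) \<notin> {2, 3}"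
proof -
  interpret linf_direct_sum U W d T by fact
  obtain D :: "'v set" where D: "countable D" "closure D = UNIV"
    using countable_dense_exists unfolding countable_dense_def by blast
  define D0 where "D0 = insert 0 (u_part ` D)"
  have D0: "countable D0" "D0 \<subseteq> U" using D(1) parts(1) subspace_0[OF subspaces(1)] by (auto simp: D0_def)
  define N where "N = (\<lambda>(a, b). norm (a - b)) ` (D0 \<times> D0)"
  have N: "countable N" unfolding N_def using D0(1) by (intro countable_image countable_SIGMA)
  have "uncountable ({0<..<1::real} - ((\<lambda>t. 2 / t) ` N \<union> (\<lambda>t. 3 / t) ` N))"
    using N by (intro uncountable_minus_countable countable_Un countable_image) (simp add: uncountable_open_interval)
  then have "{0<..<1::real} - ((\<lambda>t. 2 / t) ` N \<union> (\<lambda>t. 3 / t) ` N) \<noteq> {}" by (metis countable_empty)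
  \<comment> \<open>Each norm in \<open>N\<close> excludes at most two values of \<open>c\<close>.\<close>
  then obtain c :: real where c': "c \<in> {0<..<1} - ((\<lambda>t. 2 / t) ` N \<union> (\<lambda>t. 3 / t) ` N)" by blast
  have c: "0 < c" "c \<notin> (\<lambda>t. 2 / t) ` N" "c \<notin> (\<lambda>t. 3 / t) ` N"
    using c' unfolding Diff_iff Un_iff by auto
  define Du where "Du = (\<lambda>u. c *\<^sub>R u) ` D0"
  have Du: "countable Du" "Du \<subseteq> U" "0 \<in> Du"
    unfolding Du_def using D0 subspace_scale[OF subspaces(1)] by (auto simp: D0_def)
  have Dun: "norm (u - u') \<notin> {2, 3}" if uu': "u \<in> Du" "u' \<in> Du" for u u'
  proof -
    obtain a b where ab: "a \<in> D0" "b \<in> D0" "u = c *\<^sub>R a" "u' = c *\<^sub>R b" using uu' unfolding Du_def by blast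
    have nN: "norm (a - b) \<in> N" unfolding N_def using ab by force
    have eq: "norm (u - u') = c * norm (a - b)" using c(1) ab by (simp flip: scaleR_diff_right)
    have "norm (u - u') \<noteq> k" if k: "c \<notin> (\<lambda>t. k / t) ` N" "k > 0" for k
    proof
      assume "norm (u - u') = k"
      then have "c * norm (a - b) = k" using eq by simp
      then have "c = k / norm (a - b)" using k(2) by (auto simp: field_simps)
      then show False using k(1) nN by blast
    qed
    from this[OF c(2)] this[OF c(3)] show ?thesis by simp
  qed
  have Dud: "\<exists>u'\<in>Du. norm (u' - u) < e" if u: "u \<in> U" and e: "e > 0" for u e
  proof -
    have "e / c > 0" using e c(1) by simp
    from dense_approx[OF D(2) this, of "(1/c) *\<^sub>R u"]
    obtain s where s: "s \<in> D" "norm (s - (1/c) *\<^sub>R u) < e / c" by blast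
    have uu: "u_part u = u" using parts_unique(1)[OF u subspace_0[OF subspaces(2)]] by simp
    have "u_part (s - (1/c) *\<^sub>R u) = u_part s - (1/c) *\<^sub>R u" by (simp add: u_part_diff parts_scale uu)
    then have "norm (u_part s - (1/c) *\<^sub>R u) < e / c"
      using norm_u_part_le[of "s - (1/c) *\<^sub>R u"] s(2) by simp
    then have "c * norm (u_part s - (1/c) *\<^sub>R u) < e" using c(1) by (simp add: field_simps)
    moreover have "c *\<^sub>R (u_part s - (1/c) *\<^sub>R u) = c *\<^sub>R u_part s - u" using c(1) by (simp add: scaleR_diff_right)
    ultimately have "norm (c *\<^sub>R u_part s - u) < e" using c(1) by (metis abs_of_pos norm_scaleR)
    then show ?thesis using s(1) by (auto simp: Du_def D0_def)
  qed
  let ?q = "\<lambda>(xs :: rat list) i. real_of_rat (xs ! i)"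
  define J where "J = {(u, ls, rs). u \<in> Du \<and> (\<forall>i<d. ?q ls i < ?q rs i)}"
  have cJ: "countable J"
  proof (rule countable_subset)
    show "J \<subseteq> Du \<times> UNIV" by (auto simp: J_def)
    show "countable (Du \<times> (UNIV :: (rat list \<times> rat list) set))" using Du(1) by (intro countable_SIGMA) auto
  qed
  have J_ex: "\<exists>ls rs. (u, ls, rs) \<in> J \<and> (\<forall>i<d. l i < ?q ls i \<and> ?q rs i < r i)"
    if "u \<in> Du" "\<forall>i<d. l i < r i" for u l r
    using rational_box[OF that(2)] that(1) unfolding J_def by auto
  have neJ: "J \<noteq> {}" using J_ex[OF Du(3), of "\<lambda>_. 0" "\<lambda>_. 1"] by auto
  define g where "g = from_nat_into (J \<times> (UNIV :: nat set))"
  have g: "range g = J \<times> UNIV"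
    unfolding g_def using neJ cJ by (intro range_from_nat_into) (auto intro!: countable_SIGMA)
  have infg: "infinite {n. fst (g n) = j}" if "j \<in> J" for j
  proof
    assume "finite {n. fst (g n) = j}"
    then have "finite (g ` {n. fst (g n) = j})" by simp
    moreover have "{j} \<times> UNIV \<subseteq> g ` {n. fst (g n) = j}"
    proof
      fix y assume y: "y \<in> {j} \<times> (UNIV :: nat set)"
      then have "y \<in> range g" unfolding g using that by auto
      then obtain n where "y = g n" by blast
      then show "y \<in> g ` {n. fst (g n) = j}" using y by auto
    qed
    ultimately have "finite ({j} \<times> (UNIV :: nat set))" by (rule finite_subset[rotated])
    then show False by (simp add: finite_cartesian_product_iff)
  qed
  have gJ: "fst (g n) \<in> J" for n using g by (metis mem_Times_iff rangeI)
  define un where "un = (\<lambda>n. fst (fst (g n)))"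
  define lo where "lo = (\<lambda>n i. if i < d then ?q (fst (snd (fst (g n)))) i else 0)"
  define hi where "hi = (\<lambda>n i. if i < d then ?q (snd (snd (fst (g n)))) i else 1)"
  have lohi: "lo n i < hi n i" for n i using gJ[of n] by (auto simp: lo_def hi_def J_def)
  have un: "un n \<in> Du" for n using gJ[of n] by (auto simp: un_def J_def)
  have "\<forall>i. \<exists>r. \<forall>n. lo n i < r n \<and> r n < hi n i \<and> 2 * r n \<notin> \<int> \<and> (\<forall>m<n. r n - r m \<notin> \<int>)"
    using generic_reals[of "\<lambda>n. lo n _" "\<lambda>n. hi n _"] lohi by blast
  from choice[OF this] obtain \<rho> where \<rho>: "\<And>i n. lo n i < \<rho> i n" "\<And>i n. \<rho> i n < hi n i" "\<And>i n. 2 * \<rho> i n \<notin> \<int>"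
    "\<And>i n m. m < n \<Longrightarrow> \<rho> i n - \<rho> i m \<notin> \<int>" by blast
  have \<rho>ne: "\<rho> i n - \<rho> i m \<notin> \<int>" if "m \<noteq> n" for i m n
  proof (cases "m < n")
    case True then show ?thesis by (rule \<rho>(4))
  next
    case False
    then have "\<rho> i m - \<rho> i n \<notin> \<int>" using that by (intro \<rho>(4)) simp
    then show ?thesis using Ints_minus[of "\<rho> i n - \<rho> i m"] by auto
  qed
  have "\<forall>n. \<exists>v. u_part v = un n \<and> (\<forall>i<d. cc v i = \<rho> i n)"
  proof
    fix n
    have "un n \<in> U" using Du(2) un by blast
    from vector_exists[OF this, of "\<lambda>i. \<rho> i n"]
    show "\<exists>v. u_part v = un n \<and> (\<forall>i<d. cc v i = \<rho> i n)" by blast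
  qed
  from choice[OF this] obtain x where x: "\<And>n. u_part (x n) = un n" "\<And>n i. i < d \<Longrightarrow> cc (x n) i = \<rho> i n" by blast
  have injx: "inj x"
  proof (rule injI, rule ccontr)
    fix m n assume eq: "x m = x n" and "m \<noteq> n"
    then have "\<rho> 0 n - \<rho> 0 m \<notin> \<int>" by (intro \<rho>ne)
    moreover have "\<rho> 0 n = \<rho> 0 m" using x(2)[OF d, of n] x(2)[OF d, of m] eq by simp
    ultimately show False by simp
  qed
  have cc_bounds: "lo n i < cc (x n) i" "cc (x n) i < hi n i" if "i < d" for n i using \<rho>(1,2) x(2)[OF that] by simp_all
  have dense: "closure (range x) = UNIV"
  proof -
    have "\<exists>y\<in>range x. dist y v < e" if e: "e > 0" for v e
    proof -
      obtain u where u: "u \<in> Du" "norm (u - u_part v) < e" using Dud[OF parts(1) e] by blast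
      obtain ls rs where j: "(u, ls, rs) \<in> J" "\<forall>i<d. cc v i - e < ?q ls i \<and> ?q rs i < cc v i + e"
        using J_ex[OF u(1), of "\<lambda>i. cc v i - e" "\<lambda>i. cc v i + e"] e by auto
      obtain n where n: "fst (g n) = (u, ls, rs)" using infg[OF j(1)] not_finite_existsD by blast
      have "norm (x n - v) < e"
      proof (rule norm_less_iff[OF e, THEN iffD2], intro conjI allI impI)
        show "norm (u_part (x n - v)) < e" using u(2) n by (simp add: u_part_diff x(1) un_def)
        fix i assume i: "i < d"
        have "?q ls i < cc (x n) i" "cc (x n) i < ?q rs i"
          using cc_bounds[OF i, of n] n i by (simp_all add: lo_def hi_def)
        moreover have "cc v i - e < ?q ls i \<and> ?q rs i < cc v i + e" using j(2) i by blast
        ultimately show "\<bar>cc (x n - v) i\<bar> < e" unfolding cc_diff by linarith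
      qed
      then show ?thesis by (auto simp: dist_norm)
    qed
    then show ?thesis by (auto simp: closure_approachable)
  qed
  have fib: "infinite (fibre_box (range x) y l r)" if y: "y \<in> range x" and lr: "\<forall>i<d. l i < r i" for y l r
  proof -
    obtain n0 where n0: "y = x n0" using y by blast
    obtain ls rs where j: "(un n0, ls, rs) \<in> J" "\<forall>i<d. l i < ?q ls i \<and> ?q rs i < r i"
      using J_ex[OF un lr] by blast
    let ?M = "{n. fst (g n) = (un n0, ls, rs)}"
    have "x ` ?M \<subseteq> fibre_box (range x) y l r"
    proof
      fix z assume "z \<in> x ` ?M"
      then obtain n where n: "z = x n" "fst (g n) = (un n0, ls, rs)" by blast
      have "l i < cc z i \<and> cc z i < r i" if i: "i < d" for i
      proof -
        have "?q ls i < cc z i" "cc z i < ?q rs i"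
          using cc_bounds[OF i, of n] n i by (simp_all add: lo_def hi_def)
        moreover have "l i < ?q ls i \<and> ?q rs i < r i" using j(2) i by blast
        ultimately show ?thesis by linarith
      qed
      moreover have "u_part z = u_part y" using n n0 by (simp add: x(1) un_def)
      ultimately show "z \<in> fibre_box (range x) y l r" using n(1) by (simp add: fibre_box_def)
    qed
    moreover have "infinite (x ` ?M)" using infg[OF j(1)] injx by (simp add: finite_image_iff inj_on_subset)
    ultimately show ?thesis by (rule infinite_super)
  qed
  show ?thesis
  proof (rule that[of "range x"])
    show "2 * cc y i \<notin> \<int>" if "y \<in> range x" "i < d" for y i using that x(2) \<rho>(3) by auto
    have "cc y i - cc z i \<notin> \<int>" if yz: "y \<in> range x" "z \<in> range x" "y \<noteq> z" and i: "i < d" for y z i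
    proof -
      obtain m n where "y = x m" "z = x n" "m \<noteq> n" using yz by blast
      then show ?thesis using x(2)[OF i] \<rho>ne[of n m i] by simp
    qed
    then show "nonintegral_outside {} (range x)" unfolding nonintegral_outside_def by blast
    show "fibred_outside {} (range x)" unfolding fibred_outside_def using fib by blast
    show "norm (u_part y - u_part z) \<notin> {2, 3}" if "y \<in> range x" "z \<in> range x" for y z
      using that Dun[OF un un] by (auto simp: x(1))
    show "norm (u_part y) \<notin> {2, 3}" if "y \<in> range x" for y
      using that Dun[OF un Du(3)] by (auto simp: x(1))
  qed (use dense in auto)
qed

text \<open>
  The multiples of \<open>e\<close> by \<open>K\<close> have half-integer coordinates, so they differ from generic points
  by non-integers. A pair of points whose distance is \<open>2\<close> or \<open>3\<close> attains it in the
  \<open>U\<close>-component, which the generic set excludes, or in a coordinate, where only two exceptional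
  points can have an integer difference.
\<close>

lemma (in finite_dim_basis) exceptional_set:
  fixes U W :: "'v set"
  assumes ds: "linf_direct_sum U W d T" and d: "d > 0" and K: "countable K" "\<And>t. t \<in> K \<Longrightarrow> 2 * t \<in> \<int>"
  obtains e S where "component U W e = 0" "\<And>i. i < d \<Longrightarrow> T (component W U e) i = 1" "norm e = 1"
    "countable_dense S" "(\<lambda>t. t *\<^sub>R e) ` K \<subseteq> S"
    "linf_direct_sum.nonintegral_outside U W d T ((\<lambda>t. t *\<^sub>R e) ` K) S"
    "linf_direct_sum.fibred_outside U W d T ((\<lambda>t. t *\<^sub>R e) ` K) S"
    "\<And>x y. x \<in> S \<Longrightarrow> y \<in> S \<Longrightarrow> norm (x - y) \<in> {2, 3} \<Longrightarrow> x \<in> (\<lambda>t. t *\<^sub>R e) ` K \<and> y \<in> (\<lambda>t. t *\<^sub>R e) ` K"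
proof -
  interpret linf_direct_sum U W d T by (rule ds)
  obtain e where e: "u_part e = 0" "\<And>i. i < d \<Longrightarrow> cc e i = 1"
    using vector_exists[OF subspace_0[OF subspaces(1)], of "\<lambda>_. 1"] by blast
  have ne: "norm e = 1"
  proof (rule antisym)
    show "norm e \<le> 1" by (rule norm_le_iff[THEN iffD2]) (use e in auto)
    show "1 \<le> norm e" using cc_le_norm[OF d, of e] e(2)[OF d] by simp
  qed
  have cce: "cc (t *\<^sub>R e) i = t" if "i < d" for t i
    using linear_scale[OF linear_cc[of i], of t e] e(2)[OF that] by simp
  have ue: "u_part (t *\<^sub>R e) = 0" for t by (simp add: parts_scale e(1))
  obtain S0 where S0: "countable S0" "closure S0 = UNIV"
    and half: "\<And>x i. x \<in> S0 \<Longrightarrow> i < d \<Longrightarrow> 2 * cc x i \<notin> \<int>"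
    and gen: "nonintegral_outside {} S0" and fib: "fibred_outside {} S0"
    and dist: "\<And>x y. x \<in> S0 \<Longrightarrow> y \<in> S0 \<Longrightarrow> norm (u_part x - u_part y) \<notin> {2, 3}"
    and dist0: "\<And>x. x \<in> S0 \<Longrightarrow> norm (u_part x) \<notin> {2, 3}"
    using generic_fibred_set[OF ds d] by blast
  define F where "F = (\<lambda>t. t *\<^sub>R e) ` K"
  define S where "S = F \<union> S0"
  have mixed: "cc x i - cc y i \<notin> \<int>" "cc y i - cc x i \<notin> \<int>" if x: "x \<in> F" and y: "y \<in> S0" and i: "i < d" for x y i
  proof -
    obtain t where t: "t \<in> K" "x = t *\<^sub>R e" using x by (auto simp: F_def)
    have *: "2 * cc y i \<in> \<int>" if "cc x i - cc y i \<in> \<int>"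
    proof -
      have "2 * t - 2 * (cc x i - cc y i) \<in> \<int>" by (rule Ints_diff[OF K(2)[OF t(1)] Ints_mult[OF _ that]]) simp
      then show ?thesis using t(2) cce[OF i] by (simp add: algebra_simps)
    qed
    then show 1: "cc x i - cc y i \<notin> \<int>" using half[OF y i] by blast
    show "cc y i - cc x i \<notin> \<int>" using 1 Ints_minus[of "cc y i - cc x i"] by auto
  qed
  have genS: "cc x i - cc y i \<notin> \<int>" if "x \<in> S" "y \<in> S" "x \<noteq> y" "\<not> (x \<in> F \<and> y \<in> F)" "i < d" for x y i
    using that mixed nonintegral_outsideD[OF gen] unfolding S_def by blast
  show ?thesis
  proof (rule that[of e S], unfold F_def[symmetric])
    show "u_part e = 0" "norm e = 1" by fact+
    show "cc e i = 1" if "i < d" for i using e(2)[OF that] .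
    have "UNIV \<subseteq> closure S" using S0(2) closure_mono[of S0 S] by (auto simp: S_def)
    then show "countable_dense S" using S0(1) K(1) unfolding countable_dense_def by (auto simp: S_def F_def)
    show "F \<subseteq> S" by (simp add: S_def)
    show "nonintegral_outside F S" unfolding nonintegral_outside_def using genS by blast
    have "infinite (fibre_box S x l r)" if "x \<in> S - F" "\<forall>i<d. l i < r i" for x l r
    proof -
      have "x \<in> S0 - {}" using that(1) by (auto simp: S_def)
      from fibred_outsideD[OF fib this that(2)] show ?thesis
        by (rule infinite_super[rotated]) (auto simp: fibre_box_def S_def)
    qed
    then show "fibred_outside F S" unfolding fibred_outside_def by blast
    fix x y assume xy: "x \<in> S" "y \<in> S" "norm (x - y) \<in> {2, 3}"
    show "x \<in> F \<and> y \<in> F"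
    proof (rule ccontr)
      assume nF: "\<not> (x \<in> F \<and> y \<in> F)"
      have uF: "u_part z = 0" if "z \<in> F" for z using that ue by (auto simp: F_def)
      have "norm (u_part x - u_part y) \<notin> {2, 3}"
        using xy(1,2) nF dist[of x y] dist0[of x] dist0[of y] uF[of x] uF[of y]
        unfolding S_def by (auto simp: norm_minus_commute)
      then have "norm (u_part (x - y)) \<noteq> norm (x - y)" using xy(3) unfolding u_part_diff by metis
      then have eq: "linf_norm d (cc (x - y)) = norm (x - y)"
        using norm_parts[of "x - y"] unfolding norm_w_part by linarith
      then have "linf_norm d (cc (x - y)) > 0" using xy(3) by auto
      then obtain i where i: "i < d" "norm (x - y) = \<bar>cc x i - cc y i\<bar>"
        using linf_norm_attained eq unfolding cc_diff[symmetric] by metis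
      have "x \<noteq> y" using xy(3) by auto
      then have "cc x i - cc y i \<notin> \<int>" using genS xy(1,2) nF i(1) by blast
      moreover have int: "\<bar>cc x i - cc y i\<bar> \<in> \<int>" using i(2) xy(3) by auto
      have "cc x i - cc y i = \<bar>cc x i - cc y i\<bar> \<or> cc x i - cc y i = - \<bar>cc x i - cc y i\<bar>" by linarith
      then have "cc x i - cc y i \<in> \<int>" using int Ints_minus[OF int] by (elim disjE) simp_all
      ultimately show False by contradiction
    qed
  qed
qed

text \<open>
  A ball of radius \<open>2\<close> lies in a ball of radius \<open>m + 2\<close> if and only if the centres are at
  distance at most \<open>m\<close>. Thus weak inequalities are expressed by strict ones, and these are
  preserved by step isometries if \<open>m\<close> is an integer.
\<close>

lemma norm_le_iff_dense:
  fixes S :: "'v::real_normed_vector set"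
  assumes dense: "closure S = UNIV" and m: "m \<ge> 0"
  shows "norm (x - y) \<le> m \<longleftrightarrow> (\<forall>z\<in>S. norm (y - z) < 2 \<longrightarrow> norm (x - z) < m + 2)"
proof
  assume le: "norm (x - y) \<le> m"
  show "\<forall>z\<in>S. norm (y - z) < 2 \<longrightarrow> norm (x - z) < m + 2"
  proof (intro ballI impI)
    fix z assume "norm (y - z) < 2"
    then show "norm (x - z) < m + 2" using le norm_triangle_ineq[of "x - y" "y - z"] by simp
  qed
next
  assume *: "\<forall>z\<in>S. norm (y - z) < 2 \<longrightarrow> norm (x - z) < m + 2"
  show "norm (x - y) \<le> m"
  proof (rule ccontr)
    assume "\<not> norm (x - y) \<le> m"
    then have gt: "norm (x - y) > m" by simp
    define R where "R = norm (x - y)"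
    have R: "R > m" "R > 0" using gt m by (auto simp: R_def)
    define \<delta> where "\<delta> = min 1 ((R - m) / 2)"
    have "\<delta> \<le> (R - m) / 2" unfolding \<delta>_def by (rule min.cobounded2)
    then have \<delta>: "\<delta> > 0" "\<delta> \<le> 1" "2 * \<delta> \<le> R - m" using R by (auto simp: \<delta>_def)
    define z0 where "z0 = y + ((2 - \<delta>) / R) *\<^sub>R (y - x)"
    have "norm (y - z0) = norm (((2 - \<delta>) / R) *\<^sub>R (y - x))" by (simp add: z0_def)
    also have "\<dots> = (2 - \<delta>) / R * R" using \<delta> R by (simp add: R_def norm_minus_commute)
    finally have yz0: "norm (y - z0) = 2 - \<delta>" using R by simp
    have "x - z0 = (1 + (2 - \<delta>) / R) *\<^sub>R (x - y)" by (simp add: z0_def algebra_simps)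
    then have "norm (x - z0) = (1 + (2 - \<delta>) / R) * R" using \<delta> R by (simp add: R_def)
    then have xz0: "norm (x - z0) = R + 2 - \<delta>" using R by (simp add: distrib_right)
    obtain z where z: "z \<in> S" "norm (z - z0) < \<delta> / 2" using dense_approx[OF dense, of "\<delta> / 2"] \<delta>(1) by auto
    have "norm (y - z) \<le> norm (y - z0) + norm (z - z0)"
      using norm_triangle_ineq4[of "y - z0" "z - z0"] by simp
    then have "norm (y - z) < 2" using yz0 z(2) \<delta> by linarith
    then have lt: "norm (x - z) < m + 2" using * z(1) by blast
    have "norm (x - z0) \<le> norm (x - z) + norm (z - z0)"
      using norm_triangle_ineq[of "x - z" "z - z0"] by simp
    then show False using lt xz0 z(2) \<delta> by linarith
  qed
qed

lemma step_isometry_norm_eq: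
  fixes S :: "'v::real_normed_vector set" and k :: nat
  assumes dense: "closure S = UNIV" and f: "step_isometry f S" and x: "x \<in> S" and y: "y \<in> S" and k: "k \<ge> 2"
    and eq: "norm (x - y) = real k"
  shows "norm (f x - f y) = real k"
proof (rule antisym)
  have "\<not> norm (f x - f y) < real k" using step_isometryD(2)[OF f x y k] eq by simp
  then show "real k \<le> norm (f x - f y)" by simp
  have onto: "f ` S = S" using step_isometryD(1)[OF f] by (rule bij_betw_imp_surj_on)
  show "norm (f x - f y) \<le> real k"
    unfolding norm_le_iff_dense[OF dense of_nat_0_le_iff]
  proof
    fix w assume "w \<in> S"
    then obtain z where z: "z \<in> S" "w = f z" using onto by blast
    have "norm (y - z) < real 2 \<longleftrightarrow> norm (f y - f z) < real 2" by (rule step_isometryD(2)[OF f y z(1)]) simp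
    moreover have "norm (x - z) < real (k + 2) \<longleftrightarrow> norm (f x - f z) < real (k + 2)"
      by (rule step_isometryD(2)[OF f x z(1)]) simp
    moreover have "norm (y - z) < 2 \<longrightarrow> norm (x - z) < real k + 2"
      using norm_le_iff_dense[OF dense, of "real k" x y] eq z(1) by simp
    ultimately show "norm (f y - w) < 2 \<longrightarrow> norm (f x - w) < real k + 2" unfolding z(2) by (simp add: add.commute)
  qed
qed

lemma (in finite_dim_basis) exists_rado_set:
  fixes U W :: "'v set"
  assumes p: "0 < p" "p < 1" and ds: "linf_direct_sum U W d T" and d: "d > 0"
  shows "\<exists>S :: 'v set. countable_dense S \<and> rado p S"
proof -
  interpret linf_direct_sum U W d T by (rule ds)
  obtain S where S: "countable S" "closure S = UNIV" "nonintegral_outside {} S" "fibred_outside {} S"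
    by (rule generic_fibred_set[OF ds d], rule that, assumption+)
  have "countable_dense S" unfolding countable_dense_def using S(1,2) by (rule conjI)
  moreover have "rado p S" using p d S(1,3,4) by (rule rado_if_generic_and_fibred)
  ultimately show ?thesis by blast
qed

text \<open>
  Among the exceptional points the distance \<open>2\<close> occurs only between \<open>0\<close> and \<open>2 e\<close>, and the
  distance \<open>3\<close> only between \<open>e/2\<close> and \<open>7/2 e\<close>. Step isometries preserve these two pairs.
  Moreover \<open>0\<close> and \<open>7/2 e\<close> are not at distance less than \<open>2\<close>, whereas the other three
  connections between the two pairs are shorter than \<open>2\<close>; so every point is fixed. The only edge
  among the exceptional points joins \<open>0\<close> and \<open>e/2\<close>, and it decides about isomorphism.
\<close>

lemma (in finite_dim_basis) exists_intermediate_set: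
  fixes U W :: "'v set"
  assumes p: "0 < p" "p < 1" and ds: "linf_direct_sum U W d T" and d: "d > 0" and nz: "\<exists>u::'v. u \<noteq> 0"
  shows "\<exists>S :: 'v set. countable_dense S \<and> 0 < iso_prob p S \<and> iso_prob p S < 1"
proof -
  interpret linf_direct_sum U W d T by (rule ds)
  define K :: "real set" where "K = {0, 1/2, 2, 7/2}"
  have K1: "countable K" by (simp add: K_def)
  have K2: "2 * t \<in> \<int>" if "t \<in> K" for t
  proof -
    have "2 * t \<in> {0, 1, 4, 7}" using that by (auto simp: K_def)
    then show ?thesis by auto
  qed
  note K = K1 K2
  obtain e S where ne: "norm e = 1" and S: "countable_dense S" and FS: "(\<lambda>t. t *\<^sub>R e) ` K \<subseteq> S"
    and gen: "nonintegral_outside ((\<lambda>t. t *\<^sub>R e) ` K) S"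
    and fib: "fibred_outside ((\<lambda>t. t *\<^sub>R e) ` K) S"
    and dist: "\<And>x y. x \<in> S \<Longrightarrow> y \<in> S \<Longrightarrow> norm (x - y) \<in> {2, 3} \<Longrightarrow> x \<in> (\<lambda>t. t *\<^sub>R e) ` K \<and> y \<in> (\<lambda>t. t *\<^sub>R e) ` K"
    by (rule exceptional_set[OF ds d K]) blast+
  have dense: "closure S = UNIV" and count: "countable S" using S by (auto simp: countable_dense_def)
  let ?v = "\<lambda>t. t *\<^sub>R e"
  have norm_v: "norm (?v s - ?v t) = \<bar>s - t\<bar>" for s t by (simp add: ne flip: scaleR_diff_left)
  have vS: "?v t \<in> S" if "t \<in> K" for t using FS that by blast
  have inS: "?v 0 \<in> S" "?v (1/2) \<in> S" "?v 2 \<in> S" "?v (7/2) \<in> S" by (rule vS, simp add: K_def)+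
  let ?e = "{?v 0, ?v (1/2)}"
  have eE: "?e \<in> unit_edges S"
  proof -
    have "norm (?v 0 - ?v (1/2)) = 1/2" unfolding norm_v by simp
    moreover from this have "?v 0 \<noteq> ?v (1/2)" by auto
    ultimately show ?thesis unfolding unit_edges_pair_iff using inS by simp
  qed
  have fix_F: "f (?v 0) = ?v 0 \<and> f (?v (1/2)) = ?v (1/2)" if f: "step_isometry f S" for f
  proof -
    have fS: "f x \<in> S" if "x \<in> S" for x using step_isometryD(1)[OF f] that by (auto dest: bij_betwE)
    have lt2: "norm (x - y) < 2 \<longleftrightarrow> norm (f x - f y) < 2" if "x \<in> S" "y \<in> S" for x y
      using step_isometryD(2)[OF f that, of 2] by simp
    have "norm (f (?v 0) - f (?v 2)) = 2"
      using step_isometry_norm_eq[OF dense f inS(1,3), of 2] unfolding norm_v by simp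
    moreover from this obtain s t where st: "s \<in> K" "t \<in> K" "f (?v 0) = ?v s" "f (?v 2) = ?v t"
      using dist[OF fS[OF inS(1)] fS[OF inS(3)]] by auto
    ultimately have "\<bar>s - t\<bar> = 2" using norm_v by simp
    then have s: "s = 0 \<or> s = 2" using st(1,2) by (auto simp: K_def)
    have "norm (f (?v (1/2)) - f (?v (7/2))) = 3"
      using step_isometry_norm_eq[OF dense f inS(2,4), of 3] unfolding norm_v by simp
    moreover from this obtain s' t' where st': "s' \<in> K" "t' \<in> K" "f (?v (1/2)) = ?v s'" "f (?v (7/2)) = ?v t'"
      using dist[OF fS[OF inS(2)] fS[OF inS(4)]] by auto
    ultimately have "\<bar>s' - t'\<bar> = 3" using norm_v by simp
    then have s't': "s' = 1/2 \<and> t' = 7/2 \<or> s' = 7/2 \<and> t' = 1/2" using st'(1,2) by (auto simp: K_def)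
    have far: "\<not> \<bar>s - t'\<bar> < 2"
      using lt2[OF inS(1,4)] unfolding st(3) st'(4) norm_v by simp
    then have "s' = 1/2 \<and> s = 0" using s s't' by auto
    then show ?thesis using st(3) st'(3) by simp
  qed
  have edges_F: "a = ?v 0 \<and> b = ?v (1/2) \<or> a = ?v (1/2) \<and> b = ?v 0"
    if ab: "a \<in> ?v ` K" "b \<in> ?v ` K" "{a, b} \<in> unit_edges S" for a b
  proof -
    obtain s t where st: "s \<in> K" "t \<in> K" "a = ?v s" "b = ?v t" using ab(1,2) by blast
    have "\<bar>s - t\<bar> < 1" "s \<noteq> t" using ab(3) unfolding unit_edges_pair_iff st(3,4) norm_v by auto
    then have "s = 0 \<and> t = 1/2 \<or> s = 1/2 \<and> t = 0" using st(1,2) by (auto simp: K_def)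
    then show ?thesis using st by auto
  qed
  have agree_iff: "(\<forall>a\<in>?v ` K. \<forall>b\<in>?v ` K. {a, b} \<in> kept_edges S \<omega> \<longleftrightarrow> {a, b} \<in> kept_edges S \<omega>')"
    if eq: "?e \<in> kept_edges S \<omega> \<longleftrightarrow> ?e \<in> kept_edges S \<omega>'" for \<omega> \<omega>'
  proof (intro ballI)
    fix a b assume ab: "a \<in> ?v ` K" "b \<in> ?v ` K"
    show "{a, b} \<in> kept_edges S \<omega> \<longleftrightarrow> {a, b} \<in> kept_edges S \<omega>'"
    proof (cases "{a, b} \<in> unit_edges S")
      case True
      from edges_F[OF ab this] have "{a, b} = ?e" by (elim disjE conjE) (simp_all add: insert_commute)
      then show ?thesis using eq by simp
    qed (simp add: kept_edges_def)
  qed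
  have finF: "finite (?v ` K)" by (simp add: K_def)
  have extend: "AE x in random_graph_pair p S.
    (\<forall>a\<in>?v ` K. \<forall>b\<in>?v ` K. {a, b} \<in> kept_edges S (fst x) \<longleftrightarrow> {a, b} \<in> kept_edges S (snd x)) \<longrightarrow>
    graph_isomorphic S (kept_edges S (fst x)) (kept_edges S (snd x))"
    by (rule isomorphic_if_agree_on_exceptional[OF p d count finF FS gen fib])
  have "AE x in random_graph_pair p S.
    graph_isomorphic S (kept_edges S (fst x)) (kept_edges S (snd x)) \<longleftrightarrow>
    (?e \<in> kept_edges S (fst x) \<longleftrightarrow> ?e \<in> kept_edges S (snd x))"
    using AE_isomorphism_is_step_isometry[OF p nz S] extend
  proof eventually_elim
    case (elim x)
    show ?case
    proof
      assume "graph_isomorphic S (kept_edges S (fst x)) (kept_edges S (snd x))"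
      then obtain f where f: "bij_betw f S S"
        "\<forall>y\<in>S. \<forall>z\<in>S. {y, z} \<in> kept_edges S (fst x) \<longleftrightarrow> {f y, f z} \<in> kept_edges S (snd x)"
        unfolding graph_isomorphic_def by blast
      then have "step_isometry f S" using elim(1) by blast
      from fix_F[OF this] bspec[OF bspec[OF f(2) inS(1)] inS(2)]
      show "?e \<in> kept_edges S (fst x) \<longleftrightarrow> ?e \<in> kept_edges S (snd x)" by simp
    next
      assume "?e \<in> kept_edges S (fst x) \<longleftrightarrow> ?e \<in> kept_edges S (snd x)"
      from elim(2)[THEN mp, OF agree_iff[OF this]]
      show "graph_isomorphic S (kept_edges S (fst x)) (kept_edges S (snd x))" .
    qed
  qed
  with S iso_prob_strictly_between[OF p eE] show ?thesis by blast
qed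

text \<open>
  Let \<open>\<phi>\<close> be a signed coordinate and let \<open>\<phi> y - \<phi> x\<close> be an integer \<open>k\<close>. If \<open>\<phi> (B (f y)) - \<phi> (B
  (f x))\<close> were different from \<open>k\<close>, some \<open>z\<close> of \<open>S\<close> would have \<open>\<phi> (B (f z))\<close> strictly between \<open>\<phi>
  (B (f y))\<close> and \<open>\<phi> (B (f x)) + k\<close>. Monotonicity, applied to \<open>z\<close> and \<open>y\<close> and to \<open>z\<close> and \<open>x\<close>,
  then forces \<open>\<phi> z = \<phi> y\<close>, and injectivity of the coordinate gives \<open>z = y\<close>.
\<close>

lemma (in finite_dim_basis) step_isometry_integer_displacement:
  fixes U W :: "'v set"
  assumes ds: "linf_direct_sum U W d T" and U: "U = {0}" and nz: "\<exists>u::'v. u \<noteq> 0" and dense: "closure S = UNIV"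
    and f: "step_isometry f S"
    and e: "\<And>i. i < d \<Longrightarrow> T (component W U e) i = 1"
    and inj: "\<And>x y i. x \<in> S \<Longrightarrow> y \<in> S \<Longrightarrow> x \<noteq> y \<Longrightarrow> i < d \<Longrightarrow> T (component W U x) i \<noteq> T (component W U y) i"
  shows "\<exists>B. linear B \<and> inj B \<and> (\<forall>x\<in>S. \<forall>y\<in>S. \<forall>n::int. y - x = of_int n *\<^sub>R e \<longrightarrow> B (f y - f x) = of_int n *\<^sub>R e)"
proof -
  interpret linf_direct_sum U W d T by (rule ds)
  from step_isometry_structure[OF dense nz f]
  obtain B K where B: "linear B" and normB: "\<forall>y. norm (B y) = norm y"
    and mono: "\<forall>\<phi>\<in>smooth_functionals. \<forall>x\<in>S. \<forall>y\<in>S. \<forall>m.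
      \<phi> x - \<phi> y > of_int m \<longrightarrow> \<phi> (B (f x)) - \<phi> (B (f y)) \<ge> of_int m"
    by (elim exE conjE) (rule that)
  have onto: "f ` S = S" using step_isometryD(1)[OF f] by (rule bij_betw_imp_surj_on)
  have surj: "surj B" using B normB by (intro linear_isometry_surj) auto
  have injB: "inj B" using B normB by (intro linear_isometry_inj) auto
  have key: "\<phi> (B (f y)) - \<phi> (B (f x)) = of_int k"
    if \<phi>: "\<phi> \<in> smooth_functionals" and k: "\<phi> y - \<phi> x = of_int k" and \<phi>e: "\<phi> e \<noteq> 0"
      and inj\<phi>: "\<And>x y. x \<in> S \<Longrightarrow> y \<in> S \<Longrightarrow> \<phi> x = \<phi> y \<Longrightarrow> x = y" and x: "x \<in> S" and y: "y \<in> S" for \<phi> x y k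
  proof -
    have lin: "linear \<phi>" using \<phi> by (rule smooth_functional_linear)
    have m: "\<phi> (B (f a)) - \<phi> (B (f b)) \<ge> of_int m" if "a \<in> S" "b \<in> S" "\<phi> a - \<phi> b > of_int m" for a b m
      using mono[rule_format, OF \<phi> that] .
    have between: "\<exists>z\<in>S. \<alpha> < \<phi> (B (f z)) \<and> \<phi> (B (f z)) < \<beta>" if \<alpha>\<beta>: "\<alpha> < \<beta>" for \<alpha> \<beta>
    proof -
      obtain w where w: "B w = e" using surj by (metis surjD)
      define q where "q = ((\<alpha> + \<beta>) / 2 / \<phi> e) *\<^sub>R w"
      have "\<phi> (B q) = (\<alpha> + \<beta>) / 2" unfolding q_def using \<phi>e by (simp add: linear_scale[OF B] linear_scale[OF lin] w)
      moreover obtain s where s: "s \<in> S" "norm (s - q) < (\<beta> - \<alpha>) / 2"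
        using dense_approx[OF dense, of "(\<beta> - \<alpha>) / 2" q] \<alpha>\<beta> by auto
      moreover have "\<bar>\<phi> (B (s - q))\<bar> \<le> norm (s - q)"
        using smooth_functional_abs_le[OF \<phi>, of "B (s - q)"] normB by simp
      then have "\<bar>\<phi> (B s) - \<phi> (B q)\<bar> \<le> norm (s - q)" unfolding linear_diff[OF B] linear_diff[OF lin] .
      ultimately have b: "\<alpha> < \<phi> (B s)" "\<phi> (B s) < \<beta>" by (simp_all add: abs_less_iff)
      obtain z where "z \<in> S" "s = f z" using s(1) onto by blast
      then show ?thesis using b by blast
    qed
    show ?thesis
    proof (rule antisym; rule ccontr)
      assume "\<not> \<phi> (B (f y)) - \<phi> (B (f x)) \<le> of_int k"
      then have "\<phi> (B (f x)) + of_int k < \<phi> (B (f y))" by linarith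
      from between[OF this] obtain z where z: "z \<in> S" "\<phi> (B (f x)) + of_int k < \<phi> (B (f z))" "\<phi> (B (f z)) < \<phi> (B (f y))"
        by blast
      have "\<phi> z \<le> \<phi> y" using m[OF z(1) y, of 0] z(3) by fastforce
      moreover have "\<phi> z \<ge> \<phi> y" using m[OF x z(1), of "-k"] z(2) k by fastforce
      ultimately have "z = y" using inj\<phi>[OF z(1) y] by simp
      then show False using z(3) by simp
    next
      assume "\<not> of_int k \<le> \<phi> (B (f y)) - \<phi> (B (f x))"
      then have "\<phi> (B (f y)) < \<phi> (B (f x)) + of_int k" by linarith
      from between[OF this] obtain z where z: "z \<in> S" "\<phi> (B (f y)) < \<phi> (B (f z))" "\<phi> (B (f z)) < \<phi> (B (f x)) + of_int k"
        by blast
      have "\<phi> z \<ge> \<phi> y" using m[OF y z(1), of 0] z(2) by fastforce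
      moreover have "\<phi> z \<le> \<phi> y" using m[OF z(1) x, of k] z(3) k by fastforce
      ultimately have "z = y" using inj\<phi>[OF z(1) y] by simp
      then show False using z(2) by simp
    qed
  qed
  have "B (f y - f x) = of_int n *\<^sub>R e" if x: "x \<in> S" and y: "y \<in> S" and n: "y - x = of_int n *\<^sub>R e" for x y and n :: int
  proof (rule smooth_functionals_separate)
    fix \<phi> :: "'v \<Rightarrow> real" assume \<phi>: "\<phi> \<in> smooth_functionals"
    have lin: "linear \<phi>" using \<phi> by (rule smooth_functional_linear)
    have \<phi>n: "\<phi> y - \<phi> x = of_int n * \<phi> e" using arg_cong[OF n, of \<phi>] by (simp add: linear_diff[OF lin] linear_scale[OF lin])
    have goal: "\<phi> (B (f y - f x)) = \<phi> (B (f y)) - \<phi> (B (f x))" by (simp add: linear_diff[OF B] linear_diff[OF lin])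
    show "\<phi> (B (f y - f x)) = \<phi> (of_int n *\<^sub>R e)"
    proof (rule disjE[OF smooth_functional_cases[OF \<phi> nz]])
      assume van: "\<forall>w\<in>W. \<phi> w = 0"
      have "v \<in> W" for v using parts(1)[of v] U by (simp add: in_W_iff)
      then have "\<phi> v = 0" for v using van by blast
      then show ?thesis by simp
    next
      assume "\<exists>i<d. \<phi> = (\<lambda>v. cc v i) \<or> \<phi> = (\<lambda>v. - cc v i)"
      then obtain i where i: "i < d" "\<phi> = (\<lambda>v. cc v i) \<or> \<phi> = (\<lambda>v. - cc v i)" by (elim exE conjE) (rule that)
      define \<sigma> :: int where "\<sigma> = (if \<phi> = (\<lambda>v. cc v i) then 1 else -1)"
      have \<sigma>: "\<phi> v = of_int \<sigma> * cc v i" for v using i(2) by (auto simp: \<sigma>_def)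
      have \<sigma>nz: "\<sigma> \<noteq> 0" by (simp add: \<sigma>_def)
      have \<phi>e: "\<phi> e = of_int \<sigma>" using \<sigma>[of e] e[OF i(1)] by simp
      have "\<phi> (B (f y)) - \<phi> (B (f x)) = of_int (n * \<sigma>)"
      proof (rule key[OF \<phi> _ _ _ x y])
        show "\<phi> y - \<phi> x = of_int (n * \<sigma>)" using \<phi>n \<phi>e by simp
        show "\<phi> e \<noteq> 0" using \<phi>e \<sigma>nz by simp
        show "a = b" if "a \<in> S" "b \<in> S" "\<phi> a = \<phi> b" for a b
          using inj[OF that(1,2) _ i(1)] that(3) \<sigma>[of a] \<sigma>[of b] \<sigma>nz by auto
      qed
      then show ?thesis unfolding goal by (simp add: linear_scale[OF lin] \<phi>e)
    qed
  qed
  with B injB show ?thesis by blast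
qed

text \<open>
  A step isometry maps \<open>n e\<close> and \<open>n e + e/2\<close> to \<open>f 0 + n c\<close> and \<open>f (e/2) + n c\<close>, where \<open>c = f e
  - f 0\<close>. So the images of the edges between these points are determined by three points of \<open>S\<close>.
\<close>

lemma (in finite_dim_basis) exists_strongly_non_rado_set:
  fixes U W :: "'v set"
  assumes p: "0 < p" "p < 1" and ds: "linf_direct_sum U W d T" and d: "d > 0" and nz: "\<exists>u::'v. u \<noteq> 0"
    and U: "U = {0}"
  shows "\<exists>S :: 'v set. countable_dense S \<and> strongly_non_rado p S"
proof -
  interpret linf_direct_sum U W d T by (rule ds)
  define K :: "real set" where "K = range (\<lambda>n::nat. real n / 2)"
  have K: "countable K" "\<And>t. t \<in> K \<Longrightarrow> 2 * t \<in> \<int>" by (auto simp: K_def)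
  obtain e S where e1: "\<And>i. i < d \<Longrightarrow> cc e i = 1" and ne: "norm e = 1" and S: "countable_dense S"
    and FS: "(\<lambda>t. t *\<^sub>R e) ` K \<subseteq> S"
    and gen: "nonintegral_outside ((\<lambda>t. t *\<^sub>R e) ` K) S"
    by (rule exceptional_set[OF ds d K]) blast+
  have dense: "closure S = UNIV" and count: "countable S" using S by (auto simp: countable_dense_def)
  let ?v = "\<lambda>t. t *\<^sub>R e"
  have ccv: "cc (?v t) i = t" if "i < d" for t i
    using linear_scale[OF linear_cc[of i], of t e] e1[OF that] by simp
  have inj: "cc x i \<noteq> cc y i" if "x \<in> S" "y \<in> S" "x \<noteq> y" "i < d" for x y i
  proof (cases "x \<in> ?v ` K \<and> y \<in> ?v ` K")
    case True
    then obtain s t where "x = ?v s" "y = ?v t" by blast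
    then show ?thesis using that(3,4) ccv by auto
  next
    case False
    then show ?thesis using nonintegral_outsideD[OF gen that(1-3) False that(4)] by auto
  qed
  have vS: "?v (real n / 2) \<in> S" for n :: nat using FS by (auto simp: K_def)
  define a where "a = (\<lambda>n::nat. ?v (real n))"
  define b where "b = (\<lambda>n::nat. ?v (real n + 1/2))"
  have aS: "a n \<in> S" for n using vS[of "2 * n"] by (simp add: a_def)
  have bS: "b n \<in> S" for n using vS[of "2 * n + 1"] by (simp add: b_def add_divide_distrib add.commute)
  have norm_v: "norm (?v s - ?v t) = \<bar>s - t\<bar>" for s t by (simp add: ne flip: scaleR_diff_left)
  define E where "E = (\<lambda>n. {a n, b n})"
  have EE: "E n \<in> unit_edges S" for n
  proof -
    have "norm (a n - b n) = 1/2" unfolding a_def b_def norm_v by simp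
    moreover from this have "a n \<noteq> b n" by auto
    ultimately show ?thesis unfolding E_def unit_edges_pair_iff using aS bS by simp
  qed
  have injE: "inj E"
  proof (rule injI)
    fix m n assume "E m = E n"
    then have "a m = a n \<or> a m = b n \<and> b m = a n" unfolding E_def by (auto simp: doubleton_eq_iff)
    then have "\<bar>real m - real n\<bar> = 0 \<or> \<bar>real m - (real n + 1/2)\<bar> = 0 \<and> \<bar>real m + 1/2 - real n\<bar> = 0"
      unfolding a_def b_def by (metis norm_v norm_zero right_minus_eq)
    then show "m = n" by auto
  qed
  have image: "f ` E n = {f (a 0) + real n *\<^sub>R (f (a 1) - f (a 0)), f (b 0) + real n *\<^sub>R (f (a 1) - f (a 0))}"
    if f: "step_isometry f S" for f n
  proof -
    from step_isometry_integer_displacement[OF ds U nz dense f e1 inj]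
    obtain B where B: "linear B" "inj B"
      and disp: "\<forall>x\<in>S. \<forall>y\<in>S. \<forall>n::int. y - x = of_int n *\<^sub>R e \<longrightarrow> B (f y - f x) = of_int n *\<^sub>R e" by blast
    have one: "B (f (a 1) - f (a 0)) = e"
      using disp[rule_format, OF aS[of 0] aS[of 1], of 1] by (simp add: a_def)
    have gen_n: "f y = f x + real n *\<^sub>R (f (a 1) - f (a 0))" if "x \<in> S" "y \<in> S" "y - x = real n *\<^sub>R e" for x y
    proof -
      have "B (f y - f x) = real n *\<^sub>R e" using disp[rule_format, OF that(1,2), of "int n"] that(3) by simp
      also have "\<dots> = B (real n *\<^sub>R (f (a 1) - f (a 0)))" unfolding linear_scale[OF B(1)] one by (rule refl)
      finally have "B (f y - f x) = B (real n *\<^sub>R (f (a 1) - f (a 0)))" .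
      then have "f y - f x = real n *\<^sub>R (f (a 1) - f (a 0))" using B(2) by (simp add: inj_eq)
      then show ?thesis by (simp add: algebra_simps)
    qed
    have "f (a n) = f (a 0) + real n *\<^sub>R (f (a 1) - f (a 0))" by (rule gen_n[OF aS aS]) (simp add: a_def)
    moreover have "f (b n) = f (b 0) + real n *\<^sub>R (f (a 1) - f (a 0))"
      by (rule gen_n[OF bS bS]) (simp add: b_def algebra_simps)
    ultimately show ?thesis by (simp add: E_def)
  qed
  let ?g = "\<lambda>(q, r, s) (n::nat). {q + real n *\<^sub>R (s - q), r + real n *\<^sub>R (s - q)}"
  have "(\<lambda>f (n::nat). f ` E n) ` {f. step_isometry f S} \<subseteq> ?g ` (S \<times> S \<times> S)"
  proof
    fix h assume "h \<in> (\<lambda>f (n::nat). f ` E n) ` {f. step_isometry f S}"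
    then obtain f where f: "step_isometry f S" "h = (\<lambda>n. f ` E n)" by blast
    have fS: "f x \<in> S" if "x \<in> S" for x using step_isometryD(1)[OF f(1)] that by (auto dest: bij_betwE)
    have "h = ?g (f (a 0), f (b 0), f (a 1))" unfolding f(2) using image[OF f(1)] by auto
    then show "h \<in> ?g ` (S \<times> S \<times> S)" using fS aS bS by blast
  qed
  then have cnt: "countable ((\<lambda>f (n::nat). f ` E n) ` {f. step_isometry f S})"
    by (rule countable_subset) (intro countable_image countable_SIGMA count)
  have "range E \<subseteq> unit_edges S" using EE by blast
  from strongly_non_radoI[OF p nz S injE this cnt] S show ?thesis by blast
qed

theorem theorem2:
  fixes U W :: "'v::real_normed_vector set"
    and d :: nat
    and T :: "'v \<Rightarrow> nat \<Rightarrow> real"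
    and p :: real
    and almost_all :: "('v set \<Rightarrow> bool) \<Rightarrow> bool"
  assumes finite_dimensional: "\<exists>B :: 'v set. finite B \<and> span B = UNIV"
    and nonzero: "\<exists>v :: 'v. v \<noteq> 0"
    and decomposition: "linf_decomposition U W d T"
    and p: "0 < p" "p < 1"
    and almost_all: "almost_all_notion U W d T almost_all"
  shows
    "(U = {0} \<longrightarrow>
        almost_all (\<lambda>S. rado p S) \<and>
        (\<exists>S :: 'v set. countable_dense S \<and> strongly_non_rado p S) \<and>
        (\<exists>S :: 'v set. countable_dense S \<and> 0 < iso_prob p S \<and> iso_prob p S < 1)) \<and>
     (d = 0 \<longrightarrow>
        (\<forall>S :: 'v set. countable_dense S \<longrightarrow> strongly_non_rado p S)) \<and>
     (d > 0 \<and> U \<noteq> {0} \<longrightarrow>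
        almost_all (\<lambda>S. strongly_non_rado p S) \<and>
        (\<exists>S :: 'v set. countable_dense S \<and> rado p S) \<and>
        (\<exists>S :: 'v set. countable_dense S \<and> 0 < iso_prob p S \<and> iso_prob p S < 1))"
proof -
  obtain Bs :: "'v set" where fd: "finite_dim_basis Bs"
    using finite_dim_basis_exists[OF finite_dimensional] by blast
  interpret finite_dim_basis Bs by (rule fd)
  have ds: "linf_direct_sum U W d T"
    using decomposition by unfold_locales (auto simp: linf_decomposition_def)
  interpret linf_direct_sum U W d T by (rule ds)
  have almost_allI: "almost_all Q" if "\<And>S. countable_dense S \<Longrightarrow> generic_set U W d T S \<Longrightarrow> Q S" for Q
  proof -
    have "almost_all (generic_set U W d T) \<and> (\<forall>S. countable_dense S \<and> generic_set U W d T S \<longrightarrow> Q S)"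
      using almost_all that unfolding almost_all_notion_def by blast
    then show ?thesis using almost_all unfolding almost_all_notion_def by blast
  qed
  have non_rado: "strongly_non_rado p S" if "countable_dense S" "inj_on u_part S" for S
    by (rule strongly_non_rado_if_inj[OF p decomposition fd nonzero that])
  have "almost_all (\<lambda>S. rado p S) \<and> (\<exists>S :: 'v set. countable_dense S \<and> strongly_non_rado p S) \<and>
      (\<exists>S :: 'v set. countable_dense S \<and> 0 < iso_prob p S \<and> iso_prob p S < 1)" if U: "U = {0}"
  proof -
    have u0: "u_part v = 0" for v using parts(1)[of v] U by simp
    have d: "d > 0"
    proof (rule ccontr)
      assume "\<not> d > 0"
      then have "v = 0" for v :: 'v
        by (intro vector_eqI[of v 0]) (simp add: u0, simp)
      then show False using nonzero by blast
    qed
    have "rado p S" if S: "countable_dense S" and gen: "generic_set U W d T S" for S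
    proof -
      have count: "countable S" and dense: "closure S = UNIV" using S by (auto simp: countable_dense_def)
      have "nonintegral_outside {} S"
        using gen unfolding generic_set_def nonintegral_outside_def by blast
      moreover have "fibred_outside {} S"
        unfolding fibred_outside_def using fibre_box_infinite_if_no_complement[OF U nonzero dense] by blast
      ultimately show ?thesis by (rule rado_if_generic_and_fibred[OF p d count])
    qed
    then have "almost_all (\<lambda>S. rado p S)" by (rule almost_allI)
    with exists_strongly_non_rado_set[OF p ds d nonzero U] exists_intermediate_set[OF p ds d nonzero]
    show ?thesis by blast
  qed
  moreover have "strongly_non_rado p S" if d0: "d = 0" and S: "countable_dense S" for S :: "'v set"
  proof (rule non_rado[OF S])
    show "inj_on u_part S"
    proof (rule inj_onI)
      fix x y assume "u_part x = u_part y"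
      then show "x = y" by (rule vector_eqI) (simp add: d0)
    qed
  qed
  moreover have "almost_all (\<lambda>S. strongly_non_rado p S) \<and> (\<exists>S :: 'v set. countable_dense S \<and> rado p S) \<and>
      (\<exists>S :: 'v set. countable_dense S \<and> 0 < iso_prob p S \<and> iso_prob p S < 1)" if d: "d > 0" and U: "U \<noteq> {0}"
  proof -
    have "strongly_non_rado p S" if S: "countable_dense S" and gen: "generic_set U W d T S" for S
    proof (rule non_rado[OF S])
      show "inj_on u_part S" using gen U unfolding generic_set_def by (intro inj_onI) blast
    qed
    then have "almost_all (\<lambda>S. strongly_non_rado p S)" by (rule almost_allI)
    with exists_rado_set[OF p ds d] exists_intermediate_set[OF p ds d nonzero] show ?thesis by blast
  qed
  ultimately show ?thesis by blast
qed

end
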